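(* Let $H$ be a real Hilbert space, $V\subset H$ an open neighborhood of the origin $\theta$, and let $\mathcal{L}\in C^1(V,\mathbb{R})$ with $\mathcal{L}'(\theta)=0$ satisfy Hypothesis (A) of the context (with $B=P+Q$). Let $H=H^+\oplus H^0\oplus H^-$ be the decomposition associated with $B(\theta)$, let $P^0$ be the orthogonal projection onto $H^0$, and suppose $\nu:=\dim H^0\neq0$. Then there exist small positive numbers $\epsilon,r,s$, a unique continuous map $\varphi:B_{H^0}(\theta,\epsilon)\to H^+\oplus H^-$ satisfying $$\varphi(\theta)=\theta\quad\text{and}\quad (I-P^0)\nabla\mathcal{L}(z+\varphi(z))=0\quad\forall z\in B_{H^0}(\theta,\epsilon),$$ an open neighborhood $W$ of $\theta$ in $H$ and an origin-preserving homeomorphism $$\Phi:B_{H^0}(\theta,\epsilon)\times\left(B_{H^+}(\theta,r)+B_{H^-}(\theta,s)\right)\to W$$ of the form $\Phi(z,u^++u^-)=z+\varphi(z)+\phi_z(u^++u^-)$ with $\phi_z(u^++u^-)\in H^+\oplus H^-$, such that $$\mathcal{L}\circ\Phi(z,u^++u^-)=\|u^+\|^2-\|u^-\|^2+\mathcal{L}(z+\varphi(z))$$ for all $(z,u^++u^-)\in B_{H^0}(\theta,\epsilon)\times(B_{H^+}(\theta,r)+B_{H^-}(\theta,s))$. Moreover, $\varphi$ is of class $C^{1-0}$, and: (a) for each $z\in B_{H^0}(\theta,\epsilon)$, $\Phi(z,\theta)=z+\varphi(z)$, and $\phi_z(u^++u^-)\in H^-$ if and only if $u^+=\theta$; (b)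 the functional $B_{H^0}(\theta,\epsilon)\ni z\mapsto\mathcal{L}^\circ(z):=\mathcal{L}(z+\varphi(z))$ is of class $C^1$ and $D\mathcal{L}^\circ(z)[v]=D\mathcal{L}(z+\varphi(z))[v]$ for all $v\in H^0$; if $\mathcal{L}$ is of class $C^{2-0}$, so is $\mathcal{L}^\circ$.
   Context: Notation: $(\cdot,\cdot)_H$, $\|\cdot\|$ are the inner product and norm of $H$; $\mathscr{L}_s(H)$ is the space of bounded self-adjoint operators on $H$; $B_Y(\theta,r)$ is the open ball of radius $r$ centred at the origin of $Y$; $\nabla\mathcal{L}$ is the gradient. $C^{1-0}$ means locally Lipschitz; $C^{2-0}$ means $C^1$ with locally Lipschitz derivative. Hypothesis (A) (case $X=H$): $\nabla\mathcal{L}:V\to H$ has a Gâteaux derivative $B(u)\in\mathscr{L}_s(H)$ at every $u\in V$, and $B=P+Q$, where for each $x\in V$, $P(x)\in\mathscr{L}_s(H)$ is positive definite (spectrum contained in $(0,\infty)$) and $Q(x)\in\mathscr{L}_s(H)$ is compact, and: (D2) for any sequence $(x_k)\subset V$ with $\|x_k\|\to0$, $\|P(x_k)u-P(\theta)u\|\to0$ for every $u\in H$; (D3) $Q:V\to\mathscr{L}(H)$ is continuous at $\theta$; (D4) for any sequence $(x_k)\subset V$ with $\|x_k\|\to0$ there exist $C_0>0$, $k_0\in\mathbb{N}$ with $(P(x_k)u,u)_H\ge C_0\|u\|^2$ for all $u\in H$, $k\ge k_0$. $H^+,H^0,H^-$ are the positive definite, null and negative definite spaces of $B(\theta)$ (orthogonal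 decomposition; $H^0$ and $H^-$ are finite dimensional under (A)). *)

theory Defs
  imports "HOL-Analysis.Analysis"
begin

section \<open>Differentiability classes\<close>

text \<open>
  The next three notions are used for sets \<open>S\<close> that are open in the whole space or relatively
  open in a closed subspace \<open>E\<close> of a Hilbert space.  In the second case the derivative at a point
  is an element of the dual of \<open>E\<close>, and the witness \<open>f'\<close> is an extension of it to the whole space:
  only its values on \<open>E\<close> are determined.  Restriction to \<open>E\<close> does not increase norms, and
  composing with the orthogonal projection onto \<open>E\<close> is a linear norm-preserving extension, so
  continuity and local Lipschitz continuity of the derivative mean the same in both readings.
\<close>

definition C1_on :: "'a::real_normed_vector set \<Rightarrow> ('a \<Rightarrow> real) \<Rightarrow> bool" where
  "C1_on S f \<longleftrightarrow> (\<exists>f' :: 'a \<Rightarrow> 'a \<Rightarrow>\<^sub>L real.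
     (\<forall>x\<in>S. (f has_derivative blinfun_apply (f' x)) (at x within S)) \<and> continuous_on S f')"

definition locally_lipschitz_on :: "'a::metric_space set \<Rightarrow> ('a \<Rightarrow> 'b::metric_space) \<Rightarrow> bool" where
  "locally_lipschitz_on S f \<longleftrightarrow> (\<forall>x\<in>S. \<exists>u>0. \<exists>C. C-lipschitz_on (cball x u \<inter> S) f)"

definition C2m_on :: "'a::real_normed_vector set \<Rightarrow> ('a \<Rightarrow> real) \<Rightarrow> bool" where
  \<comment> \<open>the class \<open>C\<^bsup>2-0\<^esup>\<close>\<close>
  "C2m_on S f \<longleftrightarrow> (\<exists>f' :: 'a \<Rightarrow> 'a \<Rightarrow>\<^sub>L real.
     (\<forall>x\<in>S. (f has_derivative blinfun_apply (f' x)) (at x within S)) \<and> locally_lipschitz_on S f')"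

definition gradient :: "('a::real_inner \<Rightarrow> real) \<Rightarrow> 'a \<Rightarrow> 'a" where
  "gradient f x = (THE D. GDERIV f x :> D)"

definition has_gateaux_derivative ::
  "('a::real_normed_vector \<Rightarrow> 'b::real_normed_vector) \<Rightarrow> ('a \<Rightarrow>\<^sub>L 'b) \<Rightarrow> 'a \<Rightarrow> bool" where
  "has_gateaux_derivative F A x \<longleftrightarrow>
     (\<forall>v. ((\<lambda>t::real. (F (x + t *\<^sub>R v) - F x) /\<^sub>R t) \<longlongrightarrow> blinfun_apply A v) (at 0))"

section \<open>Bounded operators on a real Hilbert space\<close>

definition selfadjoint :: "('a::real_inner \<Rightarrow>\<^sub>L 'a) \<Rightarrow> bool" where
  "selfadjoint A \<longleftrightarrow> (\<forall>x y. inner (blinfun_apply A x) y = inner x (blinfun_apply A y))"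

text \<open>
  The real spectrum.  For a self-adjoint operator it coincides with the spectrum of the
  complexification, which is contained in the reals.
\<close>

definition op_spectrum :: "('a::real_normed_vector \<Rightarrow>\<^sub>L 'a) \<Rightarrow> real set" where
  "op_spectrum A = {c. \<not> (\<exists>R. R o\<^sub>L (A - c *\<^sub>R id_blinfun) = id_blinfun \<and>
                              (A - c *\<^sub>R id_blinfun) o\<^sub>L R = id_blinfun)}"

definition positive_definite_op :: "('a::real_inner \<Rightarrow>\<^sub>L 'a) \<Rightarrow> bool" where
  "positive_definite_op A \<longleftrightarrow> selfadjoint A \<and> op_spectrum A \<subseteq> {0<..}"

definition compact_op :: "('a::real_normed_vector \<Rightarrow>\<^sub>L 'b::real_normed_vector) \<Rightarrow> bool" where
  "compact_op A \<longleftrightarrow> compact (closure (blinfun_apply A ` cball 0 1))"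

text \<open>
  The positive definite space of a self-adjoint operator \<open>A\<close> is the largest closed
  \<open>A\<close>-invariant subspace on which the quadratic form of \<open>A\<close> is positive definite.  By the
  spectral theorem it is the spectral subspace of \<open>A\<close> for the interval from \<open>0\<close> (excluded) to
  infinity, so that the space is the orthogonal direct sum of \<open>pos_space A\<close>, \<open>null_space A\<close> and
  \<open>neg_space A\<close>.
\<close>

definition pos_space :: "('a::real_inner \<Rightarrow>\<^sub>L 'a) \<Rightarrow> 'a set" where
  "pos_space A = \<Union>{M. subspace M \<and> closed M \<and> blinfun_apply A ` M \<subseteq> M \<and>
                       (\<forall>u\<in>M. u \<noteq> 0 \<longrightarrow> inner (blinfun_apply A u) u > 0)}"

definition neg_space :: "('a::real_inner \<Rightarrow>\<^sub>L 'a) \<Rightarrow> 'a set" where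
  "neg_space A = \<Union>{M. subspace M \<and> closed M \<and> blinfun_apply A ` M \<subseteq> M \<and>
                       (\<forall>u\<in>M. u \<noteq> 0 \<longrightarrow> inner (blinfun_apply A u) u < 0)}"

definition null_space :: "('a::real_inner \<Rightarrow>\<^sub>L 'a) \<Rightarrow> 'a set" where
  "null_space A = {u. blinfun_apply A u = 0}"

definition orth_proj :: "'a::real_inner set \<Rightarrow> 'a \<Rightarrow> 'a" where
  "orth_proj M x = (THE y. y \<in> M \<and> (\<forall>v\<in>M. inner (x - y) v = 0))"

definition sub_ball :: "'a::real_normed_vector set \<Rightarrow> real \<Rightarrow> 'a set" where
  "sub_ball Y r = Y \<inter> ball 0 r"

section \<open>Hypothesis (A) and the reduced equation\<close>

definition hypothesis_A ::
  "'h::{real_inner,complete_space} set \<Rightarrow> ('h \<Rightarrow> real) \<Rightarrow>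
   ('h \<Rightarrow> 'h \<Rightarrow>\<^sub>L 'h) \<Rightarrow> ('h \<Rightarrow> 'h \<Rightarrow>\<^sub>L 'h) \<Rightarrow> ('h \<Rightarrow> 'h \<Rightarrow>\<^sub>L 'h) \<Rightarrow> bool" where
  "hypothesis_A V L B P Q \<longleftrightarrow>
     (\<forall>u\<in>V. selfadjoint (B u) \<and> has_gateaux_derivative (gradient L) (B u) u) \<and>
     (\<forall>x\<in>V. B x = P x + Q x) \<and>
     (\<forall>x\<in>V. positive_definite_op (P x)) \<and>
     (\<forall>x\<in>V. selfadjoint (Q x) \<and> compact_op (Q x)) \<and>
     \<comment> \<open>(D2)\<close>
     (\<forall>x :: nat \<Rightarrow> 'h. range x \<subseteq> V \<and> (\<lambda>k. norm (x k)) \<longlonglongrightarrow> 0 \<longrightarrow>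
        (\<forall>u. (\<lambda>k. norm (blinfun_apply (P (x k)) u - blinfun_apply (P 0) u)) \<longlonglongrightarrow> 0)) \<and>
     \<comment> \<open>(D3)\<close>
     continuous (at 0 within V) Q \<and>
     \<comment> \<open>(D4)\<close>
     (\<forall>x :: nat \<Rightarrow> 'h. range x \<subseteq> V \<and> (\<lambda>k. norm (x k)) \<longlonglongrightarrow> 0 \<longrightarrow>
        (\<exists>C\<^sub>0>0. \<exists>k\<^sub>0. \<forall>k\<ge>k\<^sub>0. \<forall>u.
           inner (blinfun_apply (P (x k)) u) u \<ge> C\<^sub>0 * (norm u)\<^sup>2))"

text \<open>
  A continuous solution of the reduced equation.  The condition that \<open>z + \<phi> z\<close> lies in \<open>V\<close> is
  implicit in the mathematics, where the gradient is defined on \<open>V\<close> only.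
\<close>

definition reduced_solution ::
  "'h::real_inner set \<Rightarrow> ('h \<Rightarrow> real) \<Rightarrow> 'h set \<Rightarrow> 'h set \<Rightarrow> 'h set \<Rightarrow> real \<Rightarrow> ('h \<Rightarrow> 'h) \<Rightarrow> bool" where
  "reduced_solution V L Hp H0 Hn \<epsilon> \<phi> \<longleftrightarrow>
     continuous_on (sub_ball H0 \<epsilon>) \<phi> \<and>
     \<phi> ` sub_ball H0 \<epsilon> \<subseteq> Hp + Hn \<and>
     \<phi> 0 = 0 \<and>
     (\<forall>z\<in>sub_ball H0 \<epsilon>. z + \<phi> z \<in> V \<and>
        gradient L (z + \<phi> z) - orth_proj H0 (gradient L (z + \<phi> z)) = 0)"

end

theory Submission
  imports Defs
begin

text \<open>
  Near the origin the form of \<open>B(x)\<close> is uniformly positive on \<open>H\<^sup>+\<close> and uniformly negative on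
  \<open>H\<^sup>-\<close>; by the mean value theorem \<open>(P\<^sup>+ - P\<^sup>-)\<nabla>L\<close> is then strongly monotone along
  \<open>H\<^sup>+ + H\<^sup>-\<close>, and \<open>\<nabla>L\<close> is Lipschitz because \<open>B\<close> is locally bounded.  A contraction argument
  solves the equation \<open>(I - P\<^sup>0)\<nabla>L(z + u) = 0\<close> by \<open>u = \<phi>(z)\<close>, and the equation
  \<open>P\<^sup>-\<nabla>L(y + w) = 0\<close> by \<open>w = \<eta>(y)\<close>, with Lipschitz solutions.  Put
  \<open>m(z,u) = y + \<eta>(y)\<close> with \<open>y = z + \<phi>(z) + u\<close>.  Along rays, \<open>L(m(z,u)) - L(z + \<phi>(z))\<close> grows
  quadratically in \<open>u \<in> H\<^sup>+\<close> and \<open>L(m(z,u)) - L(m(z,u) + w)\<close> in \<open>w \<in> H\<^sup>-\<close>, so rescaling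
  \<open>u\<close> and \<open>w\<close> radially turns these differences into squared norms.  Only \<open>L\<close> has to be
  differentiated along \<open>\<phi>\<close> and \<open>\<eta>\<close>: the gradient is orthogonal to their increments.
\<close>

section \<open>Hilbert space preliminaries\<close>

text \<open>The gradient has only a Gateaux derivative, whose part \<open>P\<close> is merely
  strongly continuous at the origin, so the implicit function theorem is out of reach; Lipschitz and
  monotonicity bounds replace it. The delicate estimate is positivity of \<open>B x\<close> on the
  infinite dimensional H^+, since strong convergence says nothing about vectors that vary with x.
  Unit vectors violating it are confronted with a substitute h for their weak limit: coercivity of
  \<open>P\<close> and compactness of \<open>Q\<close> bound the form of \<open>B 0\<close> at h by
  C (|h|^2 - 1), which contradicts the gap of \<open>B 0\<close>. On H^- convergence on a finite
  basis is enough. The points m(z,u) maximise L locally in direction H^-. Hence the change of L is a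
  gain depending on (z,u) minus a loss in w with (z,u) as parameter. Rescaling first the gain and
  then the loss keeps the map triangular and explicitly invertible, and (a) holds because its H^+
  part is a radial multiple of u^+.\<close>

lemma nested_closed_convex_Inter:
  fixes S :: "nat \<Rightarrow> 'h::{real_inner,complete_space} set"
  assumes cl: "\<And>n. closed (S n)" and cv: "\<And>n. convex (S n)" and ne: "\<And>n. S n \<noteq> {}"
    and dec: "\<And>m n. m \<le> n \<Longrightarrow> S n \<subseteq> S m" and bd: "bounded (S 0)"
  obtains h where "\<And>n. h \<in> S n"
proof -
  \<comment> \<open>The least norms increase along the sequence and stay bounded. Points
    \<open>h n\<close> of nearly least norm are Cauchy by the parallelogram law, since the midpoint
    of \<open>h n\<close> and \<open>h m\<close> lies in the larger of the two sets. This yields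
    nearest points and later replaces weak compactness.\<close>
  define d where "d n = Inf (norm ` S n)" for n
  obtain R where R: "\<And>x. x \<in> S 0 \<Longrightarrow> norm x \<le> R" using bd by (auto simp: bounded_iff)
  have bb: "bdd_below (norm ` S n)" for n by (rule bdd_belowI[of _ 0]) auto
  have dle: "d n \<le> norm x" if "x \<in> S n" for x n
    unfolding d_def by (rule cInf_lower) (use that bb in auto)
  have d0: "0 \<le> d n" for n unfolding d_def by (rule cInf_greatest) (use ne in auto)
  have "incseq d" unfolding incseq_def d_def
    using dec ne bb by (auto intro!: cInf_superset_mono)
  moreover have "d n \<le> R" for n
  proof -
    obtain x where "x \<in> S n" using ne by blast
    then show ?thesis using dle R dec[of 0 n] by fastforce
  qed
  ultimately obtain D where D: "d \<longlonglongrightarrow> D"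
    by (metis incseq_convergent)
  have "\<exists>x\<in>S n. norm x < d n + 1 / real (Suc n)" for n
  proof -
    have "Inf (norm ` S n) < d n + 1 / real (Suc n)" by (simp add: d_def)
    then show ?thesis using cInf_lessD[of "norm ` S n"] ne by blast
  qed
  then obtain h where h: "\<And>n. h n \<in> S n" "\<And>n. norm (h n) < d n + 1 / real (Suc n)"
    by metis
  define e where "e n = (d n + 1 / real (Suc n))\<^sup>2" for n
  have "(\<lambda>n. d n + 1 / real (Suc n)) \<longlonglongrightarrow> D + 0"
    by (intro tendsto_add D LIMSEQ_Suc lim_1_over_n)
  then have e: "e \<longlonglongrightarrow> D\<^sup>2" unfolding e_def by (auto intro!: tendsto_power)
  have d2: "(\<lambda>n. (d n)\<^sup>2) \<longlonglongrightarrow> D\<^sup>2" by (intro tendsto_power D)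
  have he: "(norm (h n))\<^sup>2 \<le> e n" for n
    unfolding e_def using h(2)[of n] by (intro power_mono) auto
  have key: "(norm (h m - h n))\<^sup>2 \<le> 2 * e n + 2 * e m - 4 * (d n)\<^sup>2" if "n \<le> m" for m n
  proof -
    have "(1/2) *\<^sub>R h n + (1/2) *\<^sub>R h m \<in> S n"
      using cv[of n] h(1)[of n] h(1)[of m] dec[OF that] by (auto intro!: convexD)
    then have "d n \<le> norm ((1/2) *\<^sub>R h n + (1/2) *\<^sub>R h m)" by (rule dle)
    then have "(d n)\<^sup>2 \<le> (norm ((1/2) *\<^sub>R h n + (1/2) *\<^sub>R h m))\<^sup>2"
      using d0 by (rule power_mono)
    moreover have "(norm (h m - h n))\<^sup>2 = 2 * (norm (h n))\<^sup>2 + 2 * (norm (h m))\<^sup>2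
        - 4 * (norm ((1/2) *\<^sub>R h n + (1/2) *\<^sub>R h m))\<^sup>2"
      unfolding power2_norm_eq_inner by (simp add: inner_simps inner_commute algebra_simps)
    ultimately show ?thesis using he[of n] he[of m] by linarith
  qed
  have "Cauchy h"
  proof (rule metric_CauchyI)
    fix r :: real assume r: "0 < r"
    \<comment> \<open>With \<open>e n\<close>, \<open>e m\<close> and the square of
      \<open>d n\<close> within s of D^2, \<open>key\<close> leaves 2s + 2s + 4s = 8s, which is half
      of r^2.\<close>
    define s where "s = r\<^sup>2 / 16"
    have s: "s > 0" using r by (simp add: s_def)
    obtain N1 where N1: "\<And>n. n \<ge> N1 \<Longrightarrow> \<bar>e n - D\<^sup>2\<bar> < s"
      using e s by (auto simp: LIMSEQ_def dist_real_def)
    obtain N2 where N2: "\<And>n. n \<ge> N2 \<Longrightarrow> \<bar>(d n)\<^sup>2 - D\<^sup>2\<bar> < s"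
      using d2 s by (auto simp: LIMSEQ_def dist_real_def)
    have *: "norm (h m - h n) < r" if "n \<le> m" "n \<ge> max N1 N2" for m n
    proof -
      have "e n < D\<^sup>2 + s" "e m < D\<^sup>2 + s" "D\<^sup>2 - s < (d n)\<^sup>2"
        using N1[of n] N1[of m] N2[of n] that by force+
      then have "(norm (h m - h n))\<^sup>2 < 8 * s" using key[OF that(1)] by linarith
      moreover have "8 * s < r\<^sup>2" using r by (simp add: s_def)
      ultimately have "(norm (h m - h n))\<^sup>2 < r\<^sup>2" by linarith
      then show ?thesis using r by (simp add: power2_less_imp_less)
    qed
    show "\<exists>M. \<forall>m\<ge>M. \<forall>n\<ge>M. dist (h m) (h n) < r"
    proof (intro exI allI impI)
      fix m n assume "max N1 N2 \<le> m" "max N1 N2 \<le> n"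
      then show "dist (h m) (h n) < r"
        using *[of n m] *[of m n] by (cases "n \<le> m") (auto simp: dist_norm norm_minus_commute)
    qed
  qed
  then obtain l where l: "h \<longlonglongrightarrow> l" using Cauchy_convergent convergent_def by blast
  have "l \<in> S n" for n
    by (rule Lim_in_closed_set[OF cl _ _ l]) (auto intro!: eventually_sequentiallyI[of n] subsetD[OF dec h(1)])
  then show thesis by (rule that)
qed

lemma closed_subspace_projection:
  fixes M :: "'h::{real_inner,complete_space} set"
  assumes M: "subspace M" "closed M"
  obtains y where "y \<in> M" "\<And>v. v \<in> M \<Longrightarrow> inner (x - y) v = 0"
proof -
  define D where "D = infdist x M"
  \<comment> \<open>The radii decrease to the distance from x to \<open>M\<close>, so a common point
    of these slices attains it.\<close>
  define S where "S n = M \<inter> cball x (D + 1 / real (Suc n))" for n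
  have M0: "M \<noteq> {}" using M(1) subspace_0 by blast
  obtain y where y: "\<And>n. y \<in> S n"
  proof (rule nested_closed_convex_Inter)
    show "closed (S n)" for n unfolding S_def using M by auto
    show "convex (S n)" for n unfolding S_def using M by (auto intro: convex_Int subspace_imp_convex)
    show "bounded (S 0)" unfolding S_def by (simp add: bounded_Int)
    show "S n \<subseteq> S m" if "m \<le> n" for m n
    proof -
      have "1 / real (Suc n) \<le> 1 / real (Suc m)" using that by (intro divide_left_mono) auto
      then show ?thesis unfolding S_def by (intro Int_mono order_refl subset_cball) simp
    qed
    show "S n \<noteq> {}" for n
    proof -
      have "infdist x M < D + 1 / real (Suc n)" by (simp add: D_def)
      then obtain a where "a \<in> M" "dist x a < D + 1 / real (Suc n)"
        using cINF_less_iff[of M "dist x"] M0 unfolding infdist_def by (auto simp: bdd_below_image_dist)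
      then show ?thesis unfolding S_def by auto
    qed
  qed (rule that)
  have yM: "y \<in> M" using y[of 0] by (simp add: S_def)
  have "(\<lambda>n. D + 1 / real (Suc n)) \<longlonglongrightarrow> D + 0"
    by (intro tendsto_add tendsto_const LIMSEQ_Suc lim_1_over_n)
  then have "dist x y \<le> D + 0"
    by (rule LIMSEQ_le_const) (use y in \<open>auto simp: S_def\<close>)
  then have yD: "dist x y \<le> D" by simp
  have orth: "inner (x - y) v = 0" if v: "v \<in> M" for v
  proof (cases "v = 0")
    case False
    \<comment> \<open>The minimiser of |x - y - t v|^2 in t. As y is already nearest to x, moving by
      it gains nothing, which forces the inner product to vanish.\<close>
    define t where "t = inner (x - y) v / (norm v)\<^sup>2"
    have "y + t *\<^sub>R v \<in> M" using M(1) yM v by (simp add: subspace_add subspace_scale)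
    then have "D \<le> dist x (y + t *\<^sub>R v)" unfolding D_def by (rule infdist_le)
    then have "norm (x - y) \<le> norm (x - y - t *\<^sub>R v)" using yD by (simp add: dist_norm diff_diff_eq)
    then have "(norm (x - y))\<^sup>2 \<le> (norm (x - y - t *\<^sub>R v))\<^sup>2" by (intro power_mono) auto
    also have "\<dots> = (norm (x - y))\<^sup>2 - 2 * t * inner (x - y) v + t\<^sup>2 * (norm v)\<^sup>2"
      unfolding power2_norm_eq_inner by (simp add: inner_simps inner_commute algebra_simps power2_eq_square)
    also have "t\<^sup>2 * (norm v)\<^sup>2 = t * inner (x - y) v" using False by (simp add: t_def power2_eq_square)
    finally have "t * inner (x - y) v \<le> 0" by simp
    then have "(inner (x - y) v)\<^sup>2 / (norm v)\<^sup>2 \<le> 0" by (simp add: t_def power2_eq_square)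
    then show ?thesis using False by (simp add: divide_le_0_iff)
  qed simp
  show thesis by (rule that[OF yM orth])
qed

lemma riesz_representation:
  fixes f :: "'h::{real_inner,complete_space} \<Rightarrow> real"
  assumes f: "bounded_linear f"
  obtains y where "\<And>x. f x = inner x y"
proof (cases "\<forall>x. f x = 0")
  case True
  then show thesis using that[of 0] by simp
next
  case False
  then obtain x0 where x0: "f x0 \<noteq> 0" by blast
  interpret f: bounded_linear f by (rule f)
  define M where "M = {x. f x = 0}"
  have "subspace M" unfolding M_def by (auto intro!: subspaceI simp: f.zero f.add f.scaleR)
  moreover have "closed M" unfolding M_def
    by (intro closed_Collect_eq continuous_intros f.continuous_on)
  ultimately obtain y where y: "y \<in> M" "\<And>v. v \<in> M \<Longrightarrow> inner (x0 - y) v = 0"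
    using closed_subspace_projection[of M x0] by blast
  define z where "z = x0 - y"
  have fz: "f z \<noteq> 0" using x0 y(1) by (simp add: z_def M_def f.diff)
  then have z0: "z \<noteq> 0" using f.zero by auto
  have "f x = inner x ((f z / (norm z)\<^sup>2) *\<^sub>R z)" for x
  proof -
    have "x - (f x / f z) *\<^sub>R z \<in> M" using fz by (simp add: M_def f.diff f.scaleR)
    then have "inner z (x - (f x / f z) *\<^sub>R z) = 0" using y(2) z_def by blast
    then have "inner x z = f x / f z * (norm z)\<^sup>2"
      by (simp add: inner_diff_right inner_commute power2_norm_eq_inner)
    then show ?thesis using fz z0 by (simp add: field_simps)
  qed
  then show thesis by (rule that)
qed

text \<open>\<open>gradient\<close> is a definite description and has its intended value only where
  existence and uniqueness are known; existence is the Riesz representation of the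
  derivative.\<close>

lemma has_derivative_gradient:
  fixes L :: "'h::{real_inner,complete_space} \<Rightarrow> real"
  assumes "(L has_derivative D) (at x)"
  shows "(L has_derivative (\<lambda>h. inner h (gradient L x))) (at x)"
proof -
  obtain y where "\<And>h. D h = inner h y"
    using riesz_representation[OF has_derivative_bounded_linear[OF assms]] by blast
  then have "D = (\<lambda>h. inner h y)" by auto
  then have y: "GDERIV L x :> y" using assms by (simp add: gderiv_def)
  have "GDERIV L x :> gradient L x" unfolding gradient_def
  proof (rule theI[of "\<lambda>D. GDERIV L x :> D", OF y])
    fix w assume "GDERIV L x :> w"
    then have "(\<lambda>h. inner h w) = (\<lambda>h. inner h y)"
      using y has_derivative_unique unfolding gderiv_def by blast
    then have "inner h (w - y) = 0" for h by (simp add: inner_diff_right fun_eq_iff)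
    then show "w = y" using inner_eq_zero_iff[of "w - y"] by simp
  qed
  then show ?thesis by (simp add: gderiv_def)
qed

text \<open>Banach-Steinhaus by Baire category: one of the closed sets \<open>C m\<close> contains a
  ball, and every short vector is the difference of a point of that ball and its centre. It later
  turns strong convergence of \<open>B\<close> at the origin into a local norm bound.\<close>

lemma uniform_boundedness:
  fixes T :: "nat \<Rightarrow> 'a::{real_normed_vector,complete_space} \<Rightarrow>\<^sub>L 'b::real_normed_vector"
  assumes "\<And>u. bounded (range (\<lambda>n. T n u))"
  obtains K where "\<And>n. norm (T n) \<le> K"
proof -
  define C where "C m = {u. \<forall>n. norm (T n u) \<le> real m}" for m
  have cl: "closed (C m)" for m unfolding C_def
    by (intro closed_Collect_all closed_Collect_le continuous_intros)
  have un: "(\<Union>m. C m) = UNIV"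
  proof -
    have "\<exists>m. u \<in> C m" for u
    proof -
      obtain b where b: "\<And>n. norm (T n u) \<le> b" using assms[of u] by (auto simp: bounded_iff)
      obtain m where "b \<le> real m" using real_arch_simple by blast
      then show ?thesis unfolding C_def using b order_trans by blast
    qed
    then show ?thesis by auto
  qed
  have "\<exists>m. interior (C m) \<noteq> {}"
  proof (rule ccontr)
    assume "\<not> ?thesis"
    then have "euclidean interior_of \<Union>(range C) = {}"
      by (intro Baire_category_alt disjI1 completely_metrizable_space_euclidean)
        (auto simp: cl)
    then show False using un by simp
  qed
  then obtain m x r where r: "r > 0" "cball x r \<subseteq> C m"
    by (metis ex_in_conv mem_interior_cball)
  have x: "norm (T n x) \<le> real m" for n
    using r by (auto simp: C_def subset_iff)
  have "norm (T n) \<le> 2 * real m / r" for n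
  proof (rule norm_blinfun_bound)
    show "0 \<le> 2 * real m / r" using r by simp
    fix u
    show "norm (T n u) \<le> 2 * real m / r * norm u"
    proof (cases "u = 0")
      case False
      have "x + (r / norm u) *\<^sub>R u \<in> cball x r" using False r by (simp add: dist_norm)
      then have "norm (T n (x + (r / norm u) *\<^sub>R u)) \<le> real m" using r by (auto simp: C_def)
      then have "norm (T n ((r / norm u) *\<^sub>R u)) \<le> 2 * real m"
        using x[of n] norm_triangle_ineq4[of "T n (x + (r / norm u) *\<^sub>R u)" "T n x"]
        by (simp add: blinfun.add_right)
      then show ?thesis using False r by (simp add: blinfun.scaleR_right field_simps)
    qed simp
  qed
  then show thesis by (rule that)
qed

section \<open>Compact perturbations of coercive self-adjoint operators\<close>

lemma compact_op_subsequence: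
  fixes Q :: "'h::real_normed_vector \<Rightarrow>\<^sub>L 'b::real_normed_vector"
  assumes Q: "compact_op Q" and u: "\<And>n. norm (u n) \<le> 1"
  obtains y r where "strict_mono (r :: nat \<Rightarrow> nat)" "(\<lambda>n. Q (u (r n))) \<longlonglongrightarrow> y"
proof -
  have "seq_compact (closure (blinfun_apply Q ` cball 0 1))"
    using Q unfolding compact_op_def by (rule compact_imp_seq_compact)
  moreover have "\<forall>n. Q (u n) \<in> closure (blinfun_apply Q ` cball 0 1)"
    using u by (auto intro!: subsetD[OF closure_subset] imageI)
  ultimately obtain l r where "strict_mono (r :: nat \<Rightarrow> nat)" "((\<lambda>n. Q (u n)) \<circ> r) \<longlonglongrightarrow> l"
    by (rule seq_compactE)
  then show thesis using that by (simp add: o_def)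
qed

section \<open>Orthogonal projections and finite orthonormal systems\<close>

locale orth_splitting =
  fixes pp pn :: "'h::{real_inner,complete_space} \<Rightarrow> 'h"
  assumes lin_pp: "linear pp" and lin_pn: "linear pn"
    and pp_idem: "pp (pp x) = pp x" and pn_idem: "pn (pn x) = pn x"
    and pp_adj: "inner (pp x) y = inner x (pp y)" and pn_adj: "inner (pn x) y = inner x (pn y)"
    and pp_pn: "pp (pn x) = 0"

text \<open>For a finite orthonormal \<open>E\<close> this is the orthogonal projection onto its
  span.\<close>

definition onproj :: "'h::real_inner set \<Rightarrow> 'h \<Rightarrow> 'h" where
  "onproj E x = (\<Sum>e\<in>E. inner x e *\<^sub>R e)"

lemma linear_onproj: "linear (onproj E)"
  by (auto intro!: linearI simp: onproj_def inner_add_left scaleR_add_left sum.distrib scaleR_sum_right)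

lemma onproj_adj: "inner (onproj E x) y = inner x (onproj E y)"
  unfolding onproj_def by (simp add: inner_sum_left inner_sum_right inner_commute mult.commute)

lemma onproj_inner:
  assumes "finite E" "F \<subseteq> E" "\<And>e. e \<in> E \<Longrightarrow> norm e = 1"
    and "\<And>e f. e \<in> E \<Longrightarrow> f \<in> E \<Longrightarrow> e \<noteq> f \<Longrightarrow> inner e f = 0" and f: "f \<in> E"
  shows "inner (onproj F x) f = (if f \<in> F then inner x f else 0)"
proof -
  have "inner (onproj F x) f = (\<Sum>e\<in>F. if e = f then inner x e else 0)"
    unfolding onproj_def inner_sum_left
  proof (rule sum.cong)
    fix e assume "e \<in> F"
    then show "inner (inner x e *\<^sub>R e) f = (if e = f then inner x e else 0)"
      using assms(2,3,4) f by (auto simp: power2_norm_eq_inner[symmetric])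
  qed simp
  also have "\<dots> = (if f \<in> F then inner x f else 0)"
    using finite_subset[OF assms(2,1)] by simp
  finally show ?thesis .
qed

text \<open>The situation at the origin; \<open>coercive\<close> is the quantitative form of what
  (D4) gives for \<open>P 0\<close>.\<close>

locale compact_perturbation =
  fixes B P Q :: "'h::{real_inner,complete_space} \<Rightarrow>\<^sub>L 'h" and C :: real
  assumes selfadj: "inner (B x) y = inner x (B y)"
    and split: "B = P + Q"
    and C_pos: "0 < C" and coercive: "C * (norm u)\<^sup>2 \<le> inner (P u) u"
    and compact: "compact_op Q"
begin

text \<open>Minimise the form over the unit sphere of \<open>M\<close>; the infimum m is
  nonpositive. Since \<open>B\<close> minus m is semidefinite on \<open>M\<close>, it sends a
  minimising sequence to 0. By compactness of \<open>Q\<close> a subsequence has convergent images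
  under \<open>P\<close> minus m, and this operator is coercive because m <= 0, so the subsequence
  itself converges, to an eigenvector.\<close>

lemma nonpositive_eigenvector:
  assumes M: "subspace M" "closed M" "\<And>u. u \<in> M \<Longrightarrow> B u \<in> M"
    and no: "\<And>l. l > 0 \<Longrightarrow> \<exists>u\<in>M. inner (B u) u < l * (norm u)\<^sup>2"
  obtains e m where "e \<in> M" "norm e = 1" "m \<le> 0" "B e = m *\<^sub>R e"
proof -
  define S where "S = {u \<in> M. norm u = 1}"
  define q where "q u = inner (B u) u" for u
  define m where "m = Inf (q ` S)"
  have qs: "q (c *\<^sub>R u) = c\<^sup>2 * q u" for c u
    unfolding q_def by (simp add: blinfun.scaleR_right power2_eq_square)
  have nS: "(1 / norm u) *\<^sub>R u \<in> S" if "u \<in> M" "u \<noteq> 0" for u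
    using that M(1) by (simp add: S_def subspace_scale)
  have unit: "\<exists>v\<in>S. q v < l" if l: "l > 0" for l
  proof -
    obtain u where u: "u \<in> M" "q u < l * (norm u)\<^sup>2" using no[OF l] unfolding q_def by blast
    then have u0: "u \<noteq> 0" by (auto simp: q_def)
    have "q ((1 / norm u) *\<^sub>R u) < l" unfolding qs using u(2) u0 by (simp add: field_simps)
    then show ?thesis using nS[OF u(1) u0] by blast
  qed
  have S0: "S \<noteq> {}" using unit[of 1] by auto
  have "\<bar>q u\<bar> \<le> norm B" if "u \<in> S" for u
    using Cauchy_Schwarz_ineq2[of "B u" u] norm_blinfun[of B u] that by (simp add: S_def q_def)
  then have bb: "bdd_below (q ` S)" by (intro bdd_belowI2[where m = "- norm B"]) force
  have mS: "m \<le> q u" if "u \<in> S" for u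
    unfolding m_def using bb that by (intro cInf_lower) auto
  have m0: "m \<le> 0" using unit[of m] mS by fastforce
  have mM: "m * (norm u)\<^sup>2 \<le> q u" if "u \<in> M" for u
  proof (cases "u = 0")
    case False
    have "m \<le> q ((1 / norm u) *\<^sub>R u)" using nS[OF that False] by (rule mS)
    then show ?thesis unfolding qs using False by (simp add: field_simps)
  qed (simp add: q_def)
  have "\<exists>v\<in>S. q v < m + 1 / real (Suc n)" for n
    using cInf_lessD[of "q ` S" "m + 1 / real (Suc n)"] S0 unfolding m_def by auto
  then obtain u where u: "\<And>n. u n \<in> S" "\<And>n. q (u n) < m + 1 / real (Suc n)" by metis
  define D where "D u = B u - m *\<^sub>R u" for u
  \<comment> \<open>A bound for the norm of \<open>D\<close>; the summand 1 makes it positive, so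
    that it can be a divisor.\<close>
  define K where "K = norm B + \<bar>m\<bar> + 1"
  have K: "0 < K" unfolding K_def by (simp add: add_nonneg_pos)
  have DK: "norm (D u) \<le> K * norm u" for u
  proof -
    have "norm (D u) \<le> norm (B u) + norm (m *\<^sub>R u)" unfolding D_def by (rule norm_triangle_ineq4)
    also have "\<dots> \<le> norm B * norm u + \<bar>m\<bar> * norm u" using norm_blinfun[of B u] by simp
    also have "\<dots> \<le> K * norm u" unfolding K_def by (simp add: algebra_simps)
    finally show ?thesis .
  qed
  have Dlin: "D (x - c *\<^sub>R y) = D x - c *\<^sub>R D y" for x y c
    unfolding D_def by (simp add: blinfun.diff_right blinfun.scaleR_right algebra_simps)
  have Dsa: "inner (D x) y = inner x (D y)" for x y
    unfolding D_def by (simp add: inner_simps selfadj)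
  have Dpos: "0 \<le> inner (D u) u" if "u \<in> M" for u
    using mM[OF that] unfolding D_def q_def by (simp add: inner_simps power2_norm_eq_inner)
  have DM: "D u \<in> M" if "u \<in> M" for u
    unfolding D_def using M(1) M(3)[OF that] that by (simp add: subspace_diff subspace_scale)
  \<comment> \<open>Cauchy-Schwarz for the semidefinite form of \<open>D\<close>\<close>
  have key: "(norm (D u))\<^sup>2 \<le> K * inner (D u) u" if u: "u \<in> M" for u
  proof -
    have "u - (1/K) *\<^sub>R D u \<in> M" using u DM M(1) by (simp add: subspace_diff subspace_scale)
    then have "0 \<le> inner (D (u - (1/K) *\<^sub>R D u)) (u - (1/K) *\<^sub>R D u)" by (rule Dpos)
    also have "\<dots> = inner (D u) u - 2 / K * (norm (D u))\<^sup>2 + 1 / K\<^sup>2 * inner (D (D u)) (D u)"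
      unfolding Dlin power2_norm_eq_inner
      by (simp add: inner_simps Dsa[of "D u" u] power2_eq_square algebra_simps)
    finally have 1: "0 \<le> inner (D u) u - 2 / K * (norm (D u))\<^sup>2 + 1 / K\<^sup>2 * inner (D (D u)) (D u)" .
    have "inner (D (D u)) (D u) \<le> norm (D (D u)) * norm (D u)" by (rule norm_cauchy_schwarz)
    also have "\<dots> \<le> K * norm (D u) * norm (D u)" using DK by (intro mult_right_mono) auto
    finally have "1 / K\<^sup>2 * inner (D (D u)) (D u) \<le> 1 / K * (norm (D u))\<^sup>2"
      using K by (simp add: field_simps power2_eq_square)
    with 1 have "1 / K * (norm (D u))\<^sup>2 \<le> inner (D u) u" by (simp add: field_simps)
    then show ?thesis using K by (simp add: field_simps)
  qed
  have "(\<lambda>n. (norm (D (u n)))\<^sup>2) \<longlonglongrightarrow> 0"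
  proof (rule tendsto_sandwich[OF _ _ tendsto_const])
    show "\<forall>\<^sub>F n in sequentially. (norm (D (u n)))\<^sup>2 \<le> K * (1 / real (Suc n))"
    proof (rule always_eventually, rule allI)
      fix n
      have "inner (D (u n)) (u n) \<le> 1 / real (Suc n)"
        using u(1,2)[of n] unfolding D_def q_def S_def
        by (simp add: inner_simps power2_norm_eq_inner[symmetric])
      then have "K * inner (D (u n)) (u n) \<le> K * (1 / real (Suc n))"
        using K by (intro mult_left_mono) auto
      then show "(norm (D (u n)))\<^sup>2 \<le> K * (1 / real (Suc n))"
        using key[of "u n"] u(1)[of n] by (simp add: S_def)
    qed
    have "(\<lambda>n. K * (1 / real (Suc n))) \<longlonglongrightarrow> K * 0"
      by (intro tendsto_mult tendsto_const LIMSEQ_Suc lim_1_over_n)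
    then show "(\<lambda>n. K * (1 / real (Suc n))) \<longlonglongrightarrow> 0" by simp
  qed simp
  then have "(\<lambda>n. sqrt ((norm (D (u n)))\<^sup>2)) \<longlonglongrightarrow> sqrt 0" by (intro tendsto_intros)
  then have D0: "(\<lambda>n. D (u n)) \<longlonglongrightarrow> 0" by (simp add: tendsto_norm_zero_iff)
  obtain y r where r: "strict_mono (r :: nat \<Rightarrow> nat)" and y: "(\<lambda>n. Q (u (r n))) \<longlonglongrightarrow> y"
  proof (rule compact_op_subsequence[OF compact])
    show "norm (u n) \<le> 1" for n using u(1)[of n] by (simp add: S_def)
  qed (rule that)
  define w where "w n = u (r n)" for n
  have wS: "w n \<in> S" for n using u(1) by (simp add: w_def)
  have Dw: "(\<lambda>n. D (w n)) \<longlonglongrightarrow> 0"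
    using LIMSEQ_subseq_LIMSEQ[OF D0 r] by (simp add: o_def w_def)
  \<comment> \<open>The image of \<open>w n\<close> under the coercive operator \<open>P\<close>
    minus m; it is also \<open>D (w n) - Q (w n)\<close>, where both terms converge.\<close>
  define z where "z n = P (w n) - m *\<^sub>R w n" for n
  have "z = (\<lambda>n. D (w n) - Q (w n))"
    unfolding z_def D_def split by (simp add: blinfun.add_left fun_eq_iff)
  then have "z \<longlonglongrightarrow> 0 - y" using y tendsto_diff[OF Dw] unfolding w_def by simp
  then have zC: "Cauchy z" by (rule LIMSEQ_imp_Cauchy)
  have zw: "C * norm (w n - w k) \<le> norm (z n - z k)" for n k
  proof (cases "w n = w k")
    case False
    define d where "d = w n - w k"
    have d: "norm d > 0" using False by (simp add: d_def)
    have "C * (norm d)\<^sup>2 \<le> inner (P d) d" by (rule coercive)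
    also have "\<dots> \<le> inner (P d) d - m * inner d d" using m0 by (simp add: mult_nonpos_nonneg)
    also have "\<dots> = inner (z n - z k) d"
      unfolding z_def d_def by (simp add: blinfun.diff_right inner_simps algebra_simps)
    also have "\<dots> \<le> norm (z n - z k) * norm d" by (rule norm_cauchy_schwarz)
    finally show ?thesis using d by (simp add: power2_eq_square d_def)
  qed simp
  have "Cauchy w"
  proof (rule metric_CauchyI)
    fix t :: real assume t: "0 < t"
    then obtain N where N: "\<And>n k. n \<ge> N \<Longrightarrow> k \<ge> N \<Longrightarrow> norm (z n - z k) < C * t"
      using metric_CauchyD[OF zC, of "C * t"] C_pos by (auto simp: dist_norm)
    have "norm (w n - w k) < t" if "n \<ge> N" "k \<ge> N" for n k
      using zw[of n k] N[OF that] C_pos by (meson le_less_trans mult_less_cancel_left_pos)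
    then show "\<exists>N. \<forall>n\<ge>N. \<forall>k\<ge>N. dist (w n) (w k) < t" by (auto simp: dist_norm)
  qed
  then obtain e where e: "w \<longlonglongrightarrow> e" using Cauchy_convergent convergent_def by blast
  have "e \<in> M" by (rule closed_sequentially[OF M(2) _ e]) (use wS in \<open>auto simp: S_def\<close>)
  moreover have "norm e = 1"
    using LIMSEQ_unique[OF tendsto_norm[OF e]] wS by (simp add: S_def)
  moreover have "B e = m *\<^sub>R e"
  proof -
    have "(\<lambda>n. D (w n)) \<longlonglongrightarrow> D e" unfolding D_def by (intro tendsto_intros e)
    then have "D e = 0" using Dw LIMSEQ_unique by blast
    then show ?thesis by (simp add: D_def)
  qed
  ultimately show thesis using that m0 by blast
qed

text \<open>The eigenvalue of a unit eigenvector is \<open>inner (B e) e\<close>, which spares a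
  separate eigenvalue function. The systems are finite so that their cardinality can be
  maximised.\<close>

definition nonpos_eigensystem :: "'h set \<Rightarrow> 'h set \<Rightarrow> bool" where
  "nonpos_eigensystem M E \<longleftrightarrow> finite E \<and> E \<subseteq> M \<and>
     (\<forall>e\<in>E. norm e = 1 \<and> inner (B e) e \<le> 0 \<and> B e = inner (B e) e *\<^sub>R e) \<and>
     (\<forall>e\<in>E. \<forall>f\<in>E. e \<noteq> f \<longrightarrow> inner e f = 0)"

text \<open>On two orthonormal eigenvectors with nonpositive eigenvalues, \<open>Q\<close> separates points
  uniformly, which total boundedness of the image of the unit ball allows only finitely often.\<close>

lemma nonpos_eigensystem_card_bounded:
  obtains N where "\<And>M E. nonpos_eigensystem M E \<Longrightarrow> card E \<le> N"
proof -
  \<comment> \<open>Radius C/2: two eigenvectors sharing a centre would have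
    \<open>norm (Q (e - f)) < C\<close>, whereas coercivity at e - f, of squared norm 2, forces at
    least sqrt 2 * C.\<close>
  obtain k where k: "finite k" "closure (blinfun_apply Q ` cball 0 1) \<subseteq> (\<Union>x\<in>k. ball x (C/2))"
    using compact C_pos unfolding compact_op_def compact_eq_totally_bounded by (meson half_gt_zero)
  have "card E \<le> card k" if E: "nonpos_eigensystem M E" for M E
  proof -
    have "\<exists>x\<in>k. dist x (Q e) < C/2" if "e \<in> E" for e
    proof -
      have "Q e \<in> closure (blinfun_apply Q ` cball 0 1)"
        using E that by (auto simp: nonpos_eigensystem_def intro!: subsetD[OF closure_subset] imageI)
      then obtain x where "x \<in> k" "Q e \<in> ball x (C/2)" using k(2) by blast
      then show ?thesis by (auto simp: mem_ball)
    qed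
    then obtain c where c: "\<And>e. e \<in> E \<Longrightarrow> c e \<in> k \<and> dist (c e) (Q e) < C/2" by metis
    have "inj_on c E"
    proof (rule inj_onI, rule ccontr)
      fix e f assume ef: "e \<in> E" "f \<in> E" "c e = c f" "e \<noteq> f"
      have "dist (Q e) (Q f) < C"
        using c[OF ef(1)] c[OF ef(2)] ef(3) dist_triangle_half_r by metis
      then have lt: "norm (Q (e - f)) < C" by (simp add: dist_norm blinfun.diff_right)
      have o: "inner e f = 0" "inner f e = 0" "inner e e = 1" "inner f f = 1"
        using E ef unfolding nonpos_eigensystem_def by (auto simp: power2_norm_eq_inner[symmetric])
      obtain a b where ab: "a \<le> 0" "b \<le> 0" "B e = a *\<^sub>R e" "B f = b *\<^sub>R f"
        using E ef unfolding nonpos_eigensystem_def by meson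
      have n2: "(norm (e - f))\<^sup>2 = 2" unfolding power2_norm_eq_inner by (simp add: inner_simps o)
      have "inner (B (e - f)) (e - f) = a + b" by (simp add: blinfun.diff_right ab inner_simps o)
      then have "inner (P (e - f)) (e - f) + inner (Q (e - f)) (e - f) \<le> 0"
        using ab unfolding split by (simp add: blinfun.add_left inner_simps)
      then have "C * 2 \<le> - inner (Q (e - f)) (e - f)" using coercive[of "e - f"] n2 by simp
      also have "\<dots> \<le> norm (Q (e - f)) * norm (e - f)"
        using Cauchy_Schwarz_ineq2[of "Q (e - f)" "e - f"] by linarith
      also have "\<dots> \<le> C * norm (e - f)" using lt by (intro mult_right_mono) auto
      finally have "2 \<le> norm (e - f)" using C_pos by simp
      then have "2\<^sup>2 \<le> (norm (e - f))\<^sup>2" by (intro power_mono) auto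
      then show False using n2 by simp
    qed
    then show ?thesis using c k(1) by (intro card_inj_on_le) auto
  qed
  then show thesis by (rule that)
qed

text \<open>Take an eigensystem of maximal cardinality. Its orthogonal complement in
  \<open>M\<close> is closed and invariant, so without a positive lower bound there,
  \<open>nonpositive_eigenvector\<close> would supply one more eigenvector.\<close>

lemma spectral_gap:
  assumes M: "subspace M" "closed M" "\<And>u. u \<in> M \<Longrightarrow> B u \<in> M"
  obtains E l where "nonpos_eigensystem M E" "0 < l"
    "\<forall>u\<in>M. (\<forall>e\<in>E. inner u e = 0) \<longrightarrow> l * (norm u)\<^sup>2 \<le> inner (B u) u"
proof -
  obtain N where N: "\<And>M E. nonpos_eigensystem M E \<Longrightarrow> card E \<le> N"
    by (rule nonpos_eigensystem_card_bounded) (rule that)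
  have "nonpos_eigensystem M {}" by (simp add: nonpos_eigensystem_def)
  then have "\<exists>E. nonpos_eigensystem M E \<and> (\<forall>F. nonpos_eigensystem M F \<longrightarrow> card F \<le> card E)"
    by (rule Lattices_Big.ex_has_greatest_nat[where b = "Suc N"]) (simp add: less_Suc_eq_le N)
  then obtain E where E: "nonpos_eigensystem M E"
    and mx: "\<forall>F. nonpos_eigensystem M F \<longrightarrow> card F \<le> card E" by (elim exE conjE)
  define M' where "M' = {u \<in> M. \<forall>e\<in>E. inner u e = 0}"
  have fE: "finite E" using E by (simp add: nonpos_eigensystem_def)
  have sub: "subspace M'"
    using M(1) unfolding M'_def by (auto intro!: subspaceI simp: subspace_0 subspace_add subspace_scale inner_simps)
  have "M' = M \<inter> (\<Inter>e\<in>E. {u. inner u e = 0})" unfolding M'_def by auto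
  then have cl: "closed M'"
    using M(2) by (auto intro!: closed_Int closed_INT closed_Collect_eq continuous_intros)
  have inv: "B u \<in> M'" if u: "u \<in> M'" for u
  proof -
    have "inner (B u) e = 0" if "e \<in> E" for e
    proof -
      have "B e = inner (B e) e *\<^sub>R e" using E that unfolding nonpos_eigensystem_def by blast
      then have "inner u (B e) = inner (B e) e * inner u e" by (metis inner_scaleR_right)
      then show ?thesis using u that unfolding selfadj M'_def by simp
    qed
    then show ?thesis using u M(3) unfolding M'_def by simp
  qed
  have "\<exists>l>0. \<forall>u\<in>M'. l * (norm u)\<^sup>2 \<le> inner (B u) u"
  proof (rule ccontr)
    assume "\<not> ?thesis"
    then have "\<And>l. l > 0 \<Longrightarrow> \<exists>u\<in>M'. inner (B u) u < l * (norm u)\<^sup>2" by (meson not_le)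
    from nonpositive_eigenvector[OF sub cl inv this]
    obtain e m where e: "e \<in> M'" "norm e = 1" "m \<le> 0" "B e = m *\<^sub>R e" by blast
    have me: "inner (B e) e = m" using e by (simp add: power2_norm_eq_inner[symmetric])
    have eE: "inner e f = 0" "inner f e = 0" if "f \<in> E" for f
      using e(1) that by (auto simp: M'_def inner_commute)
    have "e \<notin> E" using eE e(2) by fastforce
    moreover have "nonpos_eigensystem M (insert e E)"
      using E e(1,2,3) e(4)[folded me] eE me unfolding nonpos_eigensystem_def M'_def by auto
    ultimately show False using mx[rule_format, of "insert e E"] fE by simp
  qed
  then obtain l where "l > 0" "\<forall>u\<in>M'. l * (norm u)\<^sup>2 \<le> inner (B u) u" by blast
  then show thesis using that[OF E] unfolding M'_def by blast
qed


text \<open>\<open>E\<close> spans the nonpositive part and \<open>F\<close> its strictly negative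
  part. The ranges of \<open>pp\<close> and \<open>pn\<close> are admissible in the unions defining
  \<open>pos_space\<close> and \<open>neg_space\<close>. Conversely, an arbitrary admissible
  \<open>M\<close> is spanned by eigenvectors, through \<open>spectral_gap\<close>, if it is
  negative, and is orthogonal to \<open>E\<close> if it is positive.\<close>

lemma spectral_splitting:
  obtains pp pn a F where "orth_splitting pp pn" "0 < a"
    "pos_space B = {x. pp x = x}" "neg_space B = {x. pn x = x}"
    "null_space B = {x. pp x = 0 \<and> pn x = 0}"
    "\<And>u. pp u = u \<Longrightarrow> a * (norm u)\<^sup>2 \<le> inner (B u) u"
    "\<And>u. pn u = u \<Longrightarrow> inner (B u) u \<le> - a * (norm u)\<^sup>2"
    "finite F" "\<And>e. e \<in> F \<Longrightarrow> norm e = 1" "\<And>u. pn u = u \<Longrightarrow> u = (\<Sum>e\<in>F. inner u e *\<^sub>R e)"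
proof -
  obtain E l where E: "nonpos_eigensystem UNIV E" and l: "0 < l"
    and gap: "\<forall>u. (\<forall>e\<in>E. inner u e = 0) \<longrightarrow> l * (norm u)\<^sup>2 \<le> inner (B u) u"
    using spectral_gap[of UNIV] by auto
  define mu where "mu e = inner (B e) e" for e
  have fin: "finite E" and n1: "\<And>e. e \<in> E \<Longrightarrow> norm e = 1" and mu0: "\<And>e. e \<in> E \<Longrightarrow> mu e \<le> 0"
    and Be: "\<And>e. e \<in> E \<Longrightarrow> B e = mu e *\<^sub>R e"
    and orth: "\<And>e f. e \<in> E \<Longrightarrow> f \<in> E \<Longrightarrow> e \<noteq> f \<Longrightarrow> inner e f = 0"
    using E unfolding nonpos_eigensystem_def mu_def by blast+
  define F where "F = {e \<in> E. mu e < 0}"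
  have FE: "F \<subseteq> E" and fF: "finite F" using fin by (auto simp: F_def)
  define pp where "pp x = x - onproj E x" for x
  define pn where "pn = onproj F"
  have onE: "inner (onproj E x) e = inner x e" if "e \<in> E" for x e
    using onproj_inner[OF fin order_refl n1 orth that] that by simp
  have onF: "inner (onproj F x) e = (if e \<in> F then inner x e else 0)" if "e \<in> E" for x e
    using onproj_inner[OF fin FE n1 orth that] by simp
  have EE: "onproj E (onproj E x) = onproj E x" for x
    unfolding onproj_def[of E "onproj E x"] by (simp add: onE) (simp add: onproj_def)
  have FF: "onproj F (onproj F x) = onproj F x" for x
    unfolding onproj_def[of F "onproj F x"] onproj_def[of F x, symmetric]
    unfolding onproj_def[of F x]
    by (intro sum.cong refl) (use FE onF[of _ x] in \<open>simp add: subset_iff onproj_def\<close>)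
  have EF: "onproj E (onproj F x) = onproj F x" for x
  proof -
    have "onproj E (onproj F x) = (\<Sum>e\<in>E. if e \<in> F then inner x e *\<^sub>R e else 0)"
      unfolding onproj_def[of E] by (intro sum.cong) (auto simp: onF)
    also have "\<dots> = onproj F x"
      unfolding onproj_def using fin FE by (simp add: sum.inter_restrict[symmetric] Int_absorb1)
    finally show ?thesis .
  qed
  have os: "orth_splitting pp pn"
  proof (rule orth_splitting.intro)
    show "linear pp" unfolding pp_def using linear_onproj linear_id
      by (intro linear_compose_sub) (auto simp: id_def)
    show "linear pn" unfolding pn_def by (rule linear_onproj)
    fix x y
    show "pp (pp x) = pp x" by (simp add: pp_def linear_diff[OF linear_onproj] EE)
    show "pn (pn x) = pn x" by (simp add: pn_def FF)
    show "inner (pp x) y = inner x (pp y)" by (simp add: pp_def inner_simps onproj_adj)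
    show "inner (pn x) y = inner x (pn y)" by (simp add: pn_def onproj_adj)
    show "pp (pn x) = 0" by (simp add: pp_def pn_def EF)
  qed
  interpret orth_splitting pp pn by (rule os)
  have ppe: "inner (pp x) e = 0" if "e \<in> E" for x e
    using that by (simp add: pp_def inner_simps onE)
  have pp_iff: "pp x = x \<longleftrightarrow> (\<forall>e\<in>E. inner x e = 0)" for x
  proof
    assume "pp x = x" then show "\<forall>e\<in>E. inner x e = 0" using ppe by metis
  next
    assume "\<forall>e\<in>E. inner x e = 0" then show "pp x = x" by (simp add: pp_def onproj_def)
  qed
  have BiE: "inner (B x) e = mu e * inner x e" if "e \<in> E" for x e
    by (simp add: selfadj Be[OF that])
  have Bon: "onproj G (B x) = B (onproj G x)" if "G \<subseteq> E" for G x
    unfolding onproj_def blinfun.sum_right using that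
    by (intro sum.cong refl) (simp add: BiE Be blinfun.scaleR_right subset_iff)
  have Bpp: "pp (B x) = B (pp x)" for x
    by (simp add: pp_def Bon blinfun.diff_right)
  have gap': "l * (norm u)\<^sup>2 \<le> inner (B u) u" if "pp u = u" for u
    using gap that by (simp add: pp_iff)
  \<comment> \<open>One constant for both signs: the gap on the complement of \<open>E\<close>
    against the smallest modulus of the finitely many negative eigenvalues.\<close>
  define a where "a = Min (insert l ((\<lambda>e. - mu e) ` F))"
  have a: "0 < a" "a \<le> l" "\<And>e. e \<in> F \<Longrightarrow> a \<le> - mu e"
    using fF l by (auto simp: a_def F_def)
  have posB: "a * (norm u)\<^sup>2 \<le> inner (B u) u" if "pp u = u" for u
    using gap'[OF that] mult_right_mono[OF a(2), of "(norm u)\<^sup>2"] by simp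
  have negB: "inner (B u) u \<le> - a * (norm u)\<^sup>2" if "pn u = u" for u
  proof -
    have "inner (B u) u = inner (onproj F u) (B u)" using that by (simp add: pn_def inner_commute)
    also have "\<dots> = (\<Sum>e\<in>F. mu e * (inner u e)\<^sup>2)"
      unfolding onproj_def inner_sum_left using FE
      by (intro sum.cong refl) (auto simp: inner_commute[of _ "B u"] BiE power2_eq_square subset_iff)
    also have "\<dots> \<le> (\<Sum>e\<in>F. - a * (inner u e)\<^sup>2)"
    proof (intro sum_mono mult_right_mono)
      fix e assume "e \<in> F" then show "mu e \<le> - a" using a(3)[of e] by linarith
    qed simp
    also have "\<dots> = - a * inner (onproj F u) u"
      unfolding onproj_def inner_sum_left sum_distrib_left
      by (intro sum.cong refl) (simp add: power2_eq_square inner_commute)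
    also have "onproj F u = u" using that by (simp add: pn_def)
    finally show ?thesis by (simp add: power2_norm_eq_inner)
  qed
  have cl: "closed {x. pp x = x}" "closed {x. pn x = x}"
    unfolding pp_def pn_def onproj_def by (intro closed_Collect_eq continuous_intros)+
  have sub: "subspace {x. pp x = x}" "subspace {x. pn x = x}"
    by (auto intro!: subspaceI simp: linear_add[OF lin_pp] linear_scale[OF lin_pp] linear_0[OF lin_pp]
        linear_add[OF lin_pn] linear_scale[OF lin_pn] linear_0[OF lin_pn])
  have pnB: "pn (B x) = B (pn x)" for x unfolding pn_def by (rule Bon[OF FE])
  have null: "null_space B = {x. pp x = 0 \<and> pn x = 0}"
  proof (intro set_eqI iffI)
    fix x assume "x \<in> null_space B"
    then have Bx: "B x = 0" by (simp add: null_space_def)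
    have "inner x e = 0" if "e \<in> F" for e
      using BiE[of e x] that FE Bx by (auto simp: F_def)
    then have "pn x = 0" by (simp add: pn_def onproj_def)
    moreover have "l * (norm (pp x))\<^sup>2 \<le> 0"
      using gap'[of "pp x"] Bpp[of x] Bx by (simp add: pp_idem linear_0[OF lin_pp])
    then have "pp x = 0" using l by (simp add: mult_le_0_iff)
    ultimately show "x \<in> {x. pp x = 0 \<and> pn x = 0}" by simp
  next
    fix x assume "x \<in> {x. pp x = 0 \<and> pn x = 0}"
    then have x: "x = onproj E x" "onproj F x = 0" by (auto simp: pp_def pn_def)
    have "B x = (\<Sum>e\<in>E. inner x e *\<^sub>R B e)"
      by (subst x(1)) (simp add: onproj_def blinfun.sum_right blinfun.scaleR_right)
    also have "\<dots> = 0"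
    proof (rule sum.neutral, rule ballI)
      fix e assume e: "e \<in> E"
      show "inner x e *\<^sub>R B e = 0"
      proof (cases "e \<in> F")
        case True
        then have "inner x e = 0" using onF[OF e, of x] x(2) by simp
        then show ?thesis by simp
      next
        case False
        then have "mu e = 0" using e mu0[OF e] by (auto simp: F_def)
        then show ?thesis using Be[OF e] by simp
      qed
    qed
    finally show "x \<in> null_space B" by (simp add: null_space_def)
  qed
  have neg: "neg_space B = {x. pn x = x}"
  proof (intro equalityI subsetI)
    fix x assume "x \<in> {x. pn x = x}"
    moreover have "blinfun_apply B ` {x. pn x = x} \<subseteq> {x. pn x = x}" using pnB by auto
    moreover have "inner (B u) u < 0" if "pn u = u" "u \<noteq> 0" for u
    proof -
      have "0 < a * (norm u)\<^sup>2" using that a by simp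
      then show ?thesis using negB[OF that(1)] by linarith
    qed
    ultimately show "x \<in> neg_space B" unfolding neg_space_def using sub cl by blast
  next
    fix x assume "x \<in> neg_space B"
    then obtain M where M: "subspace M" "closed M" "\<And>u. u \<in> M \<Longrightarrow> B u \<in> M"
      "\<And>u. u \<in> M \<Longrightarrow> u \<noteq> 0 \<Longrightarrow> inner (B u) u < 0" and x: "x \<in> M"
      unfolding neg_space_def by blast
    obtain G l' where G: "nonpos_eigensystem M G" and l': "0 < l'"
      and gapM: "\<forall>u\<in>M. (\<forall>e\<in>G. inner u e = 0) \<longrightarrow> l' * (norm u)\<^sup>2 \<le> inner (B u) u"
      using spectral_gap[OF M(1,2,3)] by blast
    have G': "finite G" "G \<subseteq> M" "\<And>e. e \<in> G \<Longrightarrow> norm e = 1"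
      "\<And>e f. e \<in> G \<Longrightarrow> f \<in> G \<Longrightarrow> e \<noteq> f \<Longrightarrow> inner e f = 0"
      using G unfolding nonpos_eigensystem_def by auto
    have png: "pn g = g" if g: "g \<in> G" for g
    proof -
      define m where "m = inner (B g) g"
      have m: "m < 0" using M(4)[of g] G'(2,3) g unfolding m_def by fastforce
      have Bg: "B g = m *\<^sub>R g" unfolding m_def using G g by (simp add: nonpos_eigensystem_def)
      \<comment> \<open>\<open>B\<close> commutes with \<open>pp\<close>, so \<open>pp g\<close>
        satisfies the eigenvector equation with the negative number m; positivity on the range of
        \<open>pp\<close> leaves only \<open>pp g = 0\<close>.\<close>
      have "B (pp g) = m *\<^sub>R pp g" using Bpp[of g] by (simp add: Bg linear_scale[OF lin_pp])
      then have "l * (norm (pp g))\<^sup>2 \<le> m * (norm (pp g))\<^sup>2"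
        using gap'[of "pp g"] by (simp add: pp_idem power2_norm_eq_inner)
      then have "pp g = 0" using l m
        by (smt (verit, best) mult_less_cancel_right norm_eq_zero zero_le_power2 zero_eq_power2)
      then have gE: "g = onproj E g" by (simp add: pp_def)
      have z: "inner g e = 0" if "e \<in> E" "e \<notin> F" for e
      proof -
        have "mu e = 0" using that mu0[OF that(1)] by (auto simp: F_def)
        then have "m * inner g e = 0" using BiE[OF that(1), of g] Bg by simp
        then show ?thesis using m by simp
      qed
      have "onproj E g = onproj F g"
        unfolding onproj_def using fin FE z by (intro sum.mono_neutral_right) auto
      then show ?thesis using gE by (simp add: pn_def)
    qed
    \<comment> \<open>The part of x orthogonal to the eigenvectors found in \<open>M\<close>. There
      the form is nonnegative by the gap, but negative by the choice of \<open>M\<close> unless y =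
      0.\<close>
    define y where "y = x - onproj G x"
    have oM: "onproj G x \<in> M" unfolding onproj_def
      using G'(2) M(1) by (intro subspace_sum) (auto simp: subspace_scale)
    then have yM: "y \<in> M" using x M(1) by (simp add: y_def subspace_diff)
    have "inner y e = 0" if "e \<in> G" for e
      using onproj_inner[OF G'(1) order_refl G'(3,4) that] that by (simp add: y_def inner_simps)
    then have "l' * (norm y)\<^sup>2 \<le> inner (B y) y" using gapM yM by blast
    then have "y = 0" using M(4)[OF yM] l' by (smt (verit, best) mult_nonneg_nonneg zero_le_power2)
    then have "x = onproj G x" by (simp add: y_def)
    also have "\<dots> \<in> {x. pn x = x}"
      unfolding onproj_def using sub(2) by (intro subspace_sum) (auto simp: linear_scale[OF lin_pn] png)
    finally show "x \<in> {x. pn x = x}" .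
  qed
  have pos: "pos_space B = {x. pp x = x}"
  proof (intro equalityI subsetI)
    fix x assume "x \<in> {x. pp x = x}"
    moreover have "blinfun_apply B ` {x. pp x = x} \<subseteq> {x. pp x = x}" using Bpp by auto
    moreover have "inner (B u) u > 0" if "pp u = u" "u \<noteq> 0" for u
    proof -
      have "0 < a * (norm u)\<^sup>2" using that a by simp
      then show ?thesis using posB[OF that(1)] by linarith
    qed
    ultimately show "x \<in> pos_space B" unfolding pos_space_def using sub cl by blast
  next
    fix x assume "x \<in> pos_space B"
    then obtain M where M: "subspace M" "closed M" "\<And>u. u \<in> M \<Longrightarrow> B u \<in> M"
      "\<And>u. u \<in> M \<Longrightarrow> u \<noteq> 0 \<Longrightarrow> inner (B u) u > 0" and x: "x \<in> M"
      unfolding pos_space_def by blast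
    \<comment> \<open>The projection of an eigenvector to the invariant subspace \<open>M\<close> is an eigenvector or \<open>0\<close>.\<close>
    have "inner x e = 0" if e: "e \<in> E" for e
    proof -
      obtain f where f: "f \<in> M" "\<And>v. v \<in> M \<Longrightarrow> inner (e - f) v = 0"
        using closed_subspace_projection[OF M(1,2), of e] by blast
      define w where "w = B f - mu e *\<^sub>R f"
      have wM: "w \<in> M" using f(1) M by (simp add: w_def subspace_diff subspace_scale)
      have ev: "inner f v = inner e v" if "v \<in> M" for v using f(2)[OF that] by (simp add: inner_simps)
      have "inner w w = inner f (B w) - mu e * inner f w"
        by (simp add: w_def[THEN arg_cong, of "\<lambda>z. inner z w"] inner_simps selfadj)
      also have "\<dots> = inner e (B w) - mu e * inner e w" using ev wM M(3) by simp
      also have "\<dots> = 0" by (simp add: selfadj[symmetric] Be[OF e])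
      finally have "w = 0" by simp
      then have "inner (B f) f = mu e * (norm f)\<^sup>2" by (simp add: w_def power2_norm_eq_inner)
      then have "inner (B f) f \<le> 0" using mu0[OF e] by (simp add: mult_nonpos_nonneg)
      then have "f = 0" using M(4)[OF f(1)] by force
      then show ?thesis using ev[OF x] by (simp add: inner_commute)
    qed
    then show "x \<in> {x. pp x = x}" by (simp add: pp_iff)
  qed
  show thesis
  proof (rule that[OF os a(1) pos neg null posB negB fF])
    show "norm e = 1" if "e \<in> F" for e using that FE n1 by blast
    show "u = (\<Sum>e\<in>F. inner u e *\<^sub>R e)" if "pn u = u" for u
      using that by (simp add: pn_def onproj_def)
  qed
qed

end

section \<open>The reduced equation\<close>

lemma adj_idem_norm_le:
  fixes q :: "'a::real_inner \<Rightarrow> 'a"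
  assumes "\<And>x. q (q x) = q x" "\<And>x y. inner (q x) y = inner x (q y)"
  shows "norm (q x) \<le> norm x"
proof (cases "q x = 0")
  case False
  have "norm (q x) * norm (q x) = inner x (q x)"
    using assms(2)[of x "q x"] assms(1)[of x] by (simp add: power2_norm_eq_inner[symmetric] power2_eq_square[symmetric])
  also have "\<dots> \<le> norm x * norm (q x)" by (rule norm_cauchy_schwarz)
  finally show ?thesis using False by simp
qed simp

context orth_splitting begin

definition p0 where "p0 x = x - pp x - pn x"

text \<open>Self-adjointness carries \<open>pp_pn\<close> over to the opposite order.\<close>

lemma pn_pp: "pn (pp x) = 0"
proof -
  have "inner (pn (pp x)) (pn (pp x)) = inner (pp x) (pn (pn (pp x)))" by (simp add: pn_adj)
  also have "\<dots> = inner x (pp (pn (pp x)))" by (simp add: pn_idem pp_adj)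
  finally show ?thesis by (simp add: pp_pn)
qed

lemmas pp_simps = linear_add[OF lin_pp] linear_diff[OF lin_pp] linear_scale[OF lin_pp]
  linear_0[OF lin_pp] linear_neg[OF lin_pp] pp_idem pp_pn
lemmas pn_simps = linear_add[OF lin_pn] linear_diff[OF lin_pn] linear_scale[OF lin_pn]
  linear_0[OF lin_pn] linear_neg[OF lin_pn] pn_idem pn_pp

lemma pp_p0: "pp (p0 x) = 0" and pn_p0: "pn (p0 x) = 0"
  by (simp_all add: p0_def pp_simps pn_simps)

lemma inner_pp_pn: "inner (pp x) (pn y) = 0" "inner (pn y) (pp x) = 0"
  by (simp_all add: pp_adj pp_pn pn_adj pn_pp)

lemma norm_pp: "norm (pp x) \<le> norm x" by (rule adj_idem_norm_le) (simp_all add: pp_idem pp_adj)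
lemma norm_pn: "norm (pn x) \<le> norm x" by (rule adj_idem_norm_le) (simp_all add: pn_idem pn_adj)

lemma bounded_linear_pp: "bounded_linear pp"
  by (rule bounded_linear_intro[where K = 1]) (simp_all add: pp_simps norm_pp)
lemma bounded_linear_pn: "bounded_linear pn"
  by (rule bounded_linear_intro[where K = 1]) (simp_all add: pn_simps norm_pn)
lemma bounded_linear_p0: "bounded_linear p0"
  unfolding p0_def by (intro bounded_linear_sub bounded_linear_ident bounded_linear_pp bounded_linear_pn)

lemma norm_add_pp_pn: "(norm (pp x + pn y))\<^sup>2 = (norm (pp x))\<^sup>2 + (norm (pn y))\<^sup>2"
  unfolding power2_norm_eq_inner by (simp add: inner_simps inner_pp_pn)

text \<open>The reflection \<open>pp - pn\<close> is an isometry on H^+ + H^-, so composing with it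
  does not enlarge the Lipschitz constant in the contraction argument.\<close>

lemma norm_diff_pp_pn: "norm (pp x - pn x) = norm (pp x + pn x)"
proof -
  have "(norm (pp x - pn x))\<^sup>2 = (norm (pp x + pn x))\<^sup>2"
    unfolding power2_norm_eq_inner by (simp add: inner_simps inner_pp_pn)
  then show ?thesis by simp
qed

end

text \<open>\<open>J\<close> is a symmetry of the range of \<open>q\<close> that makes an indefinite
  problem monotone. As \<open>J (x - y)\<close> lies in that range, its pairing with
  \<open>g x - g y\<close> sees only \<open>q (g x)\<close> and \<open>q (g y)\<close>, which are
  0.\<close>

lemma monotone_projected_zero_unique:
  fixes g :: "'h::real_inner \<Rightarrow> 'h"
  assumes a: "0 < a" and adj: "\<And>x y. inner (q x) y = inner x (q y)"
    and J: "\<And>x. q (J (q x)) = J (q x)"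
    and mono: "a * (norm (x - y))\<^sup>2 \<le> inner (g x - g y) (J (x - y))"
    and "q (x - y) = x - y" "q (g x) = 0" "q (g y) = 0" and lin: "linear q"
  shows "x = y"
proof -
  have "inner (g x - g y) (J (x - y)) = inner (g x - g y) (q (J (x - y)))"
    using J[of "x - y"] assms(5) by simp
  also have "\<dots> = inner (q (g x - g y)) (J (x - y))" by (simp add: adj)
  also have "\<dots> = 0" by (simp add: linear_diff[OF lin] assms)
  finally have "(norm (x - y))\<^sup>2 \<le> 0" using mono a by (simp add: mult_le_0_iff)
  then show ?thesis by simp
qed

text \<open>The solution is the fixed point of the contraction \<open>w \<mapsto> w - t J q g(y + w)\<close>, \<open>t = a/K\<^sup>2\<close>.\<close>

lemma monotone_projected_equation:
  fixes g :: "'h::{real_inner,complete_space} \<Rightarrow> 'h"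
  assumes lin: "linear q" and idem: "\<And>x. q (q x) = q x"
    and adj: "\<And>x y. inner (q x) y = inner x (q y)"
    and linJ: "linear J" and adjJ: "\<And>x y. inner (J x) y = inner x (J y)"
    and qJ: "\<And>x. q (J (q x)) = J (q x)" and nJ: "\<And>x. norm (J (q x)) = norm (q x)"
    and pos: "0 < a" "a \<le> K" "0 < \<rho>"
    and lip: "\<And>x y. x \<in> ball 0 \<rho> \<Longrightarrow> y \<in> ball 0 \<rho> \<Longrightarrow> norm (g x - g y) \<le> K * norm (x - y)"
    and mono: "\<And>x y. x \<in> ball 0 \<rho> \<Longrightarrow> y \<in> ball 0 \<rho> \<Longrightarrow> q (x - y) = x - y \<Longrightarrow>
      a * (norm (x - y))\<^sup>2 \<le> inner (g x - g y) (J (x - y))"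
    and g0: "g 0 = 0"
  obtains \<delta> \<sigma> where "0 < \<delta>" "(1 + K / a) * \<delta> \<le> \<rho> / 2"
    "\<And>y. y \<in> ball 0 \<delta> \<Longrightarrow> q (\<sigma> y) = \<sigma> y \<and> q (g (y + \<sigma> y)) = 0 \<and> norm (\<sigma> y) \<le> K / a * norm y"
    "\<And>x y. x \<in> ball 0 \<delta> \<Longrightarrow> y \<in> ball 0 \<delta> \<Longrightarrow> norm (\<sigma> x - \<sigma> y) \<le> K / a * norm (x - y)"
proof -
  have K: "0 < K" using pos by linarith
  \<comment> \<open>The minimiser of 1 - 2 t a + t^2 K^2; the minimum 1 - a^2/K^2 is the square of
    the contraction factor \<open>c\<close>.\<close>
  define t where "t = a / K\<^sup>2"
  define c where "c = sqrt (1 - a\<^sup>2 / K\<^sup>2)"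
  have t: "0 < t" using pos K by (simp add: t_def)
  have aK: "a\<^sup>2 / K\<^sup>2 \<le> 1" using pos K by (simp add: power_mono)
  have c: "0 \<le> c" "c < 1" "c\<^sup>2 = 1 - a\<^sup>2 / K\<^sup>2" using aK pos K by (auto simp: c_def real_sqrt_lt_1_iff)
  \<comment> \<open>The first bound keeps \<open>y + \<sigma> y\<close> within \<rho>/2, as
    |\<sigma> y| <= K/a |y|. The second makes |T 0| <= (1 - c) \<rho>/4, so that the contraction
    maps the ball of radius \<rho>/4 into itself.\<close>
  define \<delta> where "\<delta> = min (\<rho> / 2 / (1 + K / a)) ((1 - c) * (\<rho> / 4) / (t * K))"
  have Ka: "0 < K / a" using K pos by simp
  have \<delta>0: "0 < \<delta>" using pos c t K Ka unfolding \<delta>_def by (simp add: add_pos_pos)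
  have \<delta>1: "(1 + K / a) * \<delta> \<le> \<rho> / 2"
  proof -
    have "(1 + K / a) * \<delta> \<le> (1 + K / a) * (\<rho> / 2 / (1 + K / a))"
      using Ka by (intro mult_left_mono) (auto simp: \<delta>_def)
    also have "\<dots> = \<rho> / 2"
    proof -
      have "1 + K / a \<noteq> 0" using Ka by linarith
      then show ?thesis by (metis nonzero_mult_div_cancel_left times_divide_eq_right)
    qed
    finally show ?thesis .
  qed
  have \<delta>2: "\<delta> \<le> \<rho> / 2"
  proof -
    have "1 * \<delta> \<le> (1 + K / a) * \<delta>" using Ka \<delta>0 by (intro mult_right_mono) auto
    then show ?thesis using \<delta>1 by linarith
  qed
  have \<delta>3: "t * (K * \<delta>) \<le> (1 - c) * (\<rho> / 4)"
  proof -
    have "t * K * \<delta> \<le> t * K * ((1 - c) * (\<rho> / 4) / (t * K))"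
      using t K by (intro mult_left_mono) (auto simp: \<delta>_def)
    then show ?thesis using t K by (simp add: mult.assoc)
  qed
  have nq: "norm (q x) \<le> norm x" for x by (rule adj_idem_norm_le[OF idem adj])
  have blq: "bounded_linear q"
    by (rule bounded_linear_intro[where K = 1]) (simp_all add: linear_add[OF lin] linear_scale[OF lin] nq)
  define S where "S = {w. q w = w} \<inter> cball 0 (\<rho> / 4)"
  have "closed S" unfolding S_def
    by (intro closed_Int closed_cball closed_Collect_eq continuous_intros linear_continuous_on[OF blq])
  then have cS: "complete S" by (simp add: complete_eq_closed)
  have S0: "0 \<in> S" using pos by (simp add: S_def linear_0[OF lin])
  have in\<rho>: "y + w \<in> ball 0 \<rho>" if "y \<in> ball 0 \<delta>" "w \<in> S" for y w
    using norm_triangle_ineq[of y w] that \<delta>2 pos by (simp add: S_def)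
  have ex: "\<exists>w. w \<in> S \<and> q (g (y + w)) = 0" if y: "y \<in> ball 0 \<delta>" for y
  proof -
    define T where "T w = w - t *\<^sub>R J (q (g (y + w)))" for w
    have qT: "q (T w) = T w" if "w \<in> S" for w
      using that by (simp add: T_def S_def linear_diff[OF lin] linear_scale[OF lin] qJ)
    have contr: "norm (T w - T v) \<le> c * norm (w - v)" if w: "w \<in> S" and v: "v \<in> S" for w v
    proof -
      define d where "d = w - v"
      define e where "e = g (y + w) - g (y + v)"
      have qd: "q d = d" using w v by (simp add: d_def S_def linear_diff[OF lin])
      have TT: "T w - T v = d - t *\<^sub>R J (q e)"
        by (simp add: T_def d_def e_def linear_diff[OF lin] linear_diff[OF linJ] algebra_simps)
      have yd: "(y + w) - (y + v) = d" by (simp add: d_def)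
      have m: "a * (norm d)\<^sup>2 \<le> inner e (J d)"
        using mono[OF in\<rho>[OF y w] in\<rho>[OF y v]] unfolding yd e_def using qd by blast
      have "norm (J (q e)) \<le> norm e" using nq nJ by simp
      also have "\<dots> \<le> K * norm d" using lip[OF in\<rho>[OF y w] in\<rho>[OF y v]] unfolding yd e_def .
      finally have "(norm (J (q e)))\<^sup>2 \<le> (K * norm d)\<^sup>2" by (intro power_mono) auto
      then have n: "t\<^sup>2 * (norm (J (q e)))\<^sup>2 \<le> t\<^sup>2 * (K * norm d)\<^sup>2" by (intro mult_left_mono) auto
      have "inner d (J (q e)) = inner (q (J (q d))) e" by (simp add: adj adjJ qd)
      also have "\<dots> = inner e (J d)" using qJ[of d] qd by (simp add: inner_commute)
      finally have i: "inner d (J (q e)) = inner e (J d)" .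
      have "(norm (T w - T v))\<^sup>2 = (norm d)\<^sup>2 - 2 * t * inner d (J (q e)) + t\<^sup>2 * (norm (J (q e)))\<^sup>2"
        unfolding TT power2_norm_eq_inner by (simp add: inner_simps inner_commute power2_eq_square algebra_simps)
      also have "\<dots> \<le> (norm d)\<^sup>2 - 2 * t * (a * (norm d)\<^sup>2) + t\<^sup>2 * (K * norm d)\<^sup>2"
        using n m t unfolding i by (intro add_mono diff_mono mult_left_mono) auto
      also have "\<dots> = (1 - a\<^sup>2 / K\<^sup>2) * (norm d)\<^sup>2"
      proof -
        define X where "X = a\<^sup>2 / K\<^sup>2"
        have X: "t * a = X" "t\<^sup>2 * K\<^sup>2 = X"
          using K by (simp_all add: t_def X_def power_divide power2_eq_square)
        have A: "2 * t * (a * (norm d)\<^sup>2) = 2 * X * (norm d)\<^sup>2"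
          by (simp only: X(1)[symmetric] mult.assoc)
        have B: "t\<^sup>2 * (K * norm d)\<^sup>2 = X * (norm d)\<^sup>2"
          by (simp only: X(2)[symmetric] mult.assoc power_mult_distrib)
        show ?thesis unfolding A B X_def[symmetric] by (simp add: algebra_simps)
      qed
      also have "\<dots> = (c * norm d)\<^sup>2" by (simp add: c(3) power_mult_distrib)
      finally have "norm (T w - T v) \<le> c * norm d"
        by (rule power2_le_imp_le) (use c in simp)
      then show ?thesis unfolding d_def .
    qed
    have "T ` S \<subseteq> S"
    proof (rule image_subsetI)
      fix w assume w: "w \<in> S"
      have "norm (T 0) = t * norm (J (q (g y)))" using t by (simp add: T_def)
      also have "\<dots> \<le> t * (K * \<delta>)"
      proof (intro mult_left_mono)
        have "norm (J (q (g y))) \<le> norm (g y - g 0)" using nq nJ g0 by simp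
        also have "\<dots> \<le> K * norm (y - 0)" using y \<delta>2 pos by (intro lip) auto
        also have "\<dots> \<le> K * \<delta>" using y K by (intro mult_left_mono) auto
        finally show "norm (J (q (g y))) \<le> K * \<delta>" .
      qed (use t in simp)
      finally have T0: "norm (T 0) \<le> (1 - c) * (\<rho> / 4)" using \<delta>3 by linarith
      have "norm (T w - T 0) \<le> c * norm (w - 0)" by (rule contr[OF w S0])
      also have "\<dots> \<le> c * (\<rho> / 4)" using w c by (intro mult_left_mono) (auto simp: S_def)
      finally have "norm (T w) \<le> \<rho> / 4"
        using T0 norm_triangle_ineq[of "T w - T 0" "T 0"] by (simp add: algebra_simps)
      then show "T w \<in> S" using qT[OF w] by (simp add: S_def)
    qed
    then have "\<exists>!w\<in>S. T w = w"
      using S0 c contr by (intro Banach_fix[OF cS]) (auto simp: dist_norm)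
    then obtain w where w: "w \<in> S" "T w = w" by blast
    then have "t *\<^sub>R J (q (g (y + w))) = 0" by (simp add: T_def)
    then have "norm (J (q (g (y + w)))) = 0" using t by simp
    then have "q (g (y + w)) = 0" unfolding nJ by simp
    then show ?thesis using w(1) by blast
  qed
  then obtain \<sigma> where \<sigma>: "\<And>y. y \<in> ball 0 \<delta> \<Longrightarrow> \<sigma> y \<in> S \<and> q (g (y + \<sigma> y)) = 0" by metis
  \<comment> \<open>Monotonicity is applied to two points over the same x, with difference d. Since
    \<open>J d\<close> lies in the range of \<open>q\<close>, the value
    \<open>g (x + \<sigma> x)\<close> may be exchanged for \<open>g (y + \<sigma> y)\<close>; then
    the arguments differ only by x - y, and the Lipschitz bound applies.\<close>
  have lipS: "norm (\<sigma> x - \<sigma> y) \<le> K / a * norm (x - y)" if x: "x \<in> ball 0 \<delta>" and y: "y \<in> ball 0 \<delta>" for x y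
  proof (cases "\<sigma> x = \<sigma> y")
    case False
    define d where "d = \<sigma> x - \<sigma> y"
    have d0: "0 < norm d" using False by (simp add: d_def)
    have qd: "q d = d" using \<sigma>[OF x] \<sigma>[OF y] by (simp add: d_def S_def linear_diff[OF lin])
    have qJd: "q (J d) = J d" using qJ[of d] qd by simp
    have z: "inner v (J d) = 0" if "q v = 0" for v
      using that adj[of v "J d"] by (simp add: qJd)
    have xx: "(x + \<sigma> x) - (x + \<sigma> y) = d" by (simp add: d_def)
    have b: "x + \<sigma> x \<in> ball 0 \<rho>" "x + \<sigma> y \<in> ball 0 \<rho>" "y + \<sigma> y \<in> ball 0 \<rho>"
      using in\<rho> \<sigma> x y by blast+
    have "a * (norm d)\<^sup>2 \<le> inner (g (x + \<sigma> x) - g (x + \<sigma> y)) (J d)"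
      using mono[OF b(1,2)] qd unfolding xx by blast
    also have "\<dots> = inner (g (y + \<sigma> y) - g (x + \<sigma> y)) (J d)"
      using z \<sigma>[OF x] \<sigma>[OF y] by (simp add: inner_simps)
    also have "\<dots> \<le> norm (g (y + \<sigma> y) - g (x + \<sigma> y)) * norm (J d)" by (rule norm_cauchy_schwarz)
    also have "\<dots> \<le> (K * norm (x - y)) * norm d"
      using lip[OF b(3,2)] nJ[of d] qd by (auto intro!: mult_right_mono simp: norm_minus_commute)
    finally have "a * norm d \<le> K * norm (x - y)" using d0 by (simp add: power2_eq_square)
    then show ?thesis using pos by (simp add: d_def field_simps)
  next
    case True
    have "0 \<le> K / a * norm (x - y)" using Ka by (intro mult_nonneg_nonneg) auto
    then show ?thesis using True by simp
  qed
  have \<sigma>0: "\<sigma> 0 = 0"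
  proof -
    have 0: "(0::'h) \<in> ball 0 \<delta>" using \<delta>0 by simp
    note s0 = \<sigma>[OF 0]
    have "\<sigma> 0 \<in> ball 0 \<rho>" using s0 in\<rho>[OF 0, of "\<sigma> 0"] by simp
    then have "a * (norm (\<sigma> 0 - 0))\<^sup>2 \<le> inner (g (\<sigma> 0) - g 0) (J (\<sigma> 0 - 0))"
      using s0 pos by (intro mono) (auto simp: S_def)
    then show ?thesis
      by (rule monotone_projected_zero_unique[where q = q and J = J and g = g, OF pos(1) adj qJ])
        (use s0 g0 lin in \<open>auto simp: S_def linear_0[OF lin]\<close>)
  qed
  show thesis
  proof (rule that[OF \<delta>0 \<delta>1 _ lipS])
    fix y :: 'h assume y: "y \<in> ball 0 \<delta>"
    show "q (\<sigma> y) = \<sigma> y \<and> q (g (y + \<sigma> y)) = 0 \<and> norm (\<sigma> y) \<le> K / a * norm y"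
      using \<sigma>[OF y] lipS[OF y, of 0] \<delta>0 \<sigma>0 by (simp add: S_def)
  qed
qed

section \<open>Radial rescaling\<close>

text \<open>The function h t - c t^2 is nondecreasing. A general s, not just s = 0, is kept because
  it gives strict increase along rays.\<close>

lemma quadratic_growth:
  fixes h :: "real \<Rightarrow> real"
  assumes "\<And>t. 0 \<le> t \<Longrightarrow> t \<le> 1 \<Longrightarrow> (h has_real_derivative h' t) (at t)"
    and "\<And>t. 0 \<le> t \<Longrightarrow> t \<le> 1 \<Longrightarrow> 2 * c * t \<le> h' t" and s: "0 \<le> s" "s \<le> 1"
  shows "c * (1 - s\<^sup>2) \<le> h 1 - h s"
proof -
  have "h s - c * s\<^sup>2 \<le> h 1 - c * 1\<^sup>2"
  proof (rule DERIV_nonneg_imp_nondecreasing[OF s(2)])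
    fix t assume t: "s \<le> t" "t \<le> 1"
    have "((\<lambda>t. h t - c * t\<^sup>2) has_real_derivative h' t - c * (2 * t)) (at t)"
      using t s by (auto intro!: derivative_eq_intros assms(1))
    moreover have "0 \<le> h' t - c * (2 * t)" using assms(2)[of t] t s by simp
    ultimately show "\<exists>y. ((\<lambda>t. h t - c * t\<^sup>2) has_real_derivative y) (at t) \<and> 0 \<le> y" by blast
  qed
  then show ?thesis by (simp add: algebra_simps)
qed

lemma eventually_less_of_tendsto:
  fixes x y :: "nat \<Rightarrow> real"
  assumes "x \<longlonglongrightarrow> a" "y \<longlonglongrightarrow> b" "a < b"
  shows "\<forall>\<^sub>F n in sequentially. x n < y n"
proof -
  have "\<forall>\<^sub>F n in sequentially. 0 < y n - x n"
    using assms by (intro order_tendstoD(1)[OF tendsto_diff[OF assms(2,1)]]) simp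
  then show ?thesis by eventually_elim simp
qed

text \<open>The parameter space is any metric space, so that the rescaling can be used over z and
  then over pairs (z,u). In \<open>growth\<close>, s = 0 is a quadratic lower bound and s < 1 yields
  strict increase along rays.\<close>

locale radial =
  fixes Z :: "'z::metric_space set" and Y :: "'h::real_inner set" and R \<kappa> :: real
    and f :: "'z \<Rightarrow> 'h \<Rightarrow> real"
  assumes cone: "\<And>u c. u \<in> Y \<Longrightarrow> c *\<^sub>R u \<in> Y"
    and pos: "0 < R" "0 < \<kappa>"
    and cont: "continuous_on (Z \<times> (Y \<inter> ball 0 R)) (\<lambda>p. f (fst p) (snd p))"
    and zero: "\<And>\<zeta>. \<zeta> \<in> Z \<Longrightarrow> f \<zeta> 0 = 0"
    and growth: "\<And>\<zeta> u s. \<zeta> \<in> Z \<Longrightarrow> u \<in> Y \<Longrightarrow> norm u < R \<Longrightarrow> 0 \<le> s \<Longrightarrow> s \<le> 1 \<Longrightarrow>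
      \<kappa> * (norm u)\<^sup>2 * (1 - s\<^sup>2) \<le> f \<zeta> u - f \<zeta> (s *\<^sub>R u)"
begin

text \<open>The square of its norm is the value of f, which is what produces the normal form.
  Division by zero gives the value 0 at u = 0.\<close>

definition rad where "rad \<zeta> u = (sqrt (f \<zeta> u) / norm u) *\<^sub>R u"
text \<open>Meaningful for \<open>norm a < R'\<close>: the lower bound for f guarantees that radii
  below \<open>R\<close> reach all these values, whereas \<open>rad\<close> itself may leave this
  smaller ball.\<close>

definition irad where "irad \<zeta> a = (SOME u. u \<in> Y \<and> norm u < R \<and> rad \<zeta> u = a)"

abbreviation "R' \<equiv> sqrt \<kappa> * R"

lemma lower: "\<zeta> \<in> Z \<Longrightarrow> u \<in> Y \<Longrightarrow> norm u < R \<Longrightarrow> \<kappa> * (norm u)\<^sup>2 \<le> f \<zeta> u"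
  using growth[of \<zeta> u 0] zero by simp

lemma nonneg: "\<zeta> \<in> Z \<Longrightarrow> u \<in> Y \<Longrightarrow> norm u < R \<Longrightarrow> 0 \<le> f \<zeta> u"
  using lower[of \<zeta> u] pos by (smt (verit) mult_nonneg_nonneg zero_le_power2)

lemma norm_rad: "\<zeta> \<in> Z \<Longrightarrow> u \<in> Y \<Longrightarrow> norm u < R \<Longrightarrow> norm (rad \<zeta> u) = sqrt (f \<zeta> u)"
  using nonneg[of \<zeta> u] zero[of \<zeta>] by (cases "u = 0") (auto simp: rad_def)

lemma norm_rad2: "\<zeta> \<in> Z \<Longrightarrow> u \<in> Y \<Longrightarrow> norm u < R \<Longrightarrow> (norm (rad \<zeta> u))\<^sup>2 = f \<zeta> u"
  by (simp add: norm_rad nonneg)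

lemma norm_rad_ge:
  assumes "\<zeta> \<in> Z" "u \<in> Y" "norm u < R"
  shows "sqrt \<kappa> * norm u \<le> norm (rad \<zeta> u)"
proof -
  have "sqrt (\<kappa> * (norm u)\<^sup>2) \<le> sqrt (f \<zeta> u)" using lower[OF assms] by simp
  then show ?thesis by (simp add: norm_rad assms real_sqrt_mult)
qed

lemma rad_Y: "u \<in> Y \<Longrightarrow> rad \<zeta> u \<in> Y" by (simp add: rad_def cone)

lemma rad_0 [simp]: "rad \<zeta> 0 = 0" by (simp add: rad_def)

lemma rad_eq_0_iff: "\<zeta> \<in> Z \<Longrightarrow> u \<in> Y \<Longrightarrow> norm u < R \<Longrightarrow> rad \<zeta> u = 0 \<longleftrightarrow> u = 0"
  using norm_rad_ge[of \<zeta> u] pos by (fastforce simp: mult_le_0_iff)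

lemma sgn_rad:
  assumes "\<zeta> \<in> Z" "u \<in> Y" "norm u < R"
  shows "sgn (rad \<zeta> u) = sgn u"
proof (cases "u = 0")
  case False
  define c where "c = sqrt (f \<zeta> u) / norm u"
  have c: "0 < c"
    using False rad_eq_0_iff[OF assms] nonneg[OF assms] by (auto simp: rad_def c_def less_le)
  have "rad \<zeta> u = c *\<^sub>R u" by (simp add: rad_def c_def)
  then show ?thesis using c by (simp add: sgn_scaleR)
qed simp

lemma strict:
  assumes \<zeta>: "\<zeta> \<in> Z" and e: "e \<in> Y" "norm e = 1" and t: "0 \<le> t1" "t1 < t2" "t2 < R"
  shows "f \<zeta> (t1 *\<^sub>R e) < f \<zeta> (t2 *\<^sub>R e)"
proof -
  have "\<kappa> * (norm (t2 *\<^sub>R e))\<^sup>2 * (1 - (t1 / t2)\<^sup>2) \<le> f \<zeta> (t2 *\<^sub>R e) - f \<zeta> ((t1 / t2) *\<^sub>R t2 *\<^sub>R e)"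
    using t e by (intro growth \<zeta> cone) auto
  moreover have "(t1 / t2)\<^sup>2 < 1" using t by (simp add: power_less_one_iff abs_square_less_1)
  then have "0 < \<kappa> * (norm (t2 *\<^sub>R e))\<^sup>2 * (1 - (t1 / t2)\<^sup>2)" using t e pos by simp
  ultimately show ?thesis using t by simp
qed

lemma mono_le:
  assumes "\<zeta> \<in> Z" "e \<in> Y" "norm e = 1" "0 \<le> t1" "t1 \<le> t2" "t2 < R"
  shows "f \<zeta> (t1 *\<^sub>R e) \<le> f \<zeta> (t2 *\<^sub>R e)"
  using strict[of \<zeta> e t1 t2] assms by (cases "t1 = t2") auto

lemma norm_sgn_decomp: "u = norm u *\<^sub>R sgn (u::'h)"
  by (cases "u = 0") (simp_all add: sgn_div_norm)

lemma rad_inj: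
  assumes \<zeta>: "\<zeta> \<in> Z" and u: "u \<in> Y" "norm u < R" and v: "v \<in> Y" "norm v < R" and eq: "rad \<zeta> u = rad \<zeta> v"
  shows "u = v"
proof (cases "u = 0")
  case True
  then show ?thesis using eq rad_eq_0_iff[OF \<zeta> v] by simp
next
  case False
  have s: "sgn u = sgn v" using sgn_rad[OF \<zeta> u] sgn_rad[OF \<zeta> v] eq by simp
  have f: "f \<zeta> u = f \<zeta> v" using norm_rad2[OF \<zeta> u] norm_rad2[OF \<zeta> v] eq by simp
  have e: "sgn u \<in> Y" "norm (sgn u) = 1" using False u by (auto simp: norm_sgn sgn_div_norm cone)
  have "u = norm u *\<^sub>R sgn u" "v = norm v *\<^sub>R sgn u"
    using norm_sgn_decomp[of u] norm_sgn_decomp[of v] s by auto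
  then have "f \<zeta> (norm u *\<^sub>R sgn u) = f \<zeta> (norm v *\<^sub>R sgn u)" using f by metis
  then have "norm u = norm v"
    using strict[OF \<zeta> e, of "norm u" "norm v"] strict[OF \<zeta> e, of "norm v" "norm u"] u v
    by (metis less_irrefl linorder_neqE norm_ge_zero)
  then show ?thesis using \<open>u = norm u *\<^sub>R sgn u\<close> \<open>v = norm v *\<^sub>R sgn u\<close> by metis
qed

lemma rad_surj:
  assumes \<zeta>: "\<zeta> \<in> Z" and a: "a \<in> Y" "norm a < R'"
  shows "\<exists>u. u \<in> Y \<and> norm u < R \<and> rad \<zeta> u = a"
proof (cases "a = 0")
  case True
  then show ?thesis using a pos cone[of a 0] by (intro exI[of _ 0]) auto
next
  case False
  define e where "e = sgn a"
  have e: "e \<in> Y" "norm e = 1" using False a by (auto simp: e_def norm_sgn sgn_div_norm cone)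
  \<comment> \<open>At this radius the lower bound for f already reaches |a|^2, so the intermediate
    value theorem finds the preimage on the ray.\<close>
  define r where "r = norm a / sqrt \<kappa>"
  have r: "0 \<le> r" "r < R" "\<kappa> * r\<^sup>2 = (norm a)\<^sup>2"
    using a pos by (auto simp: r_def field_simps power_divide)
  have "continuous_on {0..r} ((\<lambda>p. f (fst p) (snd p)) \<circ> (\<lambda>t. (\<zeta>, t *\<^sub>R e)))"
    using \<zeta> e r by (intro continuous_on_compose continuous_on_subset[OF cont] continuous_intros)
      (auto simp: cone)
  then have c: "continuous_on {0..r} (\<lambda>t. f \<zeta> (t *\<^sub>R e))" by (simp add: o_def)
  have "f \<zeta> (0 *\<^sub>R e) \<le> (norm a)\<^sup>2" using zero[OF \<zeta>] by simp
  moreover have "(norm a)\<^sup>2 \<le> f \<zeta> (r *\<^sub>R e)"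
    using lower[of \<zeta> "r *\<^sub>R e"] \<zeta> e r by (simp add: cone)
  ultimately obtain t where t: "0 \<le> t" "t \<le> r" "f \<zeta> (t *\<^sub>R e) = (norm a)\<^sup>2"
    using IVT'[of "\<lambda>t. f \<zeta> (t *\<^sub>R e)" 0 "(norm a)\<^sup>2" r] r(1) c by blast
  have "t \<noteq> 0" using t(3) zero[OF \<zeta>] False by auto
  then have "rad \<zeta> (t *\<^sub>R e) = norm a *\<^sub>R e" using t e by (simp add: rad_def)
  then have "rad \<zeta> (t *\<^sub>R e) = a" by (simp add: e_def norm_sgn_decomp[symmetric])
  then show ?thesis using t e r by (intro exI[of _ "t *\<^sub>R e"]) (auto simp: cone)
qed

lemma irad:
  assumes "\<zeta> \<in> Z" "a \<in> Y" "norm a < R'"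
  shows "irad \<zeta> a \<in> Y" "norm (irad \<zeta> a) < R" "rad \<zeta> (irad \<zeta> a) = a"
  using someI_ex[OF rad_surj[OF assms]] unfolding irad_def by auto

lemma irad_rad:
  assumes "\<zeta> \<in> Z" "u \<in> Y" "norm u < R" "norm (rad \<zeta> u) < R'"
  shows "irad \<zeta> (rad \<zeta> u) = u"
  using irad[OF assms(1) rad_Y[OF assms(2)] assms(4)] assms by (metis rad_inj)

text \<open>The formula is singular at u = 0; there the norm of \<open>rad\<close> is the square
  root of f, which tends to 0.\<close>

lemma continuous_on_rad: "continuous_on (Z \<times> (Y \<inter> ball 0 R)) (\<lambda>p. rad (fst p) (snd p))"
  unfolding continuous_on_def
proof
  fix p assume p: "p \<in> Z \<times> (Y \<inter> ball 0 R)"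
  let ?F = "at p within Z \<times> (Y \<inter> ball 0 R)"
  have f: "((\<lambda>p. f (fst p) (snd p)) \<longlongrightarrow> f (fst p) (snd p)) ?F"
    using cont p by (auto simp: continuous_on_def)
  have s: "(snd \<longlongrightarrow> snd p) ?F" by (intro tendsto_intros)
  show "((\<lambda>p. rad (fst p) (snd p)) \<longlongrightarrow> rad (fst p) (snd p)) ?F"
  proof (cases "snd p = 0")
    case False
    then show ?thesis unfolding rad_def by (intro tendsto_intros f s) simp
  next
    case True
    have "((\<lambda>p. sqrt (f (fst p) (snd p))) \<longlongrightarrow> sqrt (f (fst p) (snd p))) ?F"
      by (intro tendsto_intros f)
    then have "((\<lambda>p. sqrt (f (fst p) (snd p))) \<longlongrightarrow> 0) ?F" using True p zero by auto
    moreover have "\<forall>\<^sub>F q in ?F. sqrt (f (fst q) (snd q)) = norm (rad (fst q) (snd q))"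
      unfolding eventually_at_filter
    proof (intro always_eventually allI impI)
      fix q assume "q \<in> Z \<times> (Y \<inter> ball 0 R)"
      then show "sqrt (f (fst q) (snd q)) = norm (rad (fst q) (snd q))"
        using norm_rad[of "fst q" "snd q"] by (simp add: mem_Times_iff)
    qed
    ultimately have "((\<lambda>p. norm (rad (fst p) (snd p))) \<longlongrightarrow> 0) ?F"
      by (rule Lim_transform_eventually)
    then show ?thesis using True by (simp add: tendsto_norm_zero_iff)
  qed
qed

text \<open>Balls need not be compact, so continuity of the inverse is not automatic. The direction
  of the preimage is that of a. Its norm is trapped by comparing |a|^2, along the moving ray, with f
  at radii slightly below and above the limit.\<close>

lemma continuous_on_irad: "continuous_on (Z \<times> (Y \<inter> ball 0 R')) (\<lambda>p. irad (fst p) (snd p))"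
  unfolding continuous_on_sequentially
proof (intro allI ballI impI, elim conjE)
  fix x :: "nat \<Rightarrow> 'z \<times> 'h" and p
  assume p: "p \<in> Z \<times> (Y \<inter> ball 0 R')" and xS: "\<forall>n. x n \<in> Z \<times> (Y \<inter> ball 0 R')" and xp: "x \<longlonglongrightarrow> p"
  define \<zeta> a where "\<zeta> n = fst (x n)" and "a n = snd (x n)" for n
  define \<zeta>0 a0 where "\<zeta>0 = fst p" and "a0 = snd p"
  have \<zeta>: "\<zeta> n \<in> Z" and a: "a n \<in> Y" "norm (a n) < R'" for n
    using xS[rule_format, of n] by (auto simp: \<zeta>_def a_def mem_Times_iff)
  have \<zeta>0: "\<zeta>0 \<in> Z" and a0: "a0 \<in> Y" "norm a0 < R'" using p by (auto simp: \<zeta>0_def a0_def)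
  have lim: "\<zeta> \<longlonglongrightarrow> \<zeta>0" "a \<longlonglongrightarrow> a0" unfolding \<zeta>_def a_def \<zeta>0_def a0_def
    by (intro tendsto_intros xp)+
  define u where "u n = irad (\<zeta> n) (a n)" for n
  define u0 where "u0 = irad \<zeta>0 a0"
  have u: "u n \<in> Y" "norm (u n) < R" "rad (\<zeta> n) (u n) = a n" for n
    using irad[OF \<zeta>[of n] a[of n]] by (simp_all add: u_def)
  note u0 = irad[OF \<zeta>0 a0, folded u0_def]
  have fu: "f (\<zeta> n) (u n) = (norm (a n))\<^sup>2" for n using norm_rad2[OF \<zeta>[of n] u(1,2)[of n]] u(3)[of n] by simp
  have fu0: "f \<zeta>0 u0 = (norm a0)\<^sup>2" using norm_rad2[OF \<zeta>0 u0(1,2)] u0(3) by simp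
  have "u \<longlonglongrightarrow> u0"
  \<comment> \<open>At a0 = 0 there is no limiting direction, but the lower bound for the norm of
    \<open>rad\<close> forces u to 0.\<close>
  proof (cases "a0 = 0")
    case True
    have "u0 = 0" using True u0 rad_eq_0_iff[OF \<zeta>0 u0(1,2)] by simp
    have "sqrt \<kappa> * norm (u n) \<le> norm (a n)" for n using norm_rad_ge[OF \<zeta>[of n] u(1,2)[of n]] u(3)[of n] by simp
    then have b: "norm (u n) \<le> norm (a n) / sqrt \<kappa>" for n using pos by (simp add: field_simps)
    have "(\<lambda>n. norm (a n) / sqrt \<kappa>) \<longlonglongrightarrow> norm a0 / sqrt \<kappa>" by (intro tendsto_intros lim) (use pos in simp)
    then have l0: "(\<lambda>n. norm (a n) / sqrt \<kappa>) \<longlonglongrightarrow> 0" using True by simp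
    have "u \<longlonglongrightarrow> 0" by (rule Lim_null_comparison[OF _ l0]) (simp add: b)
    then show ?thesis using \<open>u0 = 0\<close> by simp
  next
    case False
    define e where "e n = sgn (a n)" for n
    define e0 where "e0 = sgn a0"
    have e: "e \<longlonglongrightarrow> e0" unfolding e_def e0_def by (intro tendsto_sgn lim False)
    have eY: "e n \<in> Y" for n using a by (simp add: e_def sgn_div_norm cone)
    have e0: "e0 \<in> Y" "norm e0 = 1" using a0 False by (auto simp: e0_def norm_sgn sgn_div_norm cone)
    have en1: "norm (e n) \<le> 1" for n by (simp add: e_def norm_sgn)
    have ev1: "\<forall>\<^sub>F n in sequentially. norm (e n) = 1"
      using tendsto_imp_eventually_ne[OF lim(2) False]
      by (rule eventually_mono) (simp add: e_def norm_sgn)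
    have un: "u n = norm (u n) *\<^sub>R e n" for n
      using norm_sgn_decomp[of "u n"] sgn_rad[OF \<zeta>[of n] u(1,2)[of n]] u(3)[of n] by (simp add: e_def)
    have u0n: "u0 = norm u0 *\<^sub>R e0"
      using norm_sgn_decomp[of u0] sgn_rad[OF \<zeta>0 u0(1,2)] u0(3) by (simp add: e0_def)
    have fl: "(\<lambda>n. f (\<zeta> n) (l *\<^sub>R e n)) \<longlonglongrightarrow> f \<zeta>0 (l *\<^sub>R e0)" if l: "0 \<le> l" "l < R" for l
    proof -
      have "((\<lambda>n. (\<zeta> n, l *\<^sub>R e n)) \<longlongrightarrow> (\<zeta>0, l *\<^sub>R e0)) sequentially" by (intro tendsto_intros lim e)
      moreover have "norm (l *\<^sub>R e n) < R" for n
        using l en1[of n] mult_left_le[of "norm (e n)" l] by simp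
      ultimately have "(\<lambda>n. f (fst (\<zeta> n, l *\<^sub>R e n)) (snd (\<zeta> n, l *\<^sub>R e n)))
          \<longlonglongrightarrow> f (fst (\<zeta>0, l *\<^sub>R e0)) (snd (\<zeta>0, l *\<^sub>R e0))"
        using l \<zeta> \<zeta>0 eY e0
        by (intro continuous_on_tendsto_compose[OF cont] always_eventually) (auto simp: cone)
      then show ?thesis by simp
    qed
    have na: "(\<lambda>n. (norm (a n))\<^sup>2) \<longlonglongrightarrow> (norm a0)\<^sup>2" by (intro tendsto_intros lim)
    have "(\<lambda>n. norm (u n)) \<longlonglongrightarrow> norm u0"
    proof (rule order_tendstoI)
      fix l assume l: "l < norm u0"
      show "\<forall>\<^sub>F n in sequentially. l < norm (u n)"
      proof (cases "l < 0")
        case True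
        show ?thesis by (rule always_eventually) (use True in \<open>auto intro: less_le_trans\<close>)
      next
        case False
        have "f \<zeta>0 (l *\<^sub>R e0) < f \<zeta>0 (norm u0 *\<^sub>R e0)"
          using l False u0(2) by (intro strict \<zeta>0 e0) auto
        then have "f \<zeta>0 (l *\<^sub>R e0) < (norm a0)\<^sup>2" using u0n fu0 by simp
        moreover have "l < R" using l u0(2) by simp
        ultimately have "\<forall>\<^sub>F n in sequentially. f (\<zeta> n) (l *\<^sub>R e n) < (norm (a n))\<^sup>2"
          using fl na False by (intro eventually_less_of_tendsto) auto
        with ev1 show ?thesis
        proof eventually_elim
          case (elim n)
          show ?case
          proof (rule ccontr)
            assume "\<not> l < norm (u n)"
            then have "f (\<zeta> n) (norm (u n) *\<^sub>R e n) \<le> f (\<zeta> n) (l *\<^sub>R e n)"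
              using \<open>l < R\<close> elim by (intro mono_le \<zeta> eY) auto
            then show False using elim fu[of n] un[of n] by simp
          qed
        qed
      qed
    next
      fix l' assume l': "norm u0 < l'"
      \<comment> \<open>The comparison radius has to stay below \<open>R\<close>, where f is
        controlled.\<close>
      define l where "l = min l' ((norm u0 + R) / 2)"
      have l: "norm u0 < l" "l < R" "l \<le> l'" using l' u0(2) by (auto simp: l_def min_def)
      have l0: "0 \<le> l" using l(1) norm_ge_zero[of u0] by linarith
      have "f \<zeta>0 (norm u0 *\<^sub>R e0) < f \<zeta>0 (l *\<^sub>R e0)" using l by (intro strict \<zeta>0 e0) auto
      then have "(norm a0)\<^sup>2 < f \<zeta>0 (l *\<^sub>R e0)" using u0n fu0 by simp
      then have "\<forall>\<^sub>F n in sequentially. (norm (a n))\<^sup>2 < f (\<zeta> n) (l *\<^sub>R e n)"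
        using fl na l0 l by (intro eventually_less_of_tendsto) auto
      with ev1 show "\<forall>\<^sub>F n in sequentially. norm (u n) < l'"
      proof eventually_elim
        case (elim n)
        have "norm (u n) < l"
        proof (rule ccontr)
          assume "\<not> norm (u n) < l"
          then have "f (\<zeta> n) (l *\<^sub>R e n) \<le> f (\<zeta> n) (norm (u n) *\<^sub>R e n)"
            using u(2)[of n] elim l0 by (intro mono_le \<zeta> eY) auto
          then show False using elim fu[of n] un[of n] by simp
        qed
        then show ?case using l by simp
      qed
    qed
    then have "(\<lambda>n. norm (u n) *\<^sub>R e n) \<longlonglongrightarrow> norm u0 *\<^sub>R e0"
      by (rule tendsto_scaleR) (rule e)
    moreover have "(\<lambda>n. norm (u n) *\<^sub>R e n) = u"
      by (rule ext) (rule un[symmetric])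
    ultimately show ?thesis unfolding u0n[symmetric] by (rule back_subst[where P = "\<lambda>v. v \<longlonglongrightarrow> u0"])
  qed
  moreover have "u = (\<lambda>p. irad (fst p) (snd p)) \<circ> x"
    by (rule ext) (simp add: u_def \<zeta>_def a_def)
  ultimately show "((\<lambda>p. irad (fst p) (snd p)) \<circ> x) \<longlonglongrightarrow> irad (fst p) (snd p)"
    by (simp add: u0_def \<zeta>0_def a0_def)
qed

end

text \<open>\<open>\<gamma>\<close> is Lipschitz but need not be differentiable. The remainder in
  the expansion of L is small against |\<gamma> z' - \<gamma> z|, hence against |z' - z|, and the
  linear term is exactly linear in z' - z by \<open>tan\<close>.\<close>

lemma has_derivative_along_tangent:
  assumes L: "(L has_derivative D) (at (\<gamma> z))" and A: "bounded_linear A"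
    and lip: "\<And>z'. z' \<in> S \<Longrightarrow> norm (\<gamma> z' - \<gamma> z) \<le> C * norm (z' - z)"
    and tan: "\<And>z'. z' \<in> S \<Longrightarrow> D (\<gamma> z' - \<gamma> z) = A (z' - z)"
  shows "((\<lambda>z. L (\<gamma> z)) has_derivative A) (at z within S)"
  unfolding has_derivative_within_alt
proof (intro conjI A allI impI)
  fix e :: real assume e: "0 < e"
  define C' where "C' = \<bar>C\<bar> + 1"
  have C': "0 < C'" by (simp add: C'_def)
  have lip': "norm (\<gamma> z' - \<gamma> z) \<le> C' * norm (z' - z)" if "z' \<in> S" for z'
  proof -
    have "C * norm (z' - z) \<le> C' * norm (z' - z)" by (intro mult_right_mono) (auto simp: C'_def)
    then show ?thesis using lip[OF that] by linarith
  qed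
  have "0 < e / C'" using e C' by simp
  then obtain d where d: "0 < d"
    "\<And>y. norm (y - \<gamma> z) < d \<Longrightarrow> norm (L y - L (\<gamma> z) - D (y - \<gamma> z)) \<le> e / C' * norm (y - \<gamma> z)"
    using L unfolding has_derivative_at_alt by blast
  show "\<exists>d>0. \<forall>y\<in>S. norm (y - z) < d \<longrightarrow> norm (L (\<gamma> y) - L (\<gamma> z) - A (y - z)) \<le> e * norm (y - z)"
  proof (intro exI[of _ "d / C'"] conjI ballI impI)
    show "0 < d / C'" using d C' by simp
    fix y assume y: "y \<in> S" "norm (y - z) < d / C'"
    have "norm (\<gamma> y - \<gamma> z) \<le> C' * norm (y - z)" by (rule lip'[OF y(1)])
    also have "\<dots> < d" using y(2) C' by (simp add: field_simps)
    finally have "norm (L (\<gamma> y) - L (\<gamma> z) - A (y - z)) \<le> e / C' * norm (\<gamma> y - \<gamma> z)"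
      using d(2) tan[OF y(1)] by metis
    also have "\<dots> \<le> e / C' * (C' * norm (y - z))" using lip'[OF y(1)] e C' by (intro mult_left_mono) auto
    also have "\<dots> = e * norm (y - z)" using C' by simp
    finally show "norm (L (\<gamma> y) - L (\<gamma> z) - A (y - z)) \<le> e * norm (y - z)" .
  qed
qed

section \<open>The splitting homeomorphism\<close>

lemma open_Collect_norm_less:
  fixes h :: "'a::topological_space \<Rightarrow> 'b::real_normed_vector"
  assumes "open S" "continuous_on S h"
  shows "open {x \<in> S. norm (h x) < c}"
proof -
  have "{x \<in> S. norm (h x) < c} = S \<inter> h -` ball 0 c" by auto
  then show ?thesis using continuous_open_preimage[OF assms(2,1) open_ball] by simp
qed

text \<open>The analytic content taken from (A): a Lipschitz gradient that is strongly monotone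
  along H^+ + H^- after a sign change on H^-, on one common ball.\<close>

locale splitting_functional = orth_splitting pp pn
  for pp pn :: "'h::{real_inner,complete_space} \<Rightarrow> 'h" +
  fixes L :: "'h \<Rightarrow> real" and g :: "'h \<Rightarrow> 'h" and \<rho> a K :: real
  assumes pos: "0 < \<rho>" "0 < a" "a \<le> K"
    and deriv: "\<And>x. x \<in> ball 0 \<rho> \<Longrightarrow> (L has_derivative (\<lambda>h. inner h (g x))) (at x)"
    and lip: "\<And>x y. x \<in> ball 0 \<rho> \<Longrightarrow> y \<in> ball 0 \<rho> \<Longrightarrow> norm (g x - g y) \<le> K * norm (x - y)"
    and mono: "\<And>x y. x \<in> ball 0 \<rho> \<Longrightarrow> y \<in> ball 0 \<rho> \<Longrightarrow> pp (x - y) + pn (x - y) = x - y \<Longrightarrow>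
      a * (norm (x - y))\<^sup>2 \<le> inner (g x - g y) (pp (x - y) - pn (x - y))"
    and g0: "g 0 = 0"
begin

definition Hp where "Hp = {x. pp x = x}"
definition Hn where "Hn = {x. pn x = x}"
definition H0 where "H0 = {x. pp x = 0 \<and> pn x = 0}"

lemma reduced_unique:
  assumes "x \<in> ball 0 \<rho>" "y \<in> ball 0 \<rho>" and d: "pp (x - y) + pn (x - y) = x - y"
    and "pp (g x) = 0" "pn (g x) = 0" "pp (g y) = 0" "pn (g y) = 0"
  shows "x = y"
proof (rule monotone_projected_zero_unique[where q = "\<lambda>x. pp x + pn x" and J = "\<lambda>x. pp x - pn x"
      and a = a and g = g])
  show "linear (\<lambda>x. pp x + pn x)" by (intro linear_compose_add lin_pp lin_pn)
  show "a * (norm (x - y))\<^sup>2 \<le> inner (g x - g y) (pp (x - y) - pn (x - y))"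
    by (rule mono[OF assms(1,2) d])
qed (use assms pos d in \<open>simp_all add: inner_simps pp_adj pn_adj pp_simps pn_simps\<close>)

lemma continuous_on_L: "continuous_on (ball 0 \<rho>) L"
  by (rule has_derivative_continuous_on) (rule has_derivative_at_withinI[OF deriv])

end

text \<open>\<open>\<phi>\<close> solves in H^+ + H^- and \<open>\<eta>\<close> in H^- alone, both
  over full balls of the space. The sizes are nested: \<open>z + \<phi> z\<close> stays within
  \<delta>/2, leaving \<delta>/2 for u before \<open>\<eta>\<close> is applied, and then
  \<open>m z u\<close> stays within \<rho>/2, leaving \<rho>/2 for w.\<close>

locale reduced_splitting = splitting_functional +
  fixes \<phi> \<eta> :: "'a \<Rightarrow> 'a" and \<epsilon> \<delta> :: real
  assumes size: "0 < \<epsilon>" "0 < \<delta>" "(1 + K / a) * \<delta> \<le> \<rho> / 2" "(1 + K / a) * \<epsilon> \<le> \<delta> / 2"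
    and \<phi>: "\<And>z. z \<in> ball 0 \<epsilon> \<Longrightarrow> pp (\<phi> z) + pn (\<phi> z) = \<phi> z"
      "\<And>z. z \<in> ball 0 \<epsilon> \<Longrightarrow> pp (g (z + \<phi> z)) = 0"
      "\<And>z. z \<in> ball 0 \<epsilon> \<Longrightarrow> pn (g (z + \<phi> z)) = 0"
      "\<And>z. z \<in> ball 0 \<epsilon> \<Longrightarrow> norm (\<phi> z) \<le> K / a * norm z"
      "\<And>x y. x \<in> ball 0 \<epsilon> \<Longrightarrow> y \<in> ball 0 \<epsilon> \<Longrightarrow> norm (\<phi> x - \<phi> y) \<le> K / a * norm (x - y)"
    and \<eta>: "\<And>z. z \<in> ball 0 \<delta> \<Longrightarrow> pn (\<eta> z) = \<eta> z"
      "\<And>z. z \<in> ball 0 \<delta> \<Longrightarrow> pn (g (z + \<eta> z)) = 0"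
      "\<And>z. z \<in> ball 0 \<delta> \<Longrightarrow> norm (\<eta> z) \<le> K / a * norm z"
      "\<And>x y. x \<in> ball 0 \<delta> \<Longrightarrow> y \<in> ball 0 \<delta> \<Longrightarrow> norm (\<eta> x - \<eta> y) \<le> K / a * norm (x - y)"
begin

section \<open>Energy gain along H^+ and loss along H^-\<close>

definition D0 where "D0 = sub_ball H0 \<epsilon>"
definition base where "base z u = z + \<phi> z + u"
text \<open>Among the points \<open>m z u + w\<close> with w in H^- of norm below \<rho>/2, L is
  largest at w = 0, by \<open>f2_growth\<close>.\<close>

definition m where "m z u = base z u + \<eta> (base z u)"
text \<open>\<open>L (m z u + w) - L (z + \<phi> z)\<close> equals
  \<open>f1 z u - f2 (z, u) w\<close> with both terms nonnegative; the signs in the normal form come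
  from here.\<close>

definition f1 where "f1 z u = L (m z u) - L (z + \<phi> z)"
definition f2 where "f2 p w = L (m (fst p) (snd p)) - L (m (fst p) (snd p) + w)"

lemma Ka: "1 \<le> K / a" using pos by simp

lemma D0D:
  assumes "z \<in> D0"
  shows "pp z = 0" "pn z = 0" "z \<in> ball 0 \<epsilon>" "norm z < \<epsilon>"
  using assms by (auto simp: D0_def sub_ball_def H0_def)

lemma norm_zphi: assumes "z \<in> ball 0 \<epsilon>" shows "norm (z + \<phi> z) < \<delta> / 2"
proof -
  have "norm (z + \<phi> z) \<le> norm z + K / a * norm z"
    using norm_triangle_ineq[of z "\<phi> z"] \<phi>(4)[OF assms] by linarith
  also have "\<dots> = (1 + K / a) * norm z" by (simp add: algebra_simps)
  also have "\<dots> < (1 + K / a) * \<epsilon>" using assms Ka by (intro mult_strict_left_mono) auto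
  finally show ?thesis using size by linarith
qed

lemma norm_eta: assumes "y \<in> ball 0 \<delta>" shows "norm (y + \<eta> y) < \<rho> / 2"
proof -
  have "norm (y + \<eta> y) \<le> norm y + K / a * norm y"
    using norm_triangle_ineq[of y "\<eta> y"] \<eta>(3)[OF assms] by linarith
  also have "\<dots> = (1 + K / a) * norm y" by (simp add: algebra_simps)
  also have "\<dots> < (1 + K / a) * \<delta>" using assms Ka by (intro mult_strict_left_mono) auto
  finally show ?thesis using size by linarith
qed

lemma \<delta>_le: "\<delta> \<le> \<rho> / 4"
proof -
  have "2 * \<delta> \<le> (1 + K / a) * \<delta>" using Ka size by (intro mult_right_mono) auto
  then show ?thesis using size by linarith
qed

lemma zphi_ball: "z \<in> ball 0 \<epsilon> \<Longrightarrow> z + \<phi> z \<in> ball 0 \<rho>" "z \<in> ball 0 \<epsilon> \<Longrightarrow> z + \<phi> z \<in> ball 0 \<delta>"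
  using norm_zphi[of z] \<delta>_le size pos by auto

lemma base_ball: "z \<in> D0 \<Longrightarrow> norm u < \<delta> / 2 \<Longrightarrow> base z u \<in> ball 0 \<delta>"
  using norm_zphi[of z] D0D(3)[of z] norm_triangle_ineq[of "z + \<phi> z" u] by (simp add: base_def)

lemma m_norm: "z \<in> D0 \<Longrightarrow> norm u < \<delta> / 2 \<Longrightarrow> norm (m z u) < \<rho> / 2"
  unfolding m_def by (rule norm_eta[OF base_ball])

lemma m_add_ball: "z \<in> D0 \<Longrightarrow> norm u < \<delta> / 2 \<Longrightarrow> norm w < \<rho> / 2 \<Longrightarrow> m z u + w \<in> ball 0 \<rho>"
  using m_norm[of z u] norm_triangle_ineq[of "m z u" w] by simp

lemma m_ball: "z \<in> D0 \<Longrightarrow> norm u < \<delta> / 2 \<Longrightarrow> m z u \<in> ball 0 \<rho>"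
  using m_add_ball[of z u 0] pos by simp

lemma pn_g_m: "z \<in> D0 \<Longrightarrow> norm u < \<delta> / 2 \<Longrightarrow> pn (g (m z u)) = 0"
  unfolding m_def by (rule \<eta>(2)[OF base_ball])

lemma pn_eta: "z \<in> D0 \<Longrightarrow> norm u < \<delta> / 2 \<Longrightarrow> pn (\<eta> (base z u)) = \<eta> (base z u)"
  by (rule \<eta>(1)[OF base_ball])

lemma pp_eta: "z \<in> D0 \<Longrightarrow> norm u < \<delta> / 2 \<Longrightarrow> pp (\<eta> (base z u)) = 0"
  using pn_eta[of z u] pp_pn by metis

text \<open>At \<open>z + \<phi> z\<close> the H^- part of the gradient is 0 already, so 0 and
  \<open>\<eta> (z + \<phi> z)\<close> solve the same equation in H^- and agree by uniqueness. Hence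
  u = 0 corresponds to the reduced point.\<close>

lemma eta_zphi:
  assumes z: "z \<in> ball 0 \<epsilon>"
  shows "\<eta> (z + \<phi> z) = 0"
proof -
  define y where "y = z + \<phi> z"
  have y: "y \<in> ball 0 \<delta>" unfolding y_def by (rule zphi_ball(2)[OF z])
  have "norm (y + \<eta> y) < \<rho>" "norm y < \<rho>" using norm_eta[OF y] y \<delta>_le pos by auto
  then have b: "y + \<eta> y \<in> ball 0 \<rho>" "y \<in> ball 0 \<rho>" by auto
  have e: "pn (\<eta> y) = \<eta> y" "pp (\<eta> y) = 0" using \<eta>(1)[OF y] pp_pn[of "\<eta> y"] by auto
  have "y + \<eta> y = y"
  proof (rule monotone_projected_zero_unique[where q = pn and J = "\<lambda>x. pp x - pn x" and g = g])
    show "0 < a" by (rule pos)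
    show "linear pn" by (rule lin_pn)
    show "a * (norm (y + \<eta> y - y))\<^sup>2 \<le> inner (g (y + \<eta> y) - g y) (pp (y + \<eta> y - y) - pn (y + \<eta> y - y))"
      by (rule mono[OF b]) (simp add: e)
    show "pn (g (y + \<eta> y)) = 0" by (rule \<eta>(2)[OF y])
    show "pn (g y) = 0" unfolding y_def by (rule \<phi>(3)[OF z])
    show "pn (pp (pn x) - pn (pn x)) = pp (pn x) - pn (pn x)" for x by (simp add: pp_simps pn_simps)
  qed (simp_all add: pn_adj e)
  then show ?thesis by (simp add: y_def)
qed

lemma m_0: "z \<in> ball 0 \<epsilon> \<Longrightarrow> m z 0 = z + \<phi> z"
  by (simp add: m_def base_def eta_zphi)

lemma continuous_on_phi: "continuous_on (ball 0 \<epsilon>) \<phi>"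
proof (rule lipschitz_on_continuous_on)
  show "(K / a)-lipschitz_on (ball 0 \<epsilon>) \<phi>"
  proof (rule lipschitz_onI)
    show "dist (\<phi> x) (\<phi> y) \<le> K / a * dist x y" if "x \<in> ball 0 \<epsilon>" "y \<in> ball 0 \<epsilon>" for x y
      unfolding dist_norm by (rule \<phi>(5)[OF that])
  qed (use Ka in simp)
qed

lemma continuous_on_eta: "continuous_on (ball 0 \<delta>) \<eta>"
proof (rule lipschitz_on_continuous_on)
  show "(K / a)-lipschitz_on (ball 0 \<delta>) \<eta>"
  proof (rule lipschitz_onI)
    show "dist (\<eta> x) (\<eta> y) \<le> K / a * dist x y" if "x \<in> ball 0 \<delta>" "y \<in> ball 0 \<delta>" for x y
      unfolding dist_norm by (rule \<eta>(4)[OF that])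
  qed (use Ka in simp)
qed

lemma continuous_on_phi':
  "continuous_on S h \<Longrightarrow> (\<And>x. x \<in> S \<Longrightarrow> norm (h x) < \<epsilon>) \<Longrightarrow> continuous_on S (\<lambda>x. \<phi> (h x))"
  by (rule continuous_on_compose2[OF continuous_on_phi]) auto

lemma continuous_on_base_eta:
  assumes "continuous_on S zf" "continuous_on S uf" "\<And>x. x \<in> S \<Longrightarrow> zf x \<in> D0" "\<And>x. x \<in> S \<Longrightarrow> norm (uf x) < \<delta> / 2"
  shows "continuous_on S (\<lambda>x. \<eta> (base (zf x) (uf x)))" "continuous_on S (\<lambda>x. m (zf x) (uf x))"
proof -
  have b: "continuous_on S (\<lambda>x. base (zf x) (uf x))" unfolding base_def
    using D0D(4) assms by (intro continuous_intros continuous_on_phi') auto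
  show e: "continuous_on S (\<lambda>x. \<eta> (base (zf x) (uf x)))"
    using base_ball assms by (intro continuous_on_compose2[OF continuous_on_eta b]) auto
  show "continuous_on S (\<lambda>x. m (zf x) (uf x))" unfolding m_def by (intro continuous_intros b e)
qed

text \<open>Along m z (t u) only u contributes to the derivative of L: the moving
  \<open>\<eta>\<close> lies in H^-, where the gradient has no component. Monotonicity between this
  point and \<open>z + \<phi> z\<close> bounds t times the derivative below by a |t u|^2.\<close>

lemma f1_growth:
  assumes z: "z \<in> D0" and u: "u \<in> Hp" "norm u < \<delta> / 2" and s: "0 \<le> s" "s \<le> 1"
  shows "a / 2 * (norm u)\<^sup>2 * (1 - s\<^sup>2) \<le> f1 z u - f1 z (s *\<^sub>R u)"
proof -
  define \<gamma> where "\<gamma> t = m z (t *\<^sub>R u)" for t :: real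
  \<comment> \<open>An open set of parameters containing [0,1], so that derivatives within it are
    derivatives at the point.\<close>
  define S where "S = {t :: real. norm (t *\<^sub>R u) < \<delta> / 2}"
  have oS: "open S" unfolding S_def by (intro open_Collect_less continuous_intros)
  have tS: "t \<in> S" if "0 \<le> t" "t \<le> 1" for t
    using u that mult_left_le_one_le[of "norm u" t] by (simp add: S_def)
  have ppu: "pp u = u" "pn u = 0" using u pn_pp[of u] by (auto simp: Hp_def)
  have \<gamma>d: "\<gamma> t' - \<gamma> t = (t' - t) *\<^sub>R u + (\<eta> (base z (t' *\<^sub>R u)) - \<eta> (base z (t *\<^sub>R u)))" for t t'
    by (simp add: \<gamma>_def m_def base_def algebra_simps)
  have orth: "inner (\<eta> (base z (t' *\<^sub>R u))) (g (\<gamma> t)) = 0" if "t \<in> S" "t' \<in> S" for t t'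
    using pn_eta[OF z, of "t' *\<^sub>R u"] pn_g_m[OF z, of "t *\<^sub>R u"] that
    unfolding S_def \<gamma>_def by (metis (mono_tags) inner_zero_right mem_Collect_eq pn_adj)
  have D: "((\<lambda>t. L (\<gamma> t)) has_real_derivative inner u (g (\<gamma> t))) (at t)" if t: "0 \<le> t" "t \<le> 1" for t
  proof -
    have "((\<lambda>t. L (\<gamma> t)) has_derivative (\<lambda>h. h * inner u (g (\<gamma> t)))) (at t within S)"
    proof (rule has_derivative_along_tangent[where L = L and \<gamma> = \<gamma> and C = "(1 + K / a) * norm u"
          and D = "\<lambda>h. inner h (g (\<gamma> t))"])
      show "(L has_derivative (\<lambda>h. inner h (g (\<gamma> t)))) (at (\<gamma> t))"
        using tS[OF t] unfolding \<gamma>_def S_def by (intro deriv m_ball z) auto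
      show "bounded_linear (\<lambda>h. h * inner u (g (\<gamma> t)))" by (rule bounded_linear_mult_left)
      fix t' assume t': "t' \<in> S"
      have "norm (\<eta> (base z (t' *\<^sub>R u)) - \<eta> (base z (t *\<^sub>R u))) \<le> K / a * norm (base z (t' *\<^sub>R u) - base z (t *\<^sub>R u))"
        using t' tS[OF t] by (intro \<eta>(4) base_ball z) (auto simp: S_def)
      also have "base z (t' *\<^sub>R u) - base z (t *\<^sub>R u) = (t' - t) *\<^sub>R u" by (simp add: base_def algebra_simps)
      finally have "norm (\<gamma> t' - \<gamma> t) \<le> norm ((t' - t) *\<^sub>R u) + K / a * norm ((t' - t) *\<^sub>R u)"
        unfolding \<gamma>d by (intro norm_triangle_le add_left_mono)
      then show "norm (\<gamma> t' - \<gamma> t) \<le> ((1 + K / a) * norm u) * norm (t' - t)"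
        by (simp add: distrib_right distrib_left mult_ac)
      show "inner (\<gamma> t' - \<gamma> t) (g (\<gamma> t)) = (t' - t) * inner u (g (\<gamma> t))"
        unfolding \<gamma>d using orth[OF tS[OF t]] t' tS[OF t] by (simp add: inner_simps)
    qed
    then show ?thesis using at_within_open[OF tS[OF t] oS]
      by (simp add: has_field_derivative_def mult_commute_abs)
  qed
  have grow: "2 * (a / 2 * (norm u)\<^sup>2) * t \<le> inner u (g (\<gamma> t))" if t: "0 \<le> t" "t \<le> 1" for t
  \<comment> \<open>Monotonicity gives the bound multiplied by t, so t = 0 is separate: there the
    derivative vanishes because the gradient has no H^+ part at \<open>z + \<phi> z\<close>.\<close>
  proof (cases "t = 0")
    case True
    have "inner u (g (\<gamma> 0)) = inner (pp u) (g (z + \<phi> z))" using m_0 D0D(3)[OF z] by (simp add: \<gamma>_def ppu)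
    also have "\<dots> = 0" unfolding pp_adj using \<phi>(2)[OF D0D(3)[OF z]] by simp
    finally show ?thesis using True by simp
  next
    case False
    then have t0: "0 < t" using t by simp
    have nt: "norm (t *\<^sub>R u) < \<delta> / 2" using tS[OF t] by (simp add: S_def)
    define y where "y = z + \<phi> z"
    define e where "e = \<eta> (base z (t *\<^sub>R u))"
    have d: "\<gamma> t - y = t *\<^sub>R u + e" by (simp add: \<gamma>_def m_def y_def e_def base_def)
    have e: "pn e = e" "pp e = 0" using pn_eta[OF z nt] pp_eta[OF z nt] by (auto simp: e_def)
    have ppd: "pp (\<gamma> t - y) = t *\<^sub>R u" and pnd: "pn (\<gamma> t - y) = e"
      unfolding d by (simp_all add: pp_simps pn_simps ppu e)
    have gy: "pp (g y) = 0" "pn (g y) = 0" using \<phi>(2,3)[OF D0D(3)[OF z]] by (auto simp: y_def)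
    \<comment> \<open>Only t times the pairing of u with \<open>g (\<gamma> t)\<close> will survive:
      \<open>g y\<close> is orthogonal to u and e, and \<open>g (\<gamma> t)\<close> is orthogonal
      to e.\<close>
    have "a * (norm (\<gamma> t - y))\<^sup>2 \<le> inner (g (\<gamma> t) - g y) (t *\<^sub>R u - e)"
    proof -
      have "\<gamma> t \<in> ball 0 \<rho>" unfolding \<gamma>_def by (rule m_ball[OF z nt])
      moreover have "y \<in> ball 0 \<rho>" unfolding y_def by (rule zphi_ball(1)[OF D0D(3)[OF z]])
      moreover have "pp (\<gamma> t - y) + pn (\<gamma> t - y) = \<gamma> t - y" using ppd pnd d by simp
      ultimately show ?thesis using mono[of "\<gamma> t" y] unfolding ppd pnd by blast
    qed
    also have "inner (g y) (t *\<^sub>R u - e) = 0"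
    proof -
      have "inner (g y) u = inner (pp (g y)) u" by (simp add: pp_adj ppu)
      moreover have "inner (g y) e = inner (pn (g y)) e" by (simp add: pn_adj e)
      ultimately show ?thesis by (simp add: gy inner_simps)
    qed
    then have "inner (g (\<gamma> t) - g y) (t *\<^sub>R u - e) = inner (g (\<gamma> t)) (t *\<^sub>R u - e)" by (simp add: inner_diff_left)
    also have "\<dots> = t * inner u (g (\<gamma> t))"
      using orth[OF tS[OF t] tS[OF t]] by (simp add: inner_simps e_def inner_commute)
    finally have 1: "a * (norm (\<gamma> t - y))\<^sup>2 \<le> t * inner u (g (\<gamma> t))" .
    have "(norm (t *\<^sub>R u))\<^sup>2 \<le> (norm (\<gamma> t - y))\<^sup>2"
      using norm_pp[of "\<gamma> t - y"] unfolding ppd by (intro power_mono) auto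
    then have "a * (t\<^sup>2 * (norm u)\<^sup>2) \<le> a * (norm (\<gamma> t - y))\<^sup>2"
      using pos by (intro mult_left_mono) (auto simp: power_mult_distrib)
    then have "t * (a * (norm u)\<^sup>2 * t) \<le> t * inner u (g (\<gamma> t))" using 1 by (simp add: power2_eq_square algebra_simps)
    then show ?thesis using t0 by simp
  qed
  have "a / 2 * (norm u)\<^sup>2 * (1 - s\<^sup>2) \<le> L (\<gamma> 1) - L (\<gamma> s)"
    by (rule quadratic_growth[OF D grow s])
  then show ?thesis by (simp add: f1_def \<gamma>_def)
qed

text \<open>The path is a straight segment, so L is differentiated directly. As the gradient at
  \<open>m z u\<close> is orthogonal to w, monotonicity with its sign change on H^- bounds the
  decrease of L.\<close>

lemma f2_growth:
  assumes z: "z \<in> D0" and u: "norm u < \<delta> / 2" and w: "w \<in> Hn" "norm w < \<rho> / 2" and s: "0 \<le> s" "s \<le> 1"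
  shows "a / 2 * (norm w)\<^sup>2 * (1 - s\<^sup>2) \<le> f2 (z, u) w - f2 (z, u) (s *\<^sub>R w)"
proof -
  define x where "x = m z u"
  have pnw: "pn w = w" "pp w = 0" using w pp_pn[of w] by (auto simp: Hn_def)
  have b: "x + t *\<^sub>R w \<in> ball 0 \<rho>" if "0 \<le> t" "t \<le> 1" for t
    unfolding x_def using w that mult_left_le_one_le[of "norm w" t] by (intro m_add_ball z u) simp
  have xb: "x \<in> ball 0 \<rho>" using b[of 0] by simp
  have gx: "inner w (g x) = 0"
    using pn_g_m[OF z u] pn_adj[of w "g x"] by (simp add: pnw x_def)
  have D: "((\<lambda>t. - L (x + t *\<^sub>R w)) has_real_derivative - inner w (g (x + t *\<^sub>R w))) (at t)"
    if t: "0 \<le> t" "t \<le> 1" for t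
  proof -
    have "((\<lambda>t. x + t *\<^sub>R w) has_derivative (\<lambda>h. h *\<^sub>R w)) (at t)"
      by (auto intro!: derivative_eq_intros)
    from has_derivative_compose[OF this deriv[OF b[OF t]]]
    show ?thesis
      by (auto simp: has_field_derivative_def mult.commute[of "inner w (g (x + t *\<^sub>R w))"] intro!: derivative_eq_intros)
  qed
  have grow: "2 * (a / 2 * (norm w)\<^sup>2) * t \<le> - inner w (g (x + t *\<^sub>R w))" if t: "0 \<le> t" "t \<le> 1" for t
  proof (cases "t = 0")
    case True
    then show ?thesis using gx by simp
  next
    case False
    then have t0: "0 < t" using t by simp
    have "a * (norm (t *\<^sub>R w))\<^sup>2 \<le> inner (g (x + t *\<^sub>R w) - g x) (- (t *\<^sub>R w))"
      using mono[OF b[OF t] xb] by (simp add: pp_simps pn_simps pnw)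
    also have "\<dots> = t * - inner w (g (x + t *\<^sub>R w))" using gx by (simp add: inner_simps inner_commute)
    finally have "t * (a * (norm w)\<^sup>2 * t) \<le> t * - inner w (g (x + t *\<^sub>R w))"
      by (simp add: power_mult_distrib power2_eq_square algebra_simps)
    then have "a * (norm w)\<^sup>2 * t \<le> - inner w (g (x + t *\<^sub>R w))" using t0 by (simp only: mult_le_cancel_left_pos)
    then show ?thesis by simp
  qed
  have "a / 2 * (norm w)\<^sup>2 * (1 - s\<^sup>2) \<le> - L (x + 1 *\<^sub>R w) - - L (x + s *\<^sub>R w)"
    by (rule quadratic_growth[OF D grow s])
  then show ?thesis by (simp add: f2_def x_def)
qed

sublocale r1: radial D0 Hp "\<delta> / 2" "a / 2" f1
proof
  show "c *\<^sub>R u \<in> Hp" if "u \<in> Hp" for u c using that by (simp add: Hp_def pp_simps)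
  show "0 < \<delta> / 2" "0 < a / 2" using size pos by auto
  show "f1 z 0 = 0" if "z \<in> D0" for z using m_0[OF D0D(3)[OF that]] by (simp add: f1_def)
  show "a / 2 * (norm u)\<^sup>2 * (1 - s\<^sup>2) \<le> f1 z u - f1 z (s *\<^sub>R u)"
    if "z \<in> D0" "u \<in> Hp" "norm u < \<delta> / 2" "0 \<le> s" "s \<le> 1" for z u s
    by (rule f1_growth[OF that])
  have "continuous_on (D0 \<times> (Hp \<inter> ball 0 (\<delta> / 2))) (\<lambda>p. fst p + \<phi> (fst p))"
    by (intro continuous_intros continuous_on_phi') (auto dest: D0D)
  moreover have "continuous_on (D0 \<times> (Hp \<inter> ball 0 (\<delta> / 2))) (\<lambda>p. m (fst p) (snd p))"
    by (intro continuous_intros continuous_on_base_eta) auto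
  ultimately show "continuous_on (D0 \<times> (Hp \<inter> ball 0 (\<delta> / 2))) (\<lambda>p. f1 (fst p) (snd p))"
    unfolding f1_def using m_ball zphi_ball(1)[OF D0D(3)]
    by (intro continuous_on_diff continuous_on_compose2[OF continuous_on_L]) auto
qed

text \<open>The parameter is a pair because the point from which w departs depends on both z and
  u.\<close>

sublocale r2: radial "D0 \<times> (Hp \<inter> ball 0 (\<delta> / 2))" Hn "\<rho> / 2" "a / 2" f2
proof
  show "c *\<^sub>R u \<in> Hn" if "u \<in> Hn" for u c using that by (simp add: Hn_def pn_simps)
  show "0 < \<rho> / 2" "0 < a / 2" using pos by auto
  show "f2 p 0 = 0" for p by (simp add: f2_def)
  show "a / 2 * (norm w)\<^sup>2 * (1 - s\<^sup>2) \<le> f2 p w - f2 p (s *\<^sub>R w)"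
    if "p \<in> D0 \<times> (Hp \<inter> ball 0 (\<delta> / 2))" "w \<in> Hn" "norm w < \<rho> / 2" "0 \<le> s" "s \<le> 1" for p w s
    using f2_growth[of "fst p" "snd p" w s] that by (auto simp: mem_Times_iff)
  let ?S = "(D0 \<times> (Hp \<inter> ball 0 (\<delta> / 2))) \<times> (Hn \<inter> ball 0 (\<rho> / 2))"
  have "continuous_on ?S (\<lambda>p. m (fst (fst p)) (snd (fst p)))"
    by (intro continuous_intros continuous_on_base_eta) auto
  moreover from this have "continuous_on ?S (\<lambda>p. m (fst (fst p)) (snd (fst p)) + snd p)"
    by (intro continuous_intros)
  ultimately show "continuous_on ?S (\<lambda>p. f2 (fst p) (snd p))"
    unfolding f2_def using m_ball m_add_ball
    by (intro continuous_on_diff continuous_on_compose2[OF continuous_on_L]) auto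
qed

section \<open>Adapted coordinates and their inverse\<close>

definition U where "U x = pp (x - \<phi> (p0 x))"
text \<open>From \<open>m z u + w\<close> the coordinates are recovered in the order z, u, w:
  \<open>\<phi>\<close> is known once z is, and the correction by \<open>\<eta>\<close> lies in H^-,
  so it does not disturb u.\<close>

definition Wc where "Wc x = pn (x - \<phi> (p0 x)) - \<eta> (base (p0 x) (U x))"
definition Ap where "Ap x = r1.rad (p0 x) (U x)"
definition An where "An x = r2.rad (p0 x, U x) (Wc x)"

text \<open>Each of these sets makes the next coordinate continuous and correctly placed;
  \<open>W\<close> finally restricts the rescaled coordinates to the balls on which
  \<open>irad\<close> inverts \<open>rad\<close>.\<close>

definition S0 where "S0 = {x \<in> UNIV. norm (p0 x) < \<epsilon>}"
definition S1 where "S1 = {x \<in> S0. norm (U x) < \<delta> / 2}"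
definition S2 where "S2 = {x \<in> S1. norm (Wc x) < \<rho> / 2}"
definition W where "W = {x \<in> {x \<in> S2. norm (Ap x) < r1.R'}. norm (An x) < r2.R'}"

definition \<phi>z where
  "\<phi>z z v = (let u = r1.irad z (pp v) in u + \<eta> (base z u) + r2.irad (z, u) (pn v))"
definition \<Phi> where "\<Phi> p = fst p + \<phi> (fst p) + \<phi>z (fst p) (snd p)"
definition \<Psi> where "\<Psi> x = (p0 x, Ap x + An x)"

lemma p0_D0: "x \<in> S0 \<Longrightarrow> p0 x \<in> D0"
  by (simp add: S0_def D0_def sub_ball_def H0_def pp_p0 pn_p0)

lemma U_Hp: "U x \<in> Hp" by (simp add: U_def Hp_def pp_simps)

lemma Wc_Hn: "x \<in> S1 \<Longrightarrow> Wc x \<in> Hn"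
  using pn_eta[OF p0_D0, of x "U x"] by (simp add: S1_def Wc_def Hn_def pn_simps)

lemma S1D: "x \<in> S1 \<Longrightarrow> x \<in> S0" "x \<in> S1 \<Longrightarrow> norm (U x) < \<delta> / 2"
  by (auto simp: S1_def)

lemma S2D: "x \<in> S2 \<Longrightarrow> x \<in> S1" "x \<in> S2 \<Longrightarrow> norm (Wc x) < \<rho> / 2"
  by (auto simp: S2_def)

lemma continuous_on_p0: "continuous_on S p0"
  by (rule linear_continuous_on[OF bounded_linear_p0])

lemma continuous_on_U: "continuous_on S0 U"
  unfolding U_def
  by (intro linear_continuous_on_compose bounded_linear.linear[OF bounded_linear_pp]
      bounded_linear.continuous_on[OF bounded_linear_pp] continuous_intros continuous_on_phi' continuous_on_p0)
    (simp add: S0_def)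

lemma continuous_on_Wc: "continuous_on S1 Wc"
proof -
  have sub: "S1 \<subseteq> S0" by (auto simp: S1_def)
  show ?thesis unfolding Wc_def
    using S1D p0_D0
    by (intro continuous_on_diff bounded_linear.continuous_on[OF bounded_linear_pn] continuous_intros
        continuous_on_phi' continuous_on_p0 continuous_on_base_eta continuous_on_subset[OF continuous_on_U sub])
      (auto simp: S0_def)
qed

lemma continuous_on_Ap: "continuous_on S1 Ap"
proof -
  have sub: "S1 \<subseteq> S0" by (auto simp: S1_def)
  have "continuous_on S1 (\<lambda>x. (\<lambda>p. r1.rad (fst p) (snd p)) (p0 x, U x))"
  proof (rule continuous_on_compose2[OF r1.continuous_on_rad])
    show "continuous_on S1 (\<lambda>x. (p0 x, U x))"
      by (intro continuous_on_Pair continuous_on_p0 continuous_on_subset[OF continuous_on_U sub])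
    show "(\<lambda>x. (p0 x, U x)) ` S1 \<subseteq> D0 \<times> (Hp \<inter> ball 0 (\<delta> / 2))"
      using S1D p0_D0 U_Hp by (intro image_subsetI) simp
  qed
  then show ?thesis by (simp add: Ap_def[abs_def])
qed

lemma continuous_on_An: "continuous_on S2 An"
proof -
  have sub: "S2 \<subseteq> S0" "S2 \<subseteq> S1" by (auto simp: S1_def S2_def)
  have "continuous_on S2 (\<lambda>x. (\<lambda>p. r2.rad (fst p) (snd p)) ((p0 x, U x), Wc x))"
  proof (rule continuous_on_compose2[OF r2.continuous_on_rad])
    show "continuous_on S2 (\<lambda>x. ((p0 x, U x), Wc x))"
      by (intro continuous_on_Pair continuous_on_p0 continuous_on_subset[OF continuous_on_U sub(1)]
        continuous_on_subset[OF continuous_on_Wc sub(2)])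
    show "(\<lambda>x. ((p0 x, U x), Wc x)) ` S2 \<subseteq> (D0 \<times> (Hp \<inter> ball 0 (\<delta> / 2))) \<times> (Hn \<inter> ball 0 (\<rho> / 2))"
      using S1D S2D p0_D0 U_Hp Wc_Hn by (intro image_subsetI) simp
  qed
  then show ?thesis by (simp add: An_def[abs_def])
qed

lemma open_W: "open W"
proof -
  have "open S0" unfolding S0_def by (intro open_Collect_norm_less open_UNIV continuous_on_p0)
  then have "open S1" unfolding S1_def by (intro open_Collect_norm_less continuous_on_U)
  then have "open S2" unfolding S2_def by (intro open_Collect_norm_less continuous_on_Wc)
  moreover have "continuous_on S2 Ap"
    by (rule continuous_on_subset[OF continuous_on_Ap]) (auto simp: S2_def)
  ultimately have "open {x \<in> S2. norm (Ap x) < r1.R'}" by (intro open_Collect_norm_less)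
  then show ?thesis unfolding W_def
    by (rule open_Collect_norm_less) (rule continuous_on_subset[OF continuous_on_An], auto)
qed

lemma mem_box_iff:
  "v \<in> sub_ball Hp r + sub_ball Hn s \<longleftrightarrow> pp v + pn v = v \<and> norm (pp v) < r \<and> norm (pn v) < s"
proof
  assume "v \<in> sub_ball Hp r + sub_ball Hn s"
  then obtain x y where v: "v = x + y" and x: "pp x = x" "norm x < r" and y: "pn y = y" "norm y < s"
    by (auto simp: set_plus_def sub_ball_def Hp_def Hn_def)
  have "pp y = 0" "pn x = 0" using x y pp_pn[of y] pn_pp[of x] by auto
  then show "pp v + pn v = v \<and> norm (pp v) < r \<and> norm (pn v) < s"
    using x y by (simp add: v pp_simps pn_simps)
next
  assume v: "pp v + pn v = v \<and> norm (pp v) < r \<and> norm (pn v) < s"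
  then have "pp v \<in> sub_ball Hp r" "pn v \<in> sub_ball Hn s"
    by (auto simp: sub_ball_def Hp_def Hn_def pp_simps pn_simps)
  then have "pp v + pn v \<in> sub_ball Hp r + sub_ball Hn s" by (rule set_plus_intro)
  then show "v \<in> sub_ball Hp r + sub_ball Hn s" using v by simp
qed

lemma coords:
  assumes z: "z \<in> D0" and u: "u \<in> Hp" "norm u < \<delta> / 2" and w: "w \<in> Hn" "norm w < \<rho> / 2"
  shows "p0 (m z u + w) = z" "U (m z u + w) = u" "Wc (m z u + w) = w" "m z u + w \<in> S2"
proof -
  define e where "e = \<eta> (base z u)"
  have e: "pn e = e" "pp e = 0" using pn_eta[OF z u(2)] pp_eta[OF z u(2)] by (auto simp: e_def)
  have pu: "pp u = u" "pn u = 0" using u pn_pp[of u] by (auto simp: Hp_def)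
  have pw: "pn w = w" "pp w = 0" using w pp_pn[of w] by (auto simp: Hn_def)
  have x: "m z u + w = z + \<phi> z + u + e + w" by (simp add: m_def base_def e_def)
  have "p0 (m z u + w) = z + (\<phi> z - (pp (\<phi> z) + pn (\<phi> z)))"
    unfolding x p0_def by (simp add: pp_simps pn_simps e pu pw D0D[OF z])
  then show p: "p0 (m z u + w) = z" using \<phi>(1)[OF D0D(3)[OF z]] by simp
  show U: "U (m z u + w) = u"
    unfolding U_def p unfolding x by (simp add: pp_simps e pu pw D0D[OF z])
  show Wc: "Wc (m z u + w) = w"
    unfolding Wc_def p U unfolding x by (simp add: pn_simps e pu pw D0D[OF z] e_def[symmetric])
  show "m z u + w \<in> S2"
    using u w D0D[OF z] by (simp add: S2_def S1_def S0_def p U Wc)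
qed

lemma coords_inv:
  assumes "x \<in> S1"
  shows "m (p0 x) (U x) + Wc x = x"
proof -
  have 1: "pp (\<phi> (p0 x)) + pn (\<phi> (p0 x)) = \<phi> (p0 x)"
    using \<phi>(1) D0D(3)[OF p0_D0[OF S1D(1)[OF assms]]] by blast
  have "m (p0 x) (U x) + Wc x = p0 x + \<phi> (p0 x) + pp x - pp (\<phi> (p0 x)) + (pn x - pn (\<phi> (p0 x)))"
    by (simp add: m_def Wc_def base_def U_def pp_simps pn_simps)
  also have "\<dots> = p0 x + pp x + pn x + (\<phi> (p0 x) - (pp (\<phi> (p0 x)) + pn (\<phi> (p0 x))))" by simp
  also have "\<dots> = x" unfolding 1 by (simp add: p0_def)
  finally show ?thesis .
qed

lemma Phi_eq:
  assumes z: "z \<in> D0" and v: "norm (pp v) < r1.R'" "norm (pn v) < r2.R'"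
  defines "u \<equiv> r1.irad z (pp v)" and "w \<equiv> r2.irad (z, r1.irad z (pp v)) (pn v)"
  shows "\<Phi> (z, v) = m z u + w" "u \<in> Hp" "norm u < \<delta> / 2" "r1.rad z u = pp v"
    "w \<in> Hn" "norm w < \<rho> / 2" "r2.rad (z, u) w = pn v"
proof -
  have pv: "pp v \<in> Hp" "pn v \<in> Hn" by (auto simp: Hp_def Hn_def pp_simps pn_simps)
  show u: "u \<in> Hp" "norm u < \<delta> / 2" "r1.rad z u = pp v"
    unfolding u_def using r1.irad[OF z pv(1) v(1)] by auto
  have zu: "(z, u) \<in> D0 \<times> (Hp \<inter> ball 0 (\<delta> / 2))" using z u by simp
  show "w \<in> Hn" "norm w < \<rho> / 2" "r2.rad (z, u) w = pn v"
    unfolding w_def u_def[symmetric] using r2.irad[OF zu pv(2) v(2)] by auto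
  show "\<Phi> (z, v) = m z u + w"
    by (simp add: \<Phi>_def \<phi>z_def Let_def m_def base_def u_def w_def)
qed

lemma Psi_Phi:
  assumes z: "z \<in> D0" and v: "pp v + pn v = v" "norm (pp v) < r1.R'" "norm (pn v) < r2.R'"
  shows "\<Psi> (\<Phi> (z, v)) = (z, v)" "\<Phi> (z, v) \<in> W"
proof -
  note P = Phi_eq[OF z v(2,3)]
  note c = coords[OF z P(2,3,5,6)]
  have A: "Ap (\<Phi> (z, v)) = pp v" "An (\<Phi> (z, v)) = pn v"
    unfolding Ap_def An_def P(1) c by (rule P(4), rule P(7))
  show "\<Psi> (\<Phi> (z, v)) = (z, v)" unfolding \<Psi>_def A using v(1) c(1) P(1) by simp
  show "\<Phi> (z, v) \<in> W" unfolding W_def using A v c(4) P(1) by simp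
qed

lemma Phi_Psi:
  assumes x: "x \<in> W"
  shows "\<Phi> (\<Psi> x) = x" "fst (\<Psi> x) \<in> D0" "snd (\<Psi> x) \<in> sub_ball Hp r1.R' + sub_ball Hn r2.R'"
proof -
  have x2: "x \<in> S2" and A: "norm (Ap x) < r1.R'" "norm (An x) < r2.R'" using x by (auto simp: W_def)
  note x1 = S2D(1)[OF x2] note x0 = S1D(1)[OF x1]
  have z: "p0 x \<in> D0" by (rule p0_D0[OF x0])
  have zu: "(p0 x, U x) \<in> D0 \<times> (Hp \<inter> ball 0 (\<delta> / 2))" using z U_Hp S1D(2)[OF x1] by simp
  have ppA: "pp (Ap x) = Ap x" using r1.rad_Y[OF U_Hp] by (simp add: Ap_def Hp_def)
  have pnA: "pn (An x) = An x" using r2.rad_Y[OF Wc_Hn[OF x1]] by (simp add: An_def Hn_def)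
  have pA: "pp (An x) = 0" "pn (Ap x) = 0" using ppA pnA pp_pn[of "An x"] pn_pp[of "Ap x"] by auto
  have v: "pp (snd (\<Psi> x)) = Ap x" "pn (snd (\<Psi> x)) = An x" by (simp_all add: \<Psi>_def pp_simps pn_simps ppA pnA pA)
  show "fst (\<Psi> x) \<in> D0" using z by (simp add: \<Psi>_def)
  show "snd (\<Psi> x) \<in> sub_ball Hp r1.R' + sub_ball Hn r2.R'"
    unfolding mem_box_iff v using A by (simp add: \<Psi>_def)
  have u: "r1.irad (p0 x) (Ap x) = U x"
    unfolding Ap_def using A S1D(2)[OF x1] by (intro r1.irad_rad z U_Hp) (auto simp: Ap_def)
  have w: "r2.irad (p0 x, U x) (An x) = Wc x"
    unfolding An_def using A S2D(2)[OF x2] by (intro r2.irad_rad zu Wc_Hn x1) (auto simp: An_def)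
  have "\<Phi> (\<Psi> x) = m (p0 x) (U x) + Wc x"
    using Phi_eq(1)[OF z, of "snd (\<Psi> x)"] A unfolding v u w by (simp add: \<Psi>_def)
  then show "\<Phi> (\<Psi> x) = x" using coords_inv[OF x1] by simp
qed

section \<open>The homeomorphism and its normal form\<close>

abbreviation "Dom \<equiv> D0 \<times> (sub_ball Hp r1.R' + sub_ball Hn r2.R')"

lemma continuous_on_Phi: "continuous_on Dom \<Phi>"
proof -
  have c0: "continuous_on Dom (\<lambda>p. pp (snd p))" "continuous_on Dom (\<lambda>p. pn (snd p))"
    by (intro bounded_linear.continuous_on[OF bounded_linear_pp] bounded_linear.continuous_on[OF bounded_linear_pn]
        continuous_intros)+
  define u where "u p = r1.irad (fst p) (pp (snd p))" for p
  define w where "w p = r2.irad (fst p, u p) (pn (snd p))" for p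
  have P: "\<Phi> p = m (fst p) (u p) + w p" "u p \<in> Hp" "norm (u p) < \<delta> / 2" if "p \<in> Dom" for p
    using Phi_eq[of "fst p" "snd p"] that by (auto simp: mem_Times_iff mem_box_iff u_def w_def)
  have cu: "continuous_on Dom u"
  proof -
    have "continuous_on Dom (\<lambda>x. (\<lambda>p. r1.irad (fst p) (snd p)) (fst x, pp (snd x)))"
    proof (rule continuous_on_compose2[OF r1.continuous_on_irad])
      show "continuous_on Dom (\<lambda>x. (fst x, pp (snd x)))" by (intro continuous_intros c0)
      show "(\<lambda>x. (fst x, pp (snd x))) ` Dom \<subseteq> D0 \<times> (Hp \<inter> ball 0 r1.R')"
      proof (rule image_subsetI)
        fix x assume "x \<in> Dom"
        moreover have "pp (snd x) \<in> Hp" by (simp add: Hp_def pp_simps)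
        ultimately show "(fst x, pp (snd x)) \<in> D0 \<times> (Hp \<inter> ball 0 r1.R')"
          by (simp add: mem_Times_iff mem_box_iff)
      qed
    qed
    then show ?thesis by (simp add: u_def[abs_def])
  qed
  have cw: "continuous_on Dom w"
  proof -
    have "continuous_on Dom (\<lambda>x. (\<lambda>p. r2.irad (fst p) (snd p)) ((fst x, u x), pn (snd x)))"
    proof (rule continuous_on_compose2[OF r2.continuous_on_irad])
      show "continuous_on Dom (\<lambda>x. ((fst x, u x), pn (snd x)))" by (intro continuous_intros cu c0)
      show "(\<lambda>x. ((fst x, u x), pn (snd x))) ` Dom \<subseteq> (D0 \<times> (Hp \<inter> ball 0 (\<delta> / 2))) \<times> (Hn \<inter> ball 0 r2.R')"
      proof (rule image_subsetI)
        fix x assume x: "x \<in> Dom"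
        moreover have "pn (snd x) \<in> Hn" by (simp add: Hn_def pn_simps)
        ultimately show "((fst x, u x), pn (snd x)) \<in> (D0 \<times> (Hp \<inter> ball 0 (\<delta> / 2))) \<times> (Hn \<inter> ball 0 r2.R')"
          using P(2,3)[OF x] by (simp add: mem_Times_iff mem_box_iff)
      qed
    qed
    then show ?thesis by (simp add: w_def[abs_def])
  qed
  have "continuous_on Dom (\<lambda>p. m (fst p) (u p) + w p)"
    using P(3) by (intro continuous_intros continuous_on_base_eta cu cw) (auto simp: mem_Times_iff)
  then show ?thesis using P(1) by (simp cong: continuous_on_cong)
qed

lemma homeomorphism_Phi: "homeomorphism Dom W \<Phi> \<Psi>"
proof (rule homeomorphismI[OF continuous_on_Phi])
  have sub: "W \<subseteq> S1" "W \<subseteq> S2" by (auto simp: W_def S2_def)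
  show "continuous_on W \<Psi>" unfolding \<Psi>_def
    by (intro continuous_intros continuous_on_p0 continuous_on_subset[OF continuous_on_Ap sub(1)]
        continuous_on_subset[OF continuous_on_An sub(2)])
  show "\<Phi> ` Dom \<subseteq> W" using Psi_Phi(2) by (auto simp: mem_box_iff)
  show "\<Psi> ` W \<subseteq> Dom" using Phi_Psi(2,3) by (intro image_subsetI) (simp only: mem_Times_iff)
  show "\<Psi> (\<Phi> p) = p" if "p \<in> Dom" for p
    using Psi_Phi(1)[of "fst p" "snd p"] that by (auto simp: mem_box_iff)
  show "\<Phi> (\<Psi> x) = x" if "x \<in> W" for x by (rule Phi_Psi(1)[OF that])
qed

lemma W_subset_ball: "W \<subseteq> ball 0 \<rho>"
proof
  fix x assume "x \<in> W"
  then have x2: "x \<in> S2" by (simp add: W_def)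
  have "m (p0 x) (U x) + Wc x \<in> ball 0 \<rho>"
    by (rule m_add_ball[OF p0_D0[OF S1D(1)] S1D(2) S2D(2)]) (use x2 in \<open>auto simp: S2_def\<close>)
  then show "x \<in> ball 0 \<rho>" using coords_inv[OF S2D(1)[OF x2]] by simp
qed

lemma R_pos: "0 < r1.R'" "0 < r2.R'" using size pos by auto

lemma Phi_0: assumes z: "z \<in> D0" shows "\<Phi> (z, 0) = z + \<phi> z"
proof -
  have R: "norm (pp 0) < r1.R'" "norm (pn 0) < r2.R'" using R_pos by (auto simp: pp_simps pn_simps)
  note P = Phi_eq[OF z R]
  have u: "r1.irad z (pp 0) = 0" using P(4) r1.rad_eq_0_iff[OF z P(2,3)] by (simp add: pp_simps)
  have zu: "(z, r1.irad z (pp 0)) \<in> D0 \<times> (Hp \<inter> ball 0 (\<delta> / 2))" using z P(2,3) by simp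
  have w: "r2.irad (z, r1.irad z (pp 0)) (pn 0) = 0"
    using P(7) r2.rad_eq_0_iff[OF zu P(5,6)] by (simp add: pn_simps)
  show ?thesis unfolding P(1) w unfolding u using m_0[OF D0D(3)[OF z]] by simp
qed

lemma zero_D0: "0 \<in> D0" using size by (simp add: D0_def sub_ball_def H0_def pp_simps pn_simps)

lemma phi_0: "\<phi> 0 = 0" using \<phi>(4)[of 0] size by simp

text \<open>Squared norms of \<open>rad\<close> are values of \<open>f1\<close> and
  \<open>f2\<close>, and their difference is the change of L. The H^+ component of
  \<open>\<phi>z\<close> is u, which vanishes exactly when its rescaling \<open>up\<close>
  does.\<close>

lemma Phi_properties:
  assumes z: "z \<in> D0" and up: "up \<in> sub_ball Hp r1.R'" and un: "un \<in> sub_ball Hn r2.R'"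
  shows "\<Phi> (z, up + un) = z + \<phi> z + \<phi>z z (up + un)"
    "\<phi>z z (up + un) \<in> Hp + Hn"
    "L (\<Phi> (z, up + un)) = (norm up)\<^sup>2 - (norm un)\<^sup>2 + L (z + \<phi> z)"
    "\<phi>z z (up + un) \<in> Hn \<longleftrightarrow> up = 0"
proof -
  have pu: "pp up = up" "norm up < r1.R'" "pn un = un" "norm un < r2.R'"
    using up un by (auto simp: sub_ball_def Hp_def Hn_def)
  have "pp un = 0" "pn up = 0" using pu pp_pn[of un] pn_pp[of up] by auto
  then have v: "pp (up + un) = up" "pn (up + un) = un" by (simp_all add: pp_simps pn_simps pu)
  define u where "u = r1.irad z up"
  define w where "w = r2.irad (z, u) un"
  have P: "\<Phi> (z, up + un) = m z u + w" "u \<in> Hp" "norm u < \<delta> / 2" "r1.rad z u = up"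
    "w \<in> Hn" "norm w < \<rho> / 2" "r2.rad (z, u) w = un"
    using Phi_eq[OF z, of "up + un"] pu unfolding v u_def w_def by auto
  show "\<Phi> (z, up + un) = z + \<phi> z + \<phi>z z (up + un)" by (simp add: \<Phi>_def)
  have e: "\<phi>z z (up + un) = u + (\<eta> (base z u) + w)" by (simp add: \<phi>z_def v Let_def u_def w_def)
  have en: "pn (\<eta> (base z u)) = \<eta> (base z u)" by (rule pn_eta[OF z P(3)])
  have Hn: "\<eta> (base z u) + w \<in> Hn" using en P(5) by (simp add: Hn_def pn_simps)
  then show "\<phi>z z (up + un) \<in> Hp + Hn" unfolding e using P(2) by (rule set_plus_intro[rotated])
  have zu: "(z, u) \<in> D0 \<times> (Hp \<inter> ball 0 (\<delta> / 2))" using z P by simp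
  have "(norm up)\<^sup>2 = f1 z u" using r1.norm_rad2[OF z P(2,3)] P(4) by simp
  moreover have "(norm un)\<^sup>2 = f2 (z, u) w" using r2.norm_rad2[OF zu P(5,6)] P(7) by simp
  ultimately show "L (\<Phi> (z, up + un)) = (norm up)\<^sup>2 - (norm un)\<^sup>2 + L (z + \<phi> z)"
    unfolding P(1) by (simp add: f1_def f2_def)
  have "\<phi>z z (up + un) \<in> Hn \<longleftrightarrow> u = 0"
  proof
    assume "\<phi>z z (up + un) \<in> Hn"
    then have "pp (\<phi>z z (up + un)) = 0" using pp_pn[of "\<phi>z z (up + un)"] by (simp add: Hn_def)
    moreover have "pp (\<eta> (base z u) + w) = 0" using Hn pp_pn[of "\<eta> (base z u) + w"] by (simp add: Hn_def)
    ultimately show "u = 0" using P(2) by (simp add: e pp_simps Hp_def)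
  qed (use Hn in \<open>simp add: e\<close>)
  also have "\<dots> \<longleftrightarrow> up = 0" using r1.rad_eq_0_iff[OF z P(2,3)] P(4) by simp
  finally show "\<phi>z z (up + un) \<in> Hn \<longleftrightarrow> up = 0" .
qed

section \<open>Derivative of the reduced functional\<close>

lemma reduced_derivative:
  assumes z: "z \<in> D0"
  shows "((\<lambda>z. L (z + \<phi> z)) has_derivative (\<lambda>h. inner h (g (z + \<phi> z)))) (at z within D0)"
proof (rule has_derivative_along_tangent[where L = L and \<gamma> = "\<lambda>z. z + \<phi> z" and C = "1 + K / a"
      and D = "\<lambda>h. inner h (g (z + \<phi> z))"])
  show "(L has_derivative (\<lambda>h. inner h (g (z + \<phi> z)))) (at (z + \<phi> z))"
    by (rule deriv[OF zphi_ball(1)[OF D0D(3)[OF z]]])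
  show "bounded_linear (\<lambda>h. inner h (g (z + \<phi> z)))" by (rule bounded_linear_inner_left)
  fix z' assume z': "z' \<in> D0"
  have k: "norm (\<phi> z' - \<phi> z) \<le> K / a * norm (z' - z)" using \<phi>(5) D0D(3) z z' by blast
  have "norm (z' + \<phi> z' - (z + \<phi> z)) \<le> norm (z' - z) + norm (\<phi> z' - \<phi> z)"
    by (rule order_trans[OF _ norm_triangle_ineq]) (simp add: algebra_simps)
  then show "norm (z' + \<phi> z' - (z + \<phi> z)) \<le> (1 + K / a) * norm (z' - z)"
    using k by (simp add: algebra_simps)
  have "inner (\<phi> x) (g (z + \<phi> z)) = 0" if "x \<in> D0" for x
  proof -
    have "inner (\<phi> x) (g (z + \<phi> z)) = inner (pp (\<phi> x) + pn (\<phi> x)) (g (z + \<phi> z))"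
      using \<phi>(1)[OF D0D(3)[OF that]] by simp
    also have "\<dots> = 0" using \<phi>(2,3)[OF D0D(3)[OF z]] by (simp add: inner_add_left pp_adj pn_adj)
    finally show ?thesis .
  qed
  then show "inner (z' + \<phi> z' - (z + \<phi> z)) (g (z + \<phi> z)) = inner (z' - z) (g (z + \<phi> z))"
    using z z' by (simp add: inner_simps)
qed

end

section \<open>Existence of the two implicit maps\<close>

lemma (in splitting_functional) reduced_splitting_exists:
  obtains \<phi> \<eta> \<epsilon> \<delta> where "reduced_splitting pp pn L g \<rho> a K \<phi> \<eta> \<epsilon> \<delta>"
proof -
  obtain \<delta>1 \<phi> where 1: "0 < \<delta>1" "(1 + K / a) * \<delta>1 \<le> \<rho> / 2"
    "\<And>y. y \<in> ball 0 \<delta>1 \<Longrightarrow> (pp (\<phi> y) + pn (\<phi> y) = \<phi> y) \<and>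
      pp (g (y + \<phi> y)) + pn (g (y + \<phi> y)) = 0 \<and> norm (\<phi> y) \<le> K / a * norm y"
    "\<And>x y. x \<in> ball 0 \<delta>1 \<Longrightarrow> y \<in> ball 0 \<delta>1 \<Longrightarrow> norm (\<phi> x - \<phi> y) \<le> K / a * norm (x - y)"
  \<comment> \<open>\<open>q\<close> projects onto H^+ + H^-, and \<open>J\<close> reverses the sign
    on H^-, where the form is negative.\<close>
  proof (rule monotone_projected_equation[where q = "\<lambda>x. pp x + pn x" and J = "\<lambda>x. pp x - pn x"
        and g = g and a = a and K = K and \<rho> = \<rho>])
    show "linear (\<lambda>x. pp x + pn x)" by (intro linear_compose_add lin_pp lin_pn)
    show "linear (\<lambda>x. pp x - pn x)" by (intro linear_compose_sub lin_pp lin_pn)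
    show "norm (pp (pp x + pn x) - pn (pp x + pn x)) = norm (pp x + pn x)" for x
      by (simp add: pp_simps pn_simps norm_diff_pp_pn)
    show "0 < a" "a \<le> K" "0 < \<rho>" "g 0 = 0" by (rule pos g0)+
    show "norm (g x - g y) \<le> K * norm (x - y)" if "x \<in> ball 0 \<rho>" "y \<in> ball 0 \<rho>" for x y
      by (rule lip[OF that])
    show "a * (norm (x - y))\<^sup>2 \<le> inner (g x - g y) (pp (x - y) - pn (x - y))"
      if "x \<in> ball 0 \<rho>" "y \<in> ball 0 \<rho>" "pp (x - y) + pn (x - y) = x - y" for x y
      by (rule mono[OF that])
    show "pp (pp x + pn x) + pn (pp x + pn x) = pp x + pn x" for x by (simp add: pp_simps pn_simps)
    show "pp (pp (pp x + pn x) - pn (pp x + pn x)) + pn (pp (pp x + pn x) - pn (pp x + pn x))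
      = pp (pp x + pn x) - pn (pp x + pn x)" for x by (simp add: pp_simps pn_simps)
    show "inner (pp x + pn x) y = inner x (pp y + pn y)" for x y by (simp add: inner_simps pp_adj pn_adj)
    show "inner (pp x - pn x) y = inner x (pp y - pn y)" for x y by (simp add: inner_simps pp_adj pn_adj)
  qed (rule that)
  obtain \<delta> \<eta> where 2: "0 < \<delta>" "(1 + K / a) * \<delta> \<le> \<rho> / 2"
    "\<And>y. y \<in> ball 0 \<delta> \<Longrightarrow> pn (\<eta> y) = \<eta> y \<and> pn (g (y + \<eta> y)) = 0 \<and> norm (\<eta> y) \<le> K / a * norm y"
    "\<And>x y. x \<in> ball 0 \<delta> \<Longrightarrow> y \<in> ball 0 \<delta> \<Longrightarrow> norm (\<eta> x - \<eta> y) \<le> K / a * norm (x - y)"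
  \<comment> \<open>On H^- alone the reflection is just the change of sign.\<close>
  proof (rule monotone_projected_equation[where q = pn and J = uminus
        and g = g and a = a and K = K and \<rho> = \<rho>])
    show "linear (uminus :: 'h \<Rightarrow> 'h)" by (rule linear_uminus)
    show "a * (norm (x - y))\<^sup>2 \<le> inner (g x - g y) (- (x - y))"
      if "x \<in> ball 0 \<rho>" "y \<in> ball 0 \<rho>" "pn (x - y) = x - y" for x y
    proof -
      have "pp (x - y) = 0" using pp_pn[of "x - y"] that(3) by simp
      then show ?thesis using mono[OF that(1,2)] that(3) by simp
    qed
    show "0 < a" "a \<le> K" "0 < \<rho>" "g 0 = 0" "linear pn" by (rule pos g0 lin_pn)+
    show "norm (g x - g y) \<le> K * norm (x - y)" if "x \<in> ball 0 \<rho>" "y \<in> ball 0 \<rho>" for x y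
      by (rule lip[OF that])
    show "pn (pn x) = pn x" "norm (- pn x) = norm (pn x)" "pn (- pn x) = - pn x" for x
      by (simp_all add: pn_simps)
    show "inner (pn x) y = inner x (pn y)" "inner (- x) y = inner x (- y)" for x y by (simp_all add: pn_adj)
  qed (rule that)
  \<comment> \<open>Inside the domain of \<open>\<phi>\<close>, and small enough to keep
    \<open>z + \<phi> z\<close> within \<delta>/2.\<close>
  define \<epsilon> where "\<epsilon> = min \<delta>1 (\<delta> / 2 / (1 + K / a))"
  have Ka: "0 < 1 + K / a" using pos by (simp add: add_pos_pos)
  have "0 < \<epsilon>" using 1 2 Ka by (simp add: \<epsilon>_def)
  have "(1 + K / a) * \<epsilon> \<le> (1 + K / a) * (\<delta> / 2 / (1 + K / a))"
    using Ka by (intro mult_left_mono) (auto simp: \<epsilon>_def)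
  also have "\<dots> = \<delta> / 2" using Ka by (metis nonzero_mult_div_cancel_left times_divide_eq_right less_numeral_extra(3))
  finally have \<epsilon>2: "(1 + K / a) * \<epsilon> \<le> \<delta> / 2" .
  have sub: "y \<in> ball 0 \<delta>1" if "y \<in> ball 0 \<epsilon>" for y :: 'h using that by (simp add: \<epsilon>_def)
  \<comment> \<open>By orthogonality the single equation for \<open>q\<close> splits into one
    equation in H^+ and one in H^-.\<close>
  have pg: "pp v = 0 \<and> pn v = 0" if "pp v + pn v = 0" for v
    using arg_cong[OF that, of pp] arg_cong[OF that, of pn] by (simp add: pp_simps pn_simps)
  have "reduced_splitting pp pn L g \<rho> a K \<phi> \<eta> \<epsilon> \<delta>"
    by unfold_locales (use \<open>0 < \<epsilon>\<close> \<epsilon>2 2 1(3,4) sub pg in blast)+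
  then show thesis by (rule that)
qed

section \<open>Local estimates from hypothesis (A)\<close>

text \<open>Turns sequential hypotheses such as (D2) and (D4) into an estimate on a ball. The index
  n governs both the radius and the constant in \<open>R n\<close>: if every n failed, the
  counterexamples \<open>x n\<close> would tend to 0 and contradict \<open>seq\<close>.\<close>

lemma ball_of_sequences:
  fixes V :: "'a::real_normed_vector set"
  assumes "open V" "0 \<in> V"
    and seq: "\<And>x :: nat \<Rightarrow> 'a. range x \<subseteq> V \<Longrightarrow> x \<longlonglongrightarrow> 0 \<Longrightarrow> \<exists>n. R n (x n)"
  obtains n r where "0 < r" "ball 0 r \<subseteq> V" "\<And>y. y \<in> ball 0 r \<Longrightarrow> R n y"
proof -
  obtain r0 where r0: "0 < r0" "ball 0 r0 \<subseteq> V" using assms(1,2) open_contains_ball by blast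
  define r where "r n = min r0 (1 / real (Suc n))" for n
  have r: "0 < r n" "ball 0 (r n) \<subseteq> V" for n
    using r0 by (auto simp: r_def)
  have "\<exists>n. \<forall>y\<in>ball 0 (r n). R n y"
  proof (rule ccontr)
    assume "\<not> ?thesis"
    then have "\<forall>n. \<exists>y. y \<in> ball 0 (r n) \<and> \<not> R n y" by blast
    then obtain x where x: "\<And>n. x n \<in> ball 0 (r n)" "\<And>n. \<not> R n (x n)" by metis
    have "norm (x n) \<le> 1 / real (Suc n)" for n using x(1)[of n] by (simp add: r_def)
    then have "x \<longlonglongrightarrow> 0"
      by (intro Lim_null_comparison[OF _ LIMSEQ_Suc[OF lim_1_over_n]] always_eventually) simp
    moreover have "range x \<subseteq> V" using x(1) r(2) by blast
    ultimately show False using seq x(2) by blast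
  qed
  then obtain n where "\<forall>y\<in>ball 0 (r n). R n y" by blast
  then show thesis using that[of "r n" n] r by blast
qed

text \<open>The point \<open>h\<close> replaces a weak limit of the sequence \<open>u\<close>: it lies in every closed half-space
  that contains a tail of \<open>u\<close>.\<close>

lemma coercive_limit_contradiction:
  fixes Pk Qk :: "nat \<Rightarrow> 'h::{real_inner,complete_space} \<Rightarrow>\<^sub>L 'h" and P Q :: "'h \<Rightarrow>\<^sub>L 'h"
  assumes sa: "\<And>k x y. inner (Pk k x) y = inner x (Pk k y)"
    and C: "0 < C" "\<And>k u. C * (norm u)\<^sup>2 \<le> inner (Pk k u) u"
    and Plim: "\<And>u. (\<lambda>k. Pk k u) \<longlonglongrightarrow> P u" and Qlim: "Qk \<longlonglongrightarrow> Q"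
    and M: "subspace M" "closed M"
    and gap: "0 < l" "\<And>u. u \<in> M \<Longrightarrow> l * (norm u)\<^sup>2 \<le> inner (P u + Q u) u"
    and u: "\<And>k. u k \<in> M" "\<And>k. norm (u k) = 1" and y: "(\<lambda>k. Q (u k)) \<longlonglongrightarrow> y"
    and e: "e \<longlonglongrightarrow> 0" "\<And>k. inner (Pk k (u k) + Qk k (u k)) (u k) \<le> e k"
  shows False
proof -
  define S where "S n = closure (convex hull (u ` {n..}))" for n
  obtain h where h: "\<And>n. h \<in> S n"
  proof (rule nested_closed_convex_Inter)
    show "closed (S n)" "convex (S n)" "S n \<noteq> {}" for n
      unfolding S_def by (auto intro: convex_closure)
    show "S n \<subseteq> S m" if "m \<le> n" for m n
      unfolding S_def using that by (intro closure_mono hull_mono image_mono) auto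
    have "bounded (u ` {0..})" using u(2) by (auto simp: bounded_iff)
    then show "bounded (S 0)" unfolding S_def by (intro bounded_closure bounded_convex_hull)
  qed (rule that)
  have hT: "h \<in> T" if "convex T" "closed T" "\<And>k. k \<ge> n \<Longrightarrow> u k \<in> T" for T n
  proof -
    have "S n \<subseteq> T" unfolding S_def using that by (intro closure_minimal hull_minimal) auto
    then show ?thesis using h by blast
  qed
  have hM: "h \<in> M" by (rule hT[OF subspace_imp_convex[OF M(1)] M(2) u(1)])
  have h1: "norm h \<le> 1" using hT[of "cball 0 1" 0] u(2) by simp
  \<comment> \<open>Preimages of closed balls under \<open>Q\<close> are closed and convex, so h
    inherits the limit y of \<open>Q (u k)\<close>.\<close>
  have Qd: "norm (Q h - y) \<le> d" if d: "0 < d" for d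
  proof -
    have "(\<lambda>k. norm (Q (u k) - y)) \<longlonglongrightarrow> 0" by (intro tendsto_norm_zero LIM_zero y)
    from order_tendstoD(2)[OF this d]
    obtain n where n: "\<And>k. k \<ge> n \<Longrightarrow> norm (Q (u k) - y) < d"
      by (auto simp: eventually_sequentially)
    have "h \<in> blinfun_apply Q -` cball y d"
    proof (rule hT)
      show "convex (blinfun_apply Q -` cball y d)"
        using bounded_linear.linear[OF blinfun.bounded_linear_right[of Q]] convex_cball
        by (rule convex_linear_vimage)
      show "closed (blinfun_apply Q -` cball y d)"
        by (rule closed_vimage[OF closed_cball]) (intro continuous_intros)
      show "u k \<in> blinfun_apply Q -` cball y d" if "k \<ge> n" for k
        using n[OF that] by (simp add: dist_norm norm_minus_commute)
    qed
    then show ?thesis by (simp add: dist_norm norm_minus_commute)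
  qed
  have "norm (Q h - y) \<le> 0" by (rule field_le_epsilon) (simp add: Qd)
  then have Qh: "Q h = y" by simp
  \<comment> \<open>Expand coercivity of \<open>Pk k\<close> at \<open>u k - h\<close>, insert the
    upper bound \<open>e k\<close>, and replace \<open>Pk k h\<close> and \<open>Qk k (u k)\<close>
    by their limits. What remains is affine in \<open>u k\<close> up to an error, so it passes to h
    although \<open>u k\<close> need not converge.\<close>
  define v where "v = 2 *\<^sub>R P h + y - (2 * C) *\<^sub>R h"
  define c where "c = inner (P h) h - C * (1 + (norm h)\<^sup>2)"
  \<comment> \<open>The factor 3: two errors from the cross term of the expansion and one from its
    value at h.\<close>
  define err where "err k = e k + 3 * norm (Pk k h - P h) + norm (Q (u k) - y) + norm (Qk k - Q)" for k
  have bound: "inner v (u k) \<le> c + err k" for k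
  proof -
    have "C * (norm (u k - h))\<^sup>2 \<le> inner (Pk k (u k - h)) (u k - h)" by (rule C)
    then have 1: "C * (norm (u k - h))\<^sup>2 \<le> inner (Pk k (u k)) (u k) - 2 * inner (Pk k h) (u k) + inner (Pk k h) h"
      using sa[of k "u k" h] by (simp add: blinfun.diff_right inner_simps inner_commute)
    have 2: "(norm (u k - h))\<^sup>2 = 1 - 2 * inner h (u k) + (norm h)\<^sup>2"
      using u(2)[of k] power2_norm_eq_inner[of "u k"] unfolding power2_norm_eq_inner[of "u k - h"]
      by (simp add: inner_simps inner_commute power2_norm_eq_inner[of h])
    have 3: "\<bar>inner (Pk k h - P h) (u k)\<bar> \<le> norm (Pk k h - P h)"
      using Cauchy_Schwarz_ineq2[of "Pk k h - P h" "u k"] u(2)[of k] by simp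
    have "\<bar>inner (Pk k h - P h) h\<bar> \<le> norm (Pk k h - P h) * norm h" by (rule Cauchy_Schwarz_ineq2)
    also have "\<dots> \<le> norm (Pk k h - P h)" using h1 by (simp add: mult_left_le)
    finally have 4: "\<bar>inner (Pk k h - P h) h\<bar> \<le> norm (Pk k h - P h)" .
    have 5: "\<bar>inner (Q (u k) - y) (u k)\<bar> \<le> norm (Q (u k) - y)"
      using Cauchy_Schwarz_ineq2[of "Q (u k) - y" "u k"] u(2)[of k] by simp
    have 6: "\<bar>inner ((Qk k - Q) (u k)) (u k)\<bar> \<le> norm (Qk k - Q)"
      using Cauchy_Schwarz_ineq2[of "(Qk k - Q) (u k)" "u k"] norm_blinfun[of "Qk k - Q" "u k"] u(2)[of k] by simp
    have 7: "inner ((Qk k - Q) (u k)) (u k) = inner (Qk k (u k)) (u k) - inner (Q (u k)) (u k)"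
      by (simp add: blinfun.diff_left inner_simps)
    have 8: "inner (Pk k (u k)) (u k) + inner (Qk k (u k)) (u k) \<le> e k" using e(2)[of k] by (simp add: inner_simps)
    have 9: "C * (norm (u k - h))\<^sup>2 = C - 2 * C * inner h (u k) + C * (norm h)\<^sup>2"
      unfolding 2 by (simp add: algebra_simps)
    show ?thesis using 1 3 4 5 6 7 8 9 unfolding v_def c_def err_def inner_simps by (simp add: inner_simps algebra_simps)
  qed
  have "err \<longlonglongrightarrow> 0 + 3 * norm (P h - P h) + norm (y - y) + norm (Q - Q)"
    unfolding err_def
    by (intro tendsto_add tendsto_mult tendsto_norm tendsto_diff tendsto_const e(1) Plim y Qlim)
  then have err0: "err \<longlonglongrightarrow> 0" by simp
  have "inner v h \<le> c + d" if d: "0 < d" for d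
  proof -
    obtain n where n: "\<And>k. k \<ge> n \<Longrightarrow> err k < d"
      using order_tendstoD(2)[OF err0 d] by (auto simp: eventually_sequentially)
    have "h \<in> {x. inner v x \<le> c + d}"
    proof (rule hT[OF convex_halfspace_le closed_halfspace_le])
      show "u k \<in> {x. inner v x \<le> c + d}" if "k \<ge> n" for k using bound[of k] n[OF that] by simp
    qed
    then show ?thesis by simp
  qed
  then have "inner v h \<le> c" by (rule field_le_epsilon)
  then have "inner (P h + Q h) h + C * (1 - (norm h)\<^sup>2) \<le> 0"
    by (simp add: v_def c_def Qh inner_simps power2_norm_eq_inner algebra_simps)
  then have le: "l * (norm h)\<^sup>2 + C * (1 - (norm h)\<^sup>2) \<le> 0" using gap(2)[OF hM] by linarith
  have t: "0 \<le> 1 - (norm h)\<^sup>2" using h1 by (simp add: power_le_one)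
  then have "0 \<le> C * (1 - (norm h)\<^sup>2)" using C(1) by simp
  moreover have "0 \<le> l * (norm h)\<^sup>2" using gap(1) by simp
  \<comment> \<open>Both terms vanish: the gap then says h = 0, while coercivity says |h| =
    1.\<close>
  ultimately have "l * (norm h)\<^sup>2 = 0" "C * (1 - (norm h)\<^sup>2) = 0" using le by linarith+
  then show False using C(1) gap(1) by simp
qed

text \<open>The mean value theorem is applied to a scalar function of t on the segment, where the
  Gateaux derivative is an ordinary derivative; the point c therefore depends on the test vector
  w.\<close>

lemma gateaux_mean_value:
  fixes g :: "'h::real_inner \<Rightarrow> 'h"
  assumes g: "\<And>u. u \<in> ball 0 \<rho> \<Longrightarrow> has_gateaux_derivative g (B u) u"
    and x: "x \<in> ball 0 \<rho>" and y: "y \<in> ball 0 \<rho>"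
  obtains c where "c \<in> ball 0 \<rho>" "inner (g x - g y) w = inner (B c (x - y)) w"
proof -
  define \<gamma> where "\<gamma> t = y + t *\<^sub>R (x - y)" for t
  have b: "\<gamma> t \<in> ball 0 \<rho>" if "0 \<le> t" "t \<le> 1" for t
  proof -
    have "(1 - t) *\<^sub>R y + t *\<^sub>R x \<in> ball 0 \<rho>"
      using x y that by (intro convexD[OF convex_ball]) auto
    then show ?thesis by (simp add: \<gamma>_def algebra_simps)
  qed
  have D: "((\<lambda>t. inner (g (\<gamma> t)) w) has_real_derivative inner (B (\<gamma> t) (x - y)) w) (at t)"
    if "0 \<le> t" "t \<le> 1" for t
  proof -
    have "((\<lambda>s. inner ((g (\<gamma> t + s *\<^sub>R (x - y)) - g (\<gamma> t)) /\<^sub>R s) w) \<longlongrightarrow> inner (B (\<gamma> t) (x - y)) w) (at 0)"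
      using g[OF b[OF that]] unfolding has_gateaux_derivative_def by (intro tendsto_intros) blast
    moreover have "inner ((g (\<gamma> t + s *\<^sub>R (x - y)) - g (\<gamma> t)) /\<^sub>R s) w
        = (inner (g (\<gamma> (t + s))) w - inner (g (\<gamma> t)) w) / s" for s
      by (simp add: \<gamma>_def algebra_simps inner_diff_left divide_inverse)
    ultimately show ?thesis unfolding DERIV_def by simp
  qed
  obtain t where t: "0 < t" "t < 1" "inner (g (\<gamma> 1)) w - inner (g (\<gamma> 0)) w = (1 - 0) * inner (B (\<gamma> t) (x - y)) w"
    using MVT2[of 0 1 "\<lambda>t. inner (g (\<gamma> t)) w" "\<lambda>t. inner (B (\<gamma> t) (x - y)) w"] D by auto
  show thesis
    by (rule that[OF b[of t]]) (use t in \<open>auto simp: \<gamma>_def inner_diff_left\<close>)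
qed

text \<open>Coercivity of \<open>P\<close>, the two sign estimates for \<open>B\<close> and its norm
  bound are obtained on separate balls and hold together on the smallest. Well chosen test vectors
  in \<open>gateaux_mean_value\<close> then carry them over to the gradient.\<close>

lemma hypothesis_A_splitting_functional:
  fixes V :: "'h::{real_inner,complete_space} set" and L :: "'h \<Rightarrow> real"
  assumes V: "open V" "0 \<in> V" and C1: "C1_on V L" and crit: "(L has_derivative (\<lambda>_. 0)) (at 0)"
    and A: "hypothesis_A V L B P Q"
  obtains pp pn \<rho> a K where "splitting_functional pp pn L (gradient L) \<rho> a K" "ball 0 \<rho> \<subseteq> V"
    "pos_space (B 0) = {x. pp x = x}" "neg_space (B 0) = {x. pn x = x}"
    "null_space (B 0) = {x. pp x = 0 \<and> pn x = 0}"
proof -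
  have saB: "inner (B u x) y = inner x (B u y)" if "u \<in> V" for u x y
    using A that unfolding hypothesis_A_def selfadjoint_def by blast
  have gat: "has_gateaux_derivative (gradient L) (B u) u" if "u \<in> V" for u
    using A that unfolding hypothesis_A_def by blast
  have BPQ: "B u = P u + Q u" if "u \<in> V" for u
    using A that unfolding hypothesis_A_def by blast
  have saP: "inner (P u x) y = inner x (P u y)" if "u \<in> V" for u x y
    using A that unfolding hypothesis_A_def positive_definite_op_def selfadjoint_def by blast
  have cQ: "compact_op (Q u)" if "u \<in> V" for u
    using A that unfolding hypothesis_A_def by blast
  have Plim: "(\<lambda>k. P (x k) u) \<longlonglongrightarrow> P 0 u" if "range x \<subseteq> V" "x \<longlonglongrightarrow> 0" for x :: "nat \<Rightarrow> 'h" and u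
  proof -
    have "(\<lambda>k. norm (x k)) \<longlonglongrightarrow> 0" using that(2) by (rule tendsto_norm_zero)
    then have "(\<lambda>k. norm (P (x k) u - P 0 u)) \<longlonglongrightarrow> 0"
      using A that(1) unfolding hypothesis_A_def by blast
    then show ?thesis using LIM_zero_cancel tendsto_norm_zero_iff by blast
  qed
  have Qlim: "(\<lambda>k. Q (x k)) \<longlonglongrightarrow> Q 0" if "range x \<subseteq> V" "x \<longlonglongrightarrow> 0" for x :: "nat \<Rightarrow> 'h"
  proof -
    have "continuous (at 0 within V) Q" using A unfolding hypothesis_A_def by blast
    then have "(Q \<circ> x) \<longlonglongrightarrow> Q 0" using that unfolding continuous_within_sequentially by blast
    then show ?thesis by (simp add: o_def)
  qed
  have Blim: "(\<lambda>k. B (x k) u) \<longlonglongrightarrow> B 0 u" if x: "range x \<subseteq> V" "x \<longlonglongrightarrow> 0" for x :: "nat \<Rightarrow> 'h" and u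
  proof -
    have "(\<lambda>k. P (x k) u + Q (x k) u) \<longlonglongrightarrow> P 0 u + Q 0 u"
      by (intro tendsto_add Plim[OF x] blinfun.tendsto Qlim[OF x] tendsto_const)
    moreover have "P (x k) u + Q (x k) u = B (x k) u" for k
      using BPQ[of "x k"] x(1) by (simp add: blinfun.add_left range_subsetD)
    moreover have "P 0 u + Q 0 u = B 0 u" using BPQ[OF V(2)] by (simp add: blinfun.add_left)
    ultimately show ?thesis by simp
  qed
  obtain n1 r1 where r1: "0 < r1" "ball 0 r1 \<subseteq> V"
    and P1: "\<And>y. y \<in> ball 0 r1 \<Longrightarrow> \<forall>u. 1 / real (Suc n1) * (norm u)\<^sup>2 \<le> inner (P y u) u"
  proof (rule ball_of_sequences[OF V])
    fix x :: "nat \<Rightarrow> 'h" assume x: "range x \<subseteq> V" "x \<longlonglongrightarrow> 0"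
    have "(\<lambda>k. norm (x k)) \<longlonglongrightarrow> 0" using x(2) by (rule tendsto_norm_zero)
    then obtain C0 k0 where C0: "0 < C0" "\<And>k u. k \<ge> k0 \<Longrightarrow> C0 * (norm u)\<^sup>2 \<le> inner (P (x k) u) u"
      using A x(1) unfolding hypothesis_A_def by metis
    obtain n0 where n0: "1 / real (Suc n0) < C0" using nat_approx_posE[OF C0(1)] by blast
    \<comment> \<open>Beyond the index in (D4), and with 1/(n+1) below its constant.\<close>
    define n where "n = max k0 n0"
    have "1 / real (Suc n) \<le> 1 / real (Suc n0)" by (intro divide_left_mono) (auto simp: n_def)
    then have nC: "1 / real (Suc n) \<le> C0" using n0 by linarith
    have "1 / real (Suc n) * (norm u)\<^sup>2 \<le> inner (P (x n) u) u" for u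
      using mult_right_mono[OF nC, of "(norm u)\<^sup>2"] C0(2)[of n u] by (simp add: n_def)
    then show "\<exists>n. \<forall>u. 1 / real (Suc n) * (norm u)\<^sup>2 \<le> inner (P (x n) u) u" by blast
  qed (rule that)
  define C where "C = 1 / real (Suc n1)"
  have C: "0 < C" "C * (norm u)\<^sup>2 \<le> inner (P y u) u" if "y \<in> ball 0 r1" for y u
    using P1[OF that] by (simp_all add: C_def)
  have r1_0: "0 \<in> ball (0::'h) r1" using r1 by simp
  interpret cp: compact_perturbation "B 0" "P 0" "Q 0" C
    by unfold_locales (use saB BPQ cQ V(2) C[OF r1_0] in auto)
  obtain pp pn a0 F where os: "orth_splitting pp pn" and a0: "0 < a0"
    and sp: "pos_space (B 0) = {x. pp x = x}" "neg_space (B 0) = {x. pn x = x}"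
      "null_space (B 0) = {x. pp x = 0 \<and> pn x = 0}"
    and gapp: "\<And>u. pp u = u \<Longrightarrow> a0 * (norm u)\<^sup>2 \<le> inner (B 0 u) u"
    and gapn: "\<And>u. pn u = u \<Longrightarrow> inner (B 0 u) u \<le> - a0 * (norm u)\<^sup>2"
    and F: "finite F" "\<And>e. e \<in> F \<Longrightarrow> norm e = 1" "\<And>u. pn u = u \<Longrightarrow> u = (\<Sum>e\<in>F. inner u e *\<^sub>R e)"
    by (rule cp.spectral_splitting) (rule that)
  interpret orth_splitting pp pn by (rule os)
  have subM: "subspace {x. pp x = x}"
    by (auto intro!: subspaceI simp: pp_simps)
  have clM: "closed {x. pp x = x}"
    by (intro closed_Collect_eq continuous_intros linear_continuous_on[OF bounded_linear_pp])
  obtain n2 r2 where r2: "0 < r2"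
    and B2: "\<And>y. y \<in> ball 0 r2 \<Longrightarrow> \<forall>u. pp u = u \<longrightarrow> 1 / real (Suc n2) * (norm u)\<^sup>2 \<le> inner (B y u) u"
  \<comment> \<open>Sequences inside \<open>ball 0 r1\<close> share the single coercivity constant
    \<open>C\<close>.\<close>
  proof (rule ball_of_sequences[OF open_ball r1_0])
    fix x :: "nat \<Rightarrow> 'h" assume x: "range x \<subseteq> ball 0 r1" "x \<longlonglongrightarrow> 0"
    show "\<exists>n. \<forall>u. pp u = u \<longrightarrow> 1 / real (Suc n) * (norm u)\<^sup>2 \<le> inner (B (x n) u) u"
    proof (rule ccontr)
      assume "\<not> ?thesis"
      then have "\<forall>n. \<exists>u. pp u = u \<and> inner (B (x n) u) u < 1 / real (Suc n) * (norm u)\<^sup>2"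
        by (meson not_le)
      then obtain u where u: "\<And>n. pp (u n) = u n"
        "\<And>n. inner (B (x n) (u n)) (u n) < 1 / real (Suc n) * (norm (u n))\<^sup>2" by metis
      have u0: "u n \<noteq> 0" for n using u(2)[of n] by auto
      \<comment> \<open>Normalised counterexamples; compactness of \<open>Q 0\<close> provides the
        convergent images that \<open>coercive_limit_contradiction\<close> asks for.\<close>
      define v where "v n = (1 / norm (u n)) *\<^sub>R u n" for n
      have v1: "norm (v n) = 1" "pp (v n) = v n" for n using u0 u by (auto simp: v_def pp_simps)
      have vB: "inner (B (x n) (v n)) (v n) \<le> 1 / real (Suc n)" for n
      proof -
        have "inner (B (x n) (v n)) (v n) = inner (B (x n) (u n)) (u n) / (norm (u n))\<^sup>2"
          by (simp add: v_def blinfun.scaleR_right power2_eq_square)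
        also have "\<dots> \<le> 1 / real (Suc n)"
          using u(2)[of n] u0[of n] by (simp add: field_simps)
        finally show ?thesis .
      qed
      obtain y r where r: "strict_mono (r :: nat \<Rightarrow> nat)" and y: "(\<lambda>n. Q 0 (v (r n))) \<longlonglongrightarrow> y"
        by (rule compact_op_subsequence[OF cQ[OF V(2)], of v]) (auto simp: v1 intro: that)
      have xr: "range (\<lambda>n. x (r n)) \<subseteq> V" using x(1) r1(2) by blast
      have xr0: "(\<lambda>n. x (r n)) \<longlonglongrightarrow> 0" using LIMSEQ_subseq_LIMSEQ[OF x(2) r] by (simp add: o_def)
      have xrV: "x (r k) \<in> V" "x (r k) \<in> ball 0 r1" for k using xr x(1) by blast+
      have e0: "(\<lambda>n. 1 / real (Suc (r n))) \<longlonglongrightarrow> 0"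
        using LIMSEQ_subseq_LIMSEQ[OF LIMSEQ_Suc[OF lim_1_over_n] r] by (simp add: o_def)
      show False
      proof (rule coercive_limit_contradiction[where Pk = "\<lambda>k. P (x (r k))" and Qk = "\<lambda>k. Q (x (r k))"
            and P = "P 0" and Q = "Q 0" and M = "{x. pp x = x}" and C = C and l = a0
            and u = "\<lambda>k. v (r k)" and y = y and e = "\<lambda>k. 1 / real (Suc (r k))"])
        show "inner (P (x (r k)) w) z = inner w (P (x (r k)) z)" for k w z by (rule saP[OF xrV(1)])
        show "0 < C" by (rule C(1)[OF r1_0])
        show "C * (norm w)\<^sup>2 \<le> inner (P (x (r k)) w) w" for k w by (rule C(2)[OF xrV(2)])
        show "(\<lambda>k. P (x (r k)) w) \<longlonglongrightarrow> P 0 w" for w by (rule Plim[OF xr xr0])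
        show "(\<lambda>k. Q (x (r k))) \<longlonglongrightarrow> Q 0" by (rule Qlim[OF xr xr0])
        show "subspace {x. pp x = x}" "closed {x. pp x = x}" by (rule subM, rule clM)
        show "0 < a0" by (rule a0)
        show "a0 * (norm w)\<^sup>2 \<le> inner (P 0 w + Q 0 w) w" if "w \<in> {x. pp x = x}" for w
          using gapp[of w] that BPQ[OF V(2)] by (simp add: blinfun.add_left)
        show "inner (P (x (r k)) (v (r k)) + Q (x (r k)) (v (r k))) (v (r k)) \<le> 1 / real (Suc (r k))" for k
          using vB[of "r k"] BPQ[OF xrV(1)] by (simp add: blinfun.add_left)
      qed (use v1 y e0 in auto)
    qed
  qed (rule that)
  obtain r3 where r3: "0 < r3"
    and B3: "\<And>y. y \<in> ball 0 r3 \<Longrightarrow> \<forall>u. pn u = u \<longrightarrow> inner (B y u) u \<le> - (a0 / 2) * (norm u)\<^sup>2"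
  proof (rule ball_of_sequences[OF V])
    fix x :: "nat \<Rightarrow> 'h" assume x: "range x \<subseteq> V" "x \<longlonglongrightarrow> 0"
    \<comment> \<open>Strong convergence on the finite basis \<open>F\<close> controls
      \<open>B (x k) - B 0\<close> on all of H^-; an error below a0/2 costs half of the gap.\<close>
    have "(\<lambda>k. \<Sum>e\<in>F. norm (B (x k) e - B 0 e)) \<longlonglongrightarrow> (\<Sum>e\<in>F. norm (B 0 e - B 0 e))"
      by (intro tendsto_sum tendsto_norm tendsto_diff Blim[OF x] tendsto_const)
    then have "(\<lambda>k. \<Sum>e\<in>F. norm (B (x k) e - B 0 e)) \<longlonglongrightarrow> 0" by simp
    then have "\<forall>\<^sub>F k in sequentially. (\<Sum>e\<in>F. norm (B (x k) e - B 0 e)) < a0 / 2"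
      using a0 by (intro order_tendstoD(2)) auto
    then obtain n where n: "(\<Sum>e\<in>F. norm (B (x n) e - B 0 e)) < a0 / 2"
      by (meson eventually_happens' sequentially_bot)
    have "inner (B (x n) u) u \<le> - (a0 / 2) * (norm u)\<^sup>2" if u: "pn u = u" for u
    proof -
      define D where "D = B (x n) - B 0"
      have "D u = (\<Sum>e\<in>F. inner u e *\<^sub>R D e)"
        by (subst F(3)[OF u]) (simp add: blinfun.sum_right blinfun.scaleR_right)
      then have "norm (D u) \<le> (\<Sum>e\<in>F. norm (inner u e *\<^sub>R D e))" by (simp only: norm_sum)
      also have "\<dots> \<le> (\<Sum>e\<in>F. norm u * norm (D e))"
      proof (intro sum_mono)
        fix e assume "e \<in> F"
        then have "\<bar>inner u e\<bar> \<le> norm u" using Cauchy_Schwarz_ineq2[of u e] F(2) by simp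
        then show "norm (inner u e *\<^sub>R D e) \<le> norm u * norm (D e)" by (simp add: mult_right_mono)
      qed
      also have "\<dots> = norm u * (\<Sum>e\<in>F. norm (B (x n) e - B 0 e))"
        by (simp add: sum_distrib_left D_def blinfun.diff_left)
      also have "\<dots> \<le> norm u * (a0 / 2)" using n by (intro mult_left_mono) auto
      finally have Du: "norm (D u) \<le> norm u * (a0 / 2)" .
      have "inner (D u) u \<le> norm (D u) * norm u" by (rule norm_cauchy_schwarz)
      also have "\<dots> \<le> norm u * (a0 / 2) * norm u" using Du by (intro mult_right_mono) auto
      finally have "inner (B (x n) u) u - inner (B 0 u) u \<le> a0 / 2 * (norm u)\<^sup>2"
        by (simp add: D_def blinfun.diff_left inner_simps power2_eq_square mult_ac)
      then show ?thesis using gapn[OF u] by (simp add: algebra_simps)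
    qed
    then show "\<exists>n. \<forall>u. pn u = u \<longrightarrow> inner (B (x n) u) u \<le> - (a0 / 2) * (norm u)\<^sup>2" by blast
  qed (rule that)
  obtain n4 r4 where r4: "0 < r4" and B4: "\<And>y. y \<in> ball 0 r4 \<Longrightarrow> norm (B y) \<le> real n4"
  proof (rule ball_of_sequences[OF V])
    fix x :: "nat \<Rightarrow> 'h" assume x: "range x \<subseteq> V" "x \<longlonglongrightarrow> 0"
    obtain K where K: "\<And>n. norm (B (x n)) \<le> K"
      by (rule uniform_boundedness[of "\<lambda>n. B (x n)"])
        (auto intro: convergent_imp_bounded[OF Blim[OF x]] that)
    obtain n where "K \<le> real n" using real_arch_simple by blast
    then show "\<exists>n. norm (B (x n)) \<le> real n" using K order_trans by blast
  qed (rule that)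
  define \<rho> where "\<rho> = min (min r1 r2) (min r3 r4)"
  define a where "a = min (1 / real (Suc n2)) (a0 / 2)"
  \<comment> \<open>The maximum ensures a <= K, as the contraction argument assumes.\<close>
  define K where "K = max a (real n4)"
  have \<rho>: "0 < \<rho>" "ball 0 \<rho> \<subseteq> V" using r1 r2 r3 r4 by (auto simp: \<rho>_def)
  have a: "0 < a" using a0 by (simp add: a_def)
  have B2': "a * (norm (pp u))\<^sup>2 \<le> inner (B y (pp u)) (pp u)" if "y \<in> ball 0 \<rho>" for y u
  proof -
    have "a * (norm (pp u))\<^sup>2 \<le> 1 / real (Suc n2) * (norm (pp u))\<^sup>2"
      by (intro mult_right_mono) (auto simp: a_def)
    also have "\<dots> \<le> inner (B y (pp u)) (pp u)" using B2[of y] that pp_idem by (auto simp: \<rho>_def)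
    finally show ?thesis .
  qed
  have B3': "a * (norm (pn u))\<^sup>2 \<le> - inner (B y (pn u)) (pn u)" if "y \<in> ball 0 \<rho>" for y u
  proof -
    have "a * (norm (pn u))\<^sup>2 \<le> a0 / 2 * (norm (pn u))\<^sup>2"
      by (intro mult_right_mono) (auto simp: a_def)
    also have "\<dots> \<le> - inner (B y (pn u)) (pn u)" using B3[of y] that pn_idem[of u] by (fastforce simp: \<rho>_def)
    finally show ?thesis .
  qed
  have BK: "norm (B y) \<le> K" if "y \<in> ball 0 \<rho>" for y using B4[of y] that by (simp add: \<rho>_def K_def)
  have grad: "(L has_derivative (\<lambda>h. inner h (gradient L x))) (at x)" if "x \<in> V" for x
  proof -
    obtain f' :: "'h \<Rightarrow> 'h \<Rightarrow>\<^sub>L real" where "(L has_derivative blinfun_apply (f' x)) (at x within V)"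
      using C1 \<open>x \<in> V\<close> unfolding C1_on_def by blast
    then show ?thesis using has_derivative_gradient at_within_open[OF \<open>x \<in> V\<close> V(1)] by metis
  qed
  have mv: "\<exists>c\<in>ball 0 \<rho>. inner (gradient L x - gradient L y) w = inner (B c (x - y)) w"
    if "x \<in> ball 0 \<rho>" "y \<in> ball 0 \<rho>" for x y w
    by (rule gateaux_mean_value[of \<rho> "gradient L" B x y w]) (use gat \<rho>(2) that in auto)
  have sf: "splitting_functional pp pn L (gradient L) \<rho> a K"
  proof (intro splitting_functional.intro os splitting_functional_axioms.intro)
    show "0 < \<rho>" "0 < a" "a \<le> K" using \<rho> a by (auto simp: K_def)
    show "(L has_derivative (\<lambda>h. inner h (gradient L x))) (at x)" if "x \<in> ball 0 \<rho>" for x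
      using grad that \<rho>(2) by blast
    have "(\<lambda>h. inner h (gradient L 0)) = (\<lambda>_. 0)"
      by (rule has_derivative_unique[OF grad[OF V(2)] crit])
    then have "inner (gradient L 0) (gradient L 0) = 0" by metis
    then show "gradient L 0 = 0" by simp
    fix x y :: 'h assume xy: "x \<in> ball 0 \<rho>" "y \<in> ball 0 \<rho>"
    show "norm (gradient L x - gradient L y) \<le> K * norm (x - y)"
    proof (cases "gradient L x = gradient L y")
      case False
      \<comment> \<open>Testing with the gradient difference itself turns the scalar mean value
        theorem into a norm bound.\<close>
      define w where "w = gradient L x - gradient L y"
      have w: "0 < norm w" using False by (simp add: w_def)
      obtain c where c: "c \<in> ball 0 \<rho>" "inner w w = inner (B c (x - y)) w"
        using mv[OF xy, of w] by (auto simp: w_def)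
      have "inner (B c (x - y)) w \<le> norm (B c (x - y)) * norm w" by (rule norm_cauchy_schwarz)
      also have "\<dots> \<le> norm (B c) * norm (x - y) * norm w" by (intro mult_right_mono norm_blinfun) auto
      also have "\<dots> \<le> K * norm (x - y) * norm w" using BK[OF c(1)] by (intro mult_right_mono) auto
      finally have "norm w * norm w \<le> K * norm (x - y) * norm w"
        using c(2) by (simp add: power2_norm_eq_inner[symmetric] power2_eq_square)
      then show ?thesis using w by (simp add: w_def)
    qed (use a in \<open>simp add: K_def\<close>)
    show "a * (norm (x - y))\<^sup>2 \<le> inner (gradient L x - gradient L y) (pp (x - y) - pn (x - y))"
      if d: "pp (x - y) + pn (x - y) = x - y"
    proof -
      define p q where "p = pp (x - y)" and "q = pn (x - y)"
      obtain c where c: "c \<in> ball 0 \<rho>"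
        "inner (gradient L x - gradient L y) (p - q) = inner (B c (x - y)) (p - q)"
        using mv[OF xy, of "p - q"] by auto
      \<comment> \<open>With the test vector p - q the mixed terms cancel by self-adjointness,
        leaving one term for each sign.\<close>
      have "inner (B c q) p = inner (B c p) q" using saB[of c q p] c(1) \<rho>(2) by (auto simp: inner_commute)
      then have "inner (B c (p + q)) (p - q) = inner (B c p) p - inner (B c q) q"
        by (simp add: blinfun.add_right inner_simps)
      moreover have "p + q = x - y" using d by (simp add: p_def q_def)
      moreover have "(norm (p + q))\<^sup>2 = (norm p)\<^sup>2 + (norm q)\<^sup>2" unfolding p_def q_def by (rule norm_add_pp_pn)
      moreover have "a * (norm p)\<^sup>2 \<le> inner (B c p) p" "a * (norm q)\<^sup>2 \<le> - inner (B c q) q"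
        unfolding p_def q_def by (rule B2'[OF c(1)], rule B3'[OF c(1)])
      ultimately show ?thesis using c(2) unfolding p_def[symmetric] q_def[symmetric]
        by (metis (no_types, lifting) add_mono diff_conv_add_uminus distrib_left)
    qed
  qed
  show thesis by (rule that[OF sf \<rho>(2) sp])
qed

section \<open>The splitting theorem\<close>

text \<open>A derivative within a set that is not open is determined in the directions that enter
  the set; at points of a ball of H^0 these include all of H^0.\<close>

lemma has_derivative_unique_direction:
  assumes A: "(f has_derivative A) (at z within S)" and B: "(f has_derivative B) (at z within S)"
    and d: "0 < d" "\<And>t. 0 < t \<Longrightarrow> t < d \<Longrightarrow> z + t *\<^sub>R v \<in> S"
  shows "A v = B v"
proof -
  define D where "D h = A h - B h" for h
  have D: "((\<lambda>x. f x - f x) has_derivative D) (at z within S)"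
    unfolding D_def by (rule has_derivative_diff[OF A B])
  interpret bounded_linear D using D by (rule has_derivative_bounded_linear)
  have "norm (D v) \<le> 0 + e" if e: "0 < e" for e
  proof -
    define e' where "e' = e / (norm v + 1)"
    have nv: "0 < norm v + 1" by (simp add: add_nonneg_pos)
    have e': "0 < e'" "e' * norm v \<le> e" using e nv by (auto simp: e'_def field_simps)
    obtain r where r: "0 < r" "\<And>y. y \<in> S \<Longrightarrow> norm (y - z) < r \<Longrightarrow> norm (D (y - z)) \<le> e' * norm (y - z)"
      using D e' unfolding has_derivative_within_alt by auto
    define t where "t = min (d / 2) (r / 2 / (norm v + 1))"
    have t: "0 < t" "t < d" using d r nv by (auto simp: t_def)
    have "t * norm v \<le> r / 2 / (norm v + 1) * norm v" by (intro mult_right_mono) (auto simp: t_def)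
    also have "\<dots> \<le> r / 2 / (norm v + 1) * (norm v + 1)" using r nv by (intro mult_left_mono) auto
    also have "\<dots> = r / 2" using nv by (metis less_irrefl nonzero_mult_div_cancel_right times_divide_eq_left)
    also have "\<dots> < r" using r by simp
    finally have "norm (D (t *\<^sub>R v)) \<le> e' * norm (t *\<^sub>R v)"
      using r(2)[OF d(2)[OF t]] t by simp
    then have "t * norm (D v) \<le> t * (e' * norm v)" using t by (simp add: scaleR mult_ac)
    then show ?thesis using t e' by simp
  qed
  then have "norm (D v) \<le> 0" by (rule field_le_epsilon)
  then show ?thesis by (simp add: D_def)
qed

section \<open>Uniqueness of the solution and regularity of the reduced functional\<close>

context reduced_splitting begin

lemma orth_proj_H0: "orth_proj H0 x = p0 x"
  unfolding orth_proj_def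
proof (rule the_equality)
  have o: "inner (x - p0 x) v = 0" if "v \<in> H0" for v
    using that by (simp add: p0_def inner_simps pp_adj pn_adj H0_def)
  have p: "p0 x \<in> H0" by (simp add: H0_def pp_p0 pn_p0)
  show "p0 x \<in> H0 \<and> (\<forall>v\<in>H0. inner (x - p0 x) v = 0)" using o p by blast
  fix y assume y: "y \<in> H0 \<and> (\<forall>v\<in>H0. inner (x - y) v = 0)"
  then have "y - p0 x \<in> H0" using p by (simp add: H0_def pp_simps pn_simps)
  then have "inner (x - p0 x) (y - p0 x) - inner (x - y) (y - p0 x) = 0" using o y by simp
  then have "inner (y - p0 x) (y - p0 x) = 0" by (simp add: inner_diff_left)
  then show "y = p0 x" by simp
qed

lemma H0_projection_eq_iff: "x - orth_proj H0 x = 0 \<longleftrightarrow> pp x = 0 \<and> pn x = 0"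
proof
  assume "x - orth_proj H0 x = 0"
  then have "x = p0 x" by (simp add: orth_proj_H0)
  then show "pp x = 0 \<and> pn x = 0" using pp_p0[of x] pn_p0[of x] by metis
qed (simp add: orth_proj_H0 p0_def)

lemma Hp_plus_Hn: "v \<in> Hp + Hn \<longleftrightarrow> pp v + pn v = v"
proof
  assume "v \<in> Hp + Hn"
  then obtain x y where v: "v = x + y" and x: "pp x = x" and y: "pn y = y"
    by (auto simp: set_plus_def Hp_def Hn_def)
  have "pp y = 0" "pn x = 0" using x y pp_pn[of y] pn_pp[of x] by auto
  then show "pp v + pn v = v" using x y by (simp add: v pp_simps pn_simps)
next
  assume v: "pp v + pn v = v"
  have "pp v + pn v \<in> Hp + Hn" by (intro set_plus_intro) (auto simp: Hp_def Hn_def pp_simps pn_simps)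
  then show "v \<in> Hp + Hn" unfolding v .
qed

lemma convex_D0: "convex D0"
proof -
  have "subspace H0" unfolding H0_def by (auto intro!: subspaceI simp: pp_simps pn_simps)
  then show ?thesis unfolding D0_def sub_ball_def
    by (intro convex_Int convex_ball) (rule subspace_imp_convex)
qed

lemma continuous_on_zphi: "continuous_on D0 (\<lambda>z. z + \<phi> z)"
  by (intro continuous_intros continuous_on_subset[OF continuous_on_phi]) (auto dest: D0D)

lemma lipschitz_zphi:
  assumes "z \<in> D0" "z' \<in> D0"
  shows "dist (z + \<phi> z) (z' + \<phi> z') \<le> (1 + K / a) * dist z z'"
proof -
  have k: "norm (\<phi> z - \<phi> z') \<le> K / a * norm (z - z')" using \<phi>(5) D0D(3) assms by blast
  have "norm (z + \<phi> z - (z' + \<phi> z')) \<le> norm (z - z') + norm (\<phi> z - \<phi> z')"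
    by (rule order_trans[OF _ norm_triangle_ineq]) (simp add: algebra_simps)
  then show ?thesis using k by (simp add: algebra_simps dist_norm)
qed

lemma reduced_solution_phi:
  assumes V: "ball 0 \<rho> \<subseteq> V" and g: "g = gradient L"
  shows "reduced_solution V L Hp H0 Hn \<epsilon> \<phi>"
  unfolding reduced_solution_def D0_def[symmetric] H0_projection_eq_iff
proof (intro conjI ballI)
  show "continuous_on D0 \<phi>" by (rule continuous_on_subset[OF continuous_on_phi]) (auto dest: D0D)
  show "\<phi> ` D0 \<subseteq> Hp + Hn" using \<phi>(1) D0D(3) by (auto simp: Hp_plus_Hn)
  show "\<phi> 0 = 0" by (rule phi_0)
  fix z assume z: "z \<in> D0"
  show "z + \<phi> z \<in> V" using zphi_ball(1)[OF D0D(3)[OF z]] V by blast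
  show "pp (gradient L (z + \<phi> z)) = 0" "pn (gradient L (z + \<phi> z)) = 0"
    using \<phi>(2,3)[OF D0D(3)[OF z]] by (simp_all add: g)
qed

text \<open>Any solution agrees with \<open>\<phi>\<close> where it is small; this set is open and closed in the ball.\<close>

lemma reduced_solution_unique:
  assumes V: "ball 0 \<rho> \<subseteq> V" and g: "g = gradient L"
    and \<psi>: "reduced_solution V L Hp H0 Hn \<epsilon> \<psi>" and z: "z \<in> D0"
  shows "\<psi> z = \<phi> z"
proof -
  have c: "continuous_on D0 \<psi>" and im: "\<And>z. z \<in> D0 \<Longrightarrow> pp (\<psi> z) + pn (\<psi> z) = \<psi> z" and \<psi>0: "\<psi> 0 = 0"
    and eq: "\<And>z. z \<in> D0 \<Longrightarrow> pp (g (z + \<psi> z)) = 0 \<and> pn (g (z + \<psi> z)) = 0"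
    using \<psi> unfolding reduced_solution_def D0_def[symmetric] H0_projection_eq_iff g
    by (auto simp: Hp_plus_Hn)
  have small: "norm z < \<rho> / 8" "norm (\<phi> z) < \<rho> / 2" if "z \<in> D0" for z
  proof -
    have "2 * \<epsilon> \<le> (1 + K / a) * \<epsilon>" using Ka size by (intro mult_right_mono) auto
    then have "\<epsilon> \<le> \<rho> / 16" using size \<delta>_le by linarith
    then show 1: "norm z < \<rho> / 8" using D0D(4)[OF that] pos by linarith
    have "norm (\<phi> z) \<le> norm (z + \<phi> z) + norm z" using norm_triangle_ineq4[of "z + \<phi> z" z] by simp
    then show "norm (\<phi> z) < \<rho> / 2" using 1 norm_zphi[OF D0D(3)[OF that]] \<delta>_le pos by linarith
  qed
  define T where "T = {z \<in> D0. \<psi> z = \<phi> z}"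
  \<comment> \<open>Where \<open>\<psi> z\<close> is small, \<open>z + \<psi> z\<close> lies in the
    ball of monotonicity and \<open>reduced_unique\<close> applies; elsewhere
    \<open>\<psi> z\<close> might a priori be far away. As \<open>\<phi>\<close> obeys the same
    bound, equality is equivalent to an open condition.\<close>
  have T: "T = D0 \<inter> \<psi> -` ball 0 (\<rho> / 2)"
  proof (intro equalityI subsetI)
    fix z assume "z \<in> T" then show "z \<in> D0 \<inter> \<psi> -` ball 0 (\<rho> / 2)" using small by (auto simp: T_def)
  next
    fix z assume "z \<in> D0 \<inter> \<psi> -` ball 0 (\<rho> / 2)"
    then have z: "z \<in> D0" "norm (\<psi> z) < \<rho> / 2" by auto
    have "norm (z + \<psi> z) < \<rho>" using norm_triangle_ineq[of z "\<psi> z"] small(1)[OF z(1)] z(2) pos by linarith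
    then have b: "z + \<psi> z \<in> ball 0 \<rho>" by simp
    have "z + \<psi> z = z + \<phi> z"
    proof (rule reduced_unique[OF b zphi_ball(1)[OF D0D(3)[OF z(1)]]])
      have "pp (\<psi> z - \<phi> z) + pn (\<psi> z - \<phi> z) = (pp (\<psi> z) + pn (\<psi> z)) - (pp (\<phi> z) + pn (\<phi> z))"
        by (simp add: pp_simps pn_simps)
      then show "pp (z + \<psi> z - (z + \<phi> z)) + pn (z + \<psi> z - (z + \<phi> z)) = z + \<psi> z - (z + \<phi> z)"
        using im[OF z(1)] \<phi>(1)[OF D0D(3)[OF z(1)]] by simp
    qed (use eq[OF z(1)] \<phi>(2,3)[OF D0D(3)[OF z(1)]] in auto)
    then show "z \<in> T" using z by (simp add: T_def)
  qed
  have "openin (top_of_set D0) T"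
    unfolding T by (rule continuous_openin_preimage_gen[OF c open_ball])
  moreover have "closedin (top_of_set D0) T"
  proof -
    have "T = {z \<in> D0. \<psi> z - \<phi> z = 0}" by (auto simp: T_def)
    moreover have "continuous_on D0 (\<lambda>z. \<psi> z - \<phi> z)"
      by (intro continuous_intros c continuous_on_subset[OF continuous_on_phi]) (auto dest: D0D)
    ultimately show ?thesis using continuous_closedin_preimage_constant by metis
  qed
  moreover have "0 \<in> T" using zero_D0 \<psi>0 phi_0 by (simp add: T_def)
  ultimately have "T = D0"
    using convex_connected[OF convex_D0] unfolding connected_clopen by blast
  then show ?thesis using z by (auto simp: T_def)
qed

text \<open>The derivative of L is composed with the Lipschitz map z + \<phi> z, so continuity and
  local Lipschitz continuity pass to the reduced functional.\<close>

lemma derivative_witness: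
  assumes V: "open V" "ball 0 \<rho> \<subseteq> V" and z: "z \<in> D0"
    and f': "\<And>x. x \<in> V \<Longrightarrow> (L has_derivative blinfun_apply (f' x)) (at x within V)"
  shows "((\<lambda>z. L (z + \<phi> z)) has_derivative blinfun_apply (f' (z + \<phi> z))) (at z within D0)"
proof -
  have b: "z + \<phi> z \<in> ball 0 \<rho>" by (rule zphi_ball(1)[OF D0D(3)[OF z]])
  then have v: "z + \<phi> z \<in> V" using V by blast
  have "(L has_derivative blinfun_apply (f' (z + \<phi> z))) (at (z + \<phi> z))"
    using f'[OF v] at_within_open[OF v V(1)] by simp
  then have "blinfun_apply (f' (z + \<phi> z)) = (\<lambda>h. inner h (g (z + \<phi> z)))"
    by (rule has_derivative_unique[OF _ deriv[OF b]])
  then show ?thesis using reduced_derivative[OF z] by simp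
qed

lemma C1_on_reduced:
  assumes V: "open V" "ball 0 \<rho> \<subseteq> V" and C1: "C1_on V L"
  shows "C1_on D0 (\<lambda>z. L (z + \<phi> z))"
proof -
  obtain f' :: "'a \<Rightarrow> 'a \<Rightarrow>\<^sub>L real" where f': "\<And>x. x \<in> V \<Longrightarrow> (L has_derivative blinfun_apply (f' x)) (at x within V)"
    and c: "continuous_on V f'"
    using C1 unfolding C1_on_def by blast
  have "continuous_on D0 (\<lambda>z. f' (z + \<phi> z))"
    using zphi_ball(1)[OF D0D(3)] V(2)
    by (intro continuous_on_compose2[OF c continuous_on_zphi]) blast
  then show ?thesis using derivative_witness[OF V _ f'] unfolding C1_on_def
    by (intro exI[of _ "\<lambda>z. f' (z + \<phi> z)"]) auto
qed

lemma C2m_on_reduced: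
  assumes V: "open V" "ball 0 \<rho> \<subseteq> V" and C2: "C2m_on V L"
  shows "C2m_on D0 (\<lambda>z. L (z + \<phi> z))"
proof -
  obtain f' :: "'a \<Rightarrow> 'a \<Rightarrow>\<^sub>L real" where f': "\<And>x. x \<in> V \<Longrightarrow> (L has_derivative blinfun_apply (f' x)) (at x within V)"
    and lip: "locally_lipschitz_on V f'"
    using C2 unfolding C2m_on_def by blast
  have zV: "z + \<phi> z \<in> V" if "z \<in> D0" for z using zphi_ball(1)[OF D0D(3)[OF that]] V(2) by blast
  define k where "k = 1 + K / a"
  have k: "0 < k" using Ka by (simp add: k_def)
  have "locally_lipschitz_on D0 (\<lambda>z. f' (z + \<phi> z))"
    unfolding locally_lipschitz_on_def
  proof
    fix z assume z: "z \<in> D0"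
    obtain u C where u: "0 < u" and C: "C-lipschitz_on (cball (z + \<phi> z) u \<inter> V) f'"
      using lip zV[OF z] unfolding locally_lipschitz_on_def by blast
    have inc: "x + \<phi> x \<in> cball (z + \<phi> z) u \<inter> V" if x: "x \<in> cball z (u / k) \<inter> D0" for x
    proof -
      have "dist (z + \<phi> z) (x + \<phi> x) \<le> k * dist z x" using lipschitz_zphi[OF z] x by (simp add: k_def)
      also have "\<dots> \<le> k * (u / k)" using x k by (intro mult_left_mono) auto
      finally show ?thesis using k x zV by simp
    qed
    have "(C * k)-lipschitz_on (cball z (u / k) \<inter> D0) (\<lambda>z. f' (z + \<phi> z))"
    proof (rule lipschitz_onI)
      show "0 \<le> C * k" using lipschitz_on_nonneg[OF C] k by simp
      fix x y assume xy: "x \<in> cball z (u / k) \<inter> D0" "y \<in> cball z (u / k) \<inter> D0"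
      have "dist (f' (x + \<phi> x)) (f' (y + \<phi> y)) \<le> C * dist (x + \<phi> x) (y + \<phi> y)"
        by (rule lipschitz_onD[OF C inc[OF xy(1)] inc[OF xy(2)]])
      also have "\<dots> \<le> C * (k * dist x y)"
        using lipschitz_zphi[of x y] xy lipschitz_on_nonneg[OF C] by (intro mult_left_mono) (auto simp: k_def)
      finally show "dist (f' (x + \<phi> x)) (f' (y + \<phi> y)) \<le> C * k * dist x y" by (simp add: mult.assoc)
    qed
    then show "\<exists>u>0. \<exists>C. C-lipschitz_on (cball z u \<inter> D0) (\<lambda>z. f' (z + \<phi> z))"
      using u k by (intro exI[of _ "u / k"]) auto
  qed
  then show ?thesis using derivative_witness[OF V _ f'] unfolding C2m_on_def
    by (intro exI[of _ "\<lambda>z. f' (z + \<phi> z)"]) auto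
qed

text \<open>\<open>frechet_derivative\<close> within the ball is a choice among derivatives that may
  differ off H^0. For v in H^0 a short segment from z in direction v stays in the ball, which fixes
  the value.\<close>

lemma frechet_derivative_reduced:
  assumes z: "z \<in> D0" and v: "v \<in> H0"
  shows "frechet_derivative (\<lambda>z. L (z + \<phi> z)) (at z within D0) v = frechet_derivative L (at (z + \<phi> z)) v"
proof -
  let ?D = "\<lambda>h. inner h (g (z + \<phi> z))"
  have "((\<lambda>z. L (z + \<phi> z)) has_derivative frechet_derivative (\<lambda>z. L (z + \<phi> z)) (at z within D0)) (at z within D0)"
    using reduced_derivative[OF z] differentiableI frechet_derivative_works by blast
  then have "frechet_derivative (\<lambda>z. L (z + \<phi> z)) (at z within D0) v = ?D v"
  proof (rule has_derivative_unique_direction[OF _ reduced_derivative[OF z]])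
    show "0 < (\<epsilon> - norm z) / (norm v + 1)" using D0D(4)[OF z] by (simp add: add_nonneg_pos)
    fix t assume t: "0 < t" "t < (\<epsilon> - norm z) / (norm v + 1)"
    have "t * norm v \<le> t * (norm v + 1)" using t by simp
    also have "\<dots> < \<epsilon> - norm z" using t by (simp add: pos_less_divide_eq add_nonneg_pos)
    finally have "norm (z + t *\<^sub>R v) < \<epsilon>" using t norm_triangle_ineq[of z "t *\<^sub>R v"] by simp
    then show "z + t *\<^sub>R v \<in> D0"
      using v D0D(1,2)[OF z] by (simp add: D0_def sub_ball_def H0_def pp_simps pn_simps)
  qed
  moreover have "?D = frechet_derivative L (at (z + \<phi> z))"
    by (rule frechet_derivative_at[OF deriv[OF zphi_ball(1)[OF D0D(3)[OF z]]]])
  ultimately show ?thesis by metis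
qed

lemma locally_lipschitz_phi: "locally_lipschitz_on D0 \<phi>"
  unfolding locally_lipschitz_on_def
proof
  fix z assume "z \<in> D0"
  have "(K / a)-lipschitz_on (cball z 1 \<inter> D0) \<phi>"
  proof (rule lipschitz_onI)
    show "dist (\<phi> x) (\<phi> y) \<le> K / a * dist x y" if "x \<in> cball z 1 \<inter> D0" "y \<in> cball z 1 \<inter> D0" for x y
      unfolding dist_norm using \<phi>(5) D0D(3) that by blast
  qed (use Ka in simp)
  then show "\<exists>u>0. \<exists>C. C-lipschitz_on (cball z u \<inter> D0) \<phi>" by (intro exI[of _ 1]) auto
qed

end

theorem theorem2p2:
  fixes V :: "'h::{real_inner,complete_space} set"
    and L :: "'h \<Rightarrow> real"
    and B P Q :: "'h \<Rightarrow> 'h \<Rightarrow>\<^sub>L 'h"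
    and Hp H0 Hn :: "'h set"
  assumes "open V" and "0 \<in> V"
    and "C1_on V L"
    and "(L has_derivative (\<lambda>_. 0)) (at 0)"
    and "hypothesis_A V L B P Q"
    and "Hp = pos_space (B 0)" and "H0 = null_space (B 0)" and "Hn = neg_space (B 0)"
    and "dim H0 \<noteq> 0"
  shows "\<exists>\<epsilon>>0. \<exists>r>0. \<exists>s>0. \<exists>\<phi>.
    reduced_solution V L Hp H0 Hn \<epsilon> \<phi> \<and>
    (\<forall>\<psi>. reduced_solution V L Hp H0 Hn \<epsilon> \<psi> \<longrightarrow> (\<forall>z\<in>sub_ball H0 \<epsilon>. \<psi> z = \<phi> z)) \<and>
    (\<exists>W (\<Phi> :: 'h \<times> 'h \<Rightarrow> 'h) \<Phi>' (\<phi>\<^sub>z :: 'h \<Rightarrow> 'h \<Rightarrow> 'h).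
      open W \<and> 0 \<in> W \<and> W \<subseteq> V \<and>
      homeomorphism (sub_ball H0 \<epsilon> \<times> (sub_ball Hp r + sub_ball Hn s)) W \<Phi> \<Phi>' \<and>
      \<Phi> (0, 0) = 0 \<and>
      (\<forall>z\<in>sub_ball H0 \<epsilon>. \<forall>up\<in>sub_ball Hp r. \<forall>un\<in>sub_ball Hn s.
         \<Phi> (z, up + un) = z + \<phi> z + \<phi>\<^sub>z z (up + un) \<and>
         \<phi>\<^sub>z z (up + un) \<in> Hp + Hn \<and>
         L (\<Phi> (z, up + un)) = (norm up)\<^sup>2 - (norm un)\<^sup>2 + L (z + \<phi> z)) \<and>
      (\<forall>z\<in>sub_ball H0 \<epsilon>. \<Phi> (z, 0) = z + \<phi> z \<and>
         (\<forall>up\<in>sub_ball Hp r. \<forall>un\<in>sub_ball Hn s.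
            \<phi>\<^sub>z z (up + un) \<in> Hn \<longleftrightarrow> up = 0))) \<and>
    locally_lipschitz_on (sub_ball H0 \<epsilon>) \<phi> \<and>
    C1_on (sub_ball H0 \<epsilon>) (\<lambda>z. L (z + \<phi> z)) \<and>
    (\<forall>z\<in>sub_ball H0 \<epsilon>. \<forall>v\<in>H0.
       frechet_derivative (\<lambda>z. L (z + \<phi> z)) (at z within sub_ball H0 \<epsilon>) v =
       frechet_derivative L (at (z + \<phi> z)) v) \<and>
    (C2m_on V L \<longrightarrow> C2m_on (sub_ball H0 \<epsilon>) (\<lambda>z. L (z + \<phi> z)))"
proof -
  obtain pp pn \<rho> a K where sf: "splitting_functional pp pn L (gradient L) \<rho> a K" and V: "ball 0 \<rho> \<subseteq> V"
    and sp: "pos_space (B 0) = {x. pp x = x}" "neg_space (B 0) = {x. pn x = x}"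
      "null_space (B 0) = {x. pp x = 0 \<and> pn x = 0}"
    by (rule hypothesis_A_splitting_functional[OF assms(1-5)]) (rule that)
  obtain \<phi> \<eta> \<epsilon> \<delta> where "reduced_splitting pp pn L (gradient L) \<rho> a K \<phi> \<eta> \<epsilon> \<delta>"
    by (rule splitting_functional.reduced_splitting_exists[OF sf]) (rule that)
  then interpret RS: reduced_splitting pp pn L "gradient L" \<rho> a K \<phi> \<eta> \<epsilon> \<delta> .
  have H: "Hp = RS.Hp" "Hn = RS.Hn" "H0 = RS.H0"
    using assms(6-8) sp by (auto simp: RS.Hp_def RS.Hn_def RS.H0_def)
  have zW: "0 \<in> RS.W"
  proof -
    have "(0, 0) \<in> RS.Dom" using RS.zero_D0 RS.R_pos by (simp add: RS.mem_box_iff RS.pp_simps RS.pn_simps)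
    then have "RS.\<Phi> (0, 0) \<in> RS.W" using RS.homeomorphism_Phi unfolding homeomorphism_def by blast
    then show ?thesis using RS.Phi_0[OF RS.zero_D0] RS.phi_0 by simp
  qed
  have WV: "RS.W \<subseteq> V" using RS.W_subset_ball V by blast
  have \<Phi>0: "RS.\<Phi> (0, 0) = 0" using RS.Phi_0[OF RS.zero_D0] RS.phi_0 by simp
  have split: "\<exists>W (\<Phi> :: 'h \<times> 'h \<Rightarrow> 'h) \<Phi>' (\<phi>\<^sub>z :: 'h \<Rightarrow> 'h \<Rightarrow> 'h).
      open W \<and> 0 \<in> W \<and> W \<subseteq> V \<and>
      homeomorphism RS.Dom W \<Phi> \<Phi>' \<and>
      \<Phi> (0, 0) = 0 \<and>
      (\<forall>z\<in>RS.D0. \<forall>up\<in>sub_ball RS.Hp RS.r1.R'. \<forall>un\<in>sub_ball RS.Hn RS.r2.R'.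
         \<Phi> (z, up + un) = z + \<phi> z + \<phi>\<^sub>z z (up + un) \<and>
         \<phi>\<^sub>z z (up + un) \<in> RS.Hp + RS.Hn \<and>
         L (\<Phi> (z, up + un)) = (norm up)\<^sup>2 - (norm un)\<^sup>2 + L (z + \<phi> z)) \<and>
      (\<forall>z\<in>RS.D0. \<Phi> (z, 0) = z + \<phi> z \<and>
         (\<forall>up\<in>sub_ball RS.Hp RS.r1.R'. \<forall>un\<in>sub_ball RS.Hn RS.r2.R'.
            \<phi>\<^sub>z z (up + un) \<in> RS.Hn \<longleftrightarrow> up = 0))"
    by (intro exI[of _ RS.W] exI[of _ RS.\<Phi>] exI[of _ RS.\<Psi>] exI[of _ RS.\<phi>z] conjI ballI
        RS.open_W zW WV RS.homeomorphism_Phi \<Phi>0 RS.Phi_properties RS.Phi_0)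
  show ?thesis unfolding H
    by (rule exI[of _ \<epsilon>], rule conjI[OF RS.size(1)], rule exI[of _ RS.r1.R'], rule conjI[OF RS.R_pos(1)],
        rule exI[of _ RS.r2.R'], rule conjI[OF RS.R_pos(2)], rule exI[of _ \<phi>])
      (intro conjI allI impI ballI split[unfolded RS.D0_def] RS.reduced_solution_phi[OF V refl]
        RS.reduced_solution_unique[OF V refl, unfolded RS.D0_def] RS.locally_lipschitz_phi[unfolded RS.D0_def]
        RS.C1_on_reduced[OF assms(1) V assms(3), unfolded RS.D0_def]
        RS.C2m_on_reduced[OF assms(1) V, unfolded RS.D0_def]
        RS.frechet_derivative_reduced[unfolded RS.D0_def])
qed

end
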